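(* For integers $3\le k<\ell$ with $k\nmid\ell$ and $\ell\ge 20k^2$, let $p=p(k,\ell)$ be the smallest prime factor of $\frac{k}{\gcd(k,\ell)}$. The tightness of the lower bound $\gamma(C^k_\ell)\ge\frac1p$ is characterized as follows: 1. If $p=2$, the bound is tight: $\gamma(C^k_\ell)=\frac12$. 2. If $p=3$, the bound is tight: $\gamma(C^k_\ell)=\frac13$. 3. For $p>3$, there exist infinitely many tight cycles $C^k_\ell$ (with integers $3\le k<\ell$, $k\nmid\ell$, $\ell\ge 20k^2$ and $p>3$) for which $\gamma(C^k_\ell)>\frac1p$. For instance, this occurs whenever $k\equiv i\pmod{6i}$ and $\gcd(k,\ell)=i$, for every $i\in\{1,2,3\}$.
   Context: A $k$-uniform hypergraph $G$ has a finite vertex set $V(G)$ and an edge set $E(G)$ consisting of $k$-element subsets of $V(G)$. The codegree of a $(k-1)$-subset $S\subseteq V(G)$ is $|\{v\in V(G): S\cup\{v\}\in E(G)\}|$, where only $k$-sets $S\cup\{v\}$ count, and $\delta_{k-1}(G)$ is the minimum codegree over all $(k-1)$-subsets of $V(G)$. For a $k$-uniform hypergraph $F$, $\mathrm{ex}_{k-1}(n,F)$ is the largest value of $\delta_{k-1}(G)$ over $k$-uniform hypergraphs $G$ on $n$ vertices containing no copy of $F$ (as a not necessarily induced subhypergraph). The codegree Turán density of $F$ is $\gamma(F)=\lim_{n\to\infty}\mathrm{ex}_{k-1}(n,F)/n$ (this limit is known to exist). For $\ell\ge k+1$, the tight cycle $C^k_\ell$ is the $k$-uniform hypergraph on $\ell$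 distinct vertices $v_1,\dots,v_\ell$ with edges $\{v_i,v_{i+1},\dots,v_{i+k-1}\}$ for all $i\in\{1,\dots,\ell\}$, indices modulo $\ell$. The bound $\gamma(C^k_\ell)\ge 1/p$ holds for all $3\le k<\ell$ with $k\nmid \ell$; "tight" means equality. *)

theory Defs
  imports Complex_Main "HOL-Number_Theory.Number_Theory"
begin

record 'a hypergraph =
  vertices :: "'a set"
  edges :: "'a set set"

definition uniform_hypergraph :: "nat \<Rightarrow> 'a hypergraph \<Rightarrow> bool" where
  "uniform_hypergraph k G \<longleftrightarrow>
     finite (vertices G) \<and> (\<forall>e\<in>edges G. e \<subseteq> vertices G \<and> card e = k)"

definition contains_copy :: "'a hypergraph \<Rightarrow> 'b hypergraph \<Rightarrow> bool" where
  "contains_copy G F \<longleftrightarrow>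
     (\<exists>f. inj_on f (vertices F) \<and> f ` vertices F \<subseteq> vertices G \<and>
          (\<forall>e\<in>edges F. f ` e \<in> edges G))"

text \<open>If \<open>G\<close> is \<open>k\<close>-uniform and \<open>card S = k - 1\<close> with \<open>k \<ge> 1\<close>, a vertex \<open>v \<in> S\<close> is never
  counted, since then \<open>insert v S = S\<close> is not a \<open>k\<close>-set.\<close>

definition codegree :: "'a hypergraph \<Rightarrow> 'a set \<Rightarrow> nat" where
  "codegree G S = card {v \<in> vertices G. insert v S \<in> edges G}"

text \<open>The minimum is over a nonempty set only when \<open>G\<close> has at least \<open>k - 1\<close> vertices; the
  finitely many smaller orders do not affect the density below.\<close>

definition min_codegree :: "nat \<Rightarrow> 'a hypergraph \<Rightarrow> nat" where
  "min_codegree k G = Min (codegree G ` {S. S \<subseteq> vertices G \<and> card S = k - 1})"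

text \<open>Every finite hypergraph is isomorphic to one whose vertices are natural numbers, so the
  host hypergraphs \<open>G\<close> range over these. The maximum is over values in \<open>{0..n}\<close>
  (for \<open>n \<ge> k - 1\<close>).\<close>

definition codegree_ex :: "nat \<Rightarrow> nat \<Rightarrow> 'b hypergraph \<Rightarrow> nat" where
  "codegree_ex k n F =
     Max {min_codegree k G | G :: nat hypergraph.
            uniform_hypergraph k G \<and> card (vertices G) = n \<and> \<not> contains_copy G F}"

definition codegree_density :: "nat \<Rightarrow> 'b hypergraph \<Rightarrow> real" where
  "codegree_density k F = lim (\<lambda>n. real (codegree_ex k n F) / real n)"

definition tight_cycle :: "nat \<Rightarrow> nat \<Rightarrow> nat hypergraph" where
  "tight_cycle k l =
     \<lparr>vertices = {..<l}, edges = {{(i + j) mod l | j. j < k} | i. i < l}\<rparr>"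

definition smallest_prime_factor :: "nat \<Rightarrow> nat" where
  "smallest_prime_factor m = Min (prime_factors m)"

definition p_of :: "nat \<Rightarrow> nat \<Rightarrow> nat" where
  "p_of k l = smallest_prime_factor (k div gcd k l)"

definition admissible :: "nat \<Rightarrow> nat \<Rightarrow> bool" where
  "admissible k l \<longleftrightarrow> 3 \<le> k \<and> k < l \<and> \<not> k dvd l \<and> 20 * k\<^sup>2 \<le> l"

end

theory Submission
  imports Defs "HOL-Combinatorics.Permutations"
begin

text \<open>
  Write \<open>m = k div gcd k l\<close> and let \<open>p\<close> be its smallest prime factor.

  Lower bounds. Colour the vertices of the host by residues and let a \<open>k\<close>-set be an edge according to
  how many vertices it has in each colour. If the rule forces the vertex that enters a window of \<open>k\<close>
  consecutive vertices of a tight cycle to have the colour of the vertex that leaves it, then the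
  colours along the cycle have periods \<open>k\<close> and \<open>l\<close>, hence \<open>gcd k l\<close>, and every colour occurs in a
  window a multiple of \<open>m\<close> times. Requiring the sum of the vertices to be 1 modulo \<open>p\<close> therefore
  excludes the cycle at density \<open>1 / p\<close> (\<open>prime_quotient_lower\<close>). For the third claim three colours are
  used, with \<open>b + 2 * c\<close> fixed modulo 3 in a window with \<open>a\<close>, \<open>b\<close>, \<open>c\<close> vertices of the three
  colours. Only windows in which \<open>m\<close> divides all three counts are dangerous. When
  \<open>gcd k l \<in> {1, 2, 3}\<close> and \<open>m mod 3 = 1\<close>, the fixed residue can be chosen such that all dangerous
  windows miss a colour; those can be deleted and replaced locally, which costs no codegree
  and keeps one colour periodic along every tight cycle (\<open>three_colour_lower\<close> and the patterns after
  it). The density \<open>1 / 3\<close> exceeds \<open>1 / p\<close> as \<open>p > 3\<close>.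

  Upper bounds. By sampling, a host with large codegree has very many subhypergraphs of bounded size
  with almost the same relative codegree (\<open>most_samples_faithful\<close>). If every such small hypergraph
  contains a closed tight walk of length \<open>l\<close>, one shape of walk occurs in a positive proportion of the
  samples, and a dense relation contains a box in which repeated vertices of the walk can be made
  distinct (\<open>dense_contains_box\<close>, \<open>hom_threshold_copy\<close>). The same sampling argument shows that the
  limit defining the density exists (\<open>ex_ratio_convergent\<close>).

  It remains to find closed tight walks. Go round an edge again and again and change at most one
  vertex in each round; the walk closes up with length \<open>l\<close> as soon as a prescribed rotation of the
  initial edge is reached (\<open>closed_walkI\<close>). Two vertices \<open>x\<close>, \<open>y\<close> of an edge \<open>e\<close> can be
  interchanged in three rounds if \<open>e - {x}\<close> and \<open>e - {y}\<close> have a common neighbour; call them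
  similar. Above codegree density \<open>1 / 2\<close> any two vertices of an edge are similar, and every
  permutation is reached. Above \<open>1 / 3\<close>, two of any three vertices of an edge are similar. If there is
  no closed walk of length \<open>l\<close>, similarity has to be an equivalence relation with exactly two classes on
  every edge, and adjacent edges have matching classes: otherwise all transpositions would be available
  within a bounded number of rounds, for which \<open>l \<ge> 20 * k\<^sup>2\<close> leaves enough time. The main
  step (\<open>classes_exchanged\<close>) shows that an edge with classes of sizes \<open>a \<ge> 2\<close> and \<open>b\<close> entails an
  edge with classes of sizes \<open>a - 2\<close> and \<open>b + 2\<close>. As no class is empty, all sizes are odd, \<open>k\<close> is even,
  and every odd number below \<open>k\<close> is the size of a class. If \<open>m\<close> is odd, some class has size \<open>m\<close>;
  but then the edge can be ordered such that the prescribed rotation preserves the two classes and is reachable after all,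
  a contradiction (\<open>odd_quotient_contradiction\<close>). For \<open>p = 3\<close> the number \<open>m\<close> is indeed odd.
\<close>

section \<open>Closed tight walks\<close>

locale kgraph =
  fixes V :: "'a set" and E :: "'a set set" and k :: nat
  assumes finite_V: "finite V"
    and edge_sub: "e \<in> E \<Longrightarrow> e \<subseteq> V"
    and edge_card: "e \<in> E \<Longrightarrow> card e = k"
    and k_ge_3: "3 \<le> k"
begin

definition nbh :: "'a set \<Rightarrow> 'a set" where
  "nbh S = {v. insert v S \<in> E}"

text \<open>Ordered edges are functions on all of \<open>nat\<close>, of which only the values below \<open>k\<close> matter. Every
  construction below changes positions below \<open>k\<close> only, so that equality of ordered edges can be
  stated as equality of functions.\<close>

definition ordered_edge :: "(nat \<Rightarrow> 'a) \<Rightarrow> bool" where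
  "ordered_edge f \<longleftrightarrow> inj_on f {..<k} \<and> f ` {..<k} \<in> E"

text \<open>One round of a walk: the new vertex, if any, takes over the position of the old one.\<close>

definition step :: "((nat \<Rightarrow> 'a) \<times> (nat \<Rightarrow> 'a)) set" where
  "step = {(f, g). ordered_edge f \<and> ordered_edge g \<and> (\<exists>i<k. \<exists>w. g = f(i := w))}"

text \<open>A closed walk is a homomorphic image of the tight cycle of length \<open>l\<close>; vertices may repeat.\<close>

definition closed_walk :: "nat \<Rightarrow> bool" where
  "closed_walk l \<longleftrightarrow> (\<exists>x. \<forall>i<l. (\<lambda>j. x ((i + j) mod l)) ` {..<k} \<in> E)"

lemma step_refl: "ordered_edge f \<Longrightarrow> (f, f) \<in> step"
  using k_ge_3 unfolding step_def by (auto intro!: exI[of _ 0] exI[of _ "f 0"])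

lemma step_sym: "(f, g) \<in> step \<Longrightarrow> (g, f) \<in> step"
proof -
  assume "(f, g) \<in> step"
  then obtain i w where "ordered_edge f" "ordered_edge g" "i < k" "g = f(i := w)"
    by (auto simp: step_def)
  moreover from this have "f = g(i := f i)" by simp
  ultimately show ?thesis unfolding step_def by blast
qed

lemma ordered_edge_comp:
  assumes "ordered_edge f" "p permutes {..<k}"
  shows "ordered_edge (f \<circ> p)"
proof -
  have "(f \<circ> p) ` {..<k} = f ` {..<k}"
    using assms(2) by (metis image_comp permutes_image)
  moreover have "inj_on (f \<circ> p) {..<k}"
    using assms by (metis comp_inj_on ordered_edge_def permutes_image permutes_inj_on)
  ultimately show ?thesis using assms(1) by (simp add: ordered_edge_def)
qed

lemma step_comp:
  assumes "(f, g) \<in> step" "p permutes {..<k}"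
  shows "(f \<circ> p, g \<circ> p) \<in> step"
proof -
  obtain i w where i: "i < k" "g = f(i := w)" and o: "ordered_edge f" "ordered_edge g"
    using assms(1) by (auto simp: step_def)
  have "g \<circ> p = (f \<circ> p)(inv_into UNIV p i := w)"
    using i assms(2) by (auto simp: fun_eq_iff permutes_inverses permutes_inv_eq)
  moreover have "inv_into UNIV p i < k"
    using i assms(2) by (metis lessThan_iff permutes_in_image permutes_inv)
  ultimately show ?thesis
    using ordered_edge_comp[OF o(1) assms(2)] ordered_edge_comp[OF o(2) assms(2)]
    unfolding step_def by blast
qed

text \<open>Renaming the positions commutes with every round. This is what makes the permutations of an edge
  that can be reached from it behave like a group.\<close>

lemma steps_comp:
  assumes "(f, g) \<in> step ^^ n" "p permutes {..<k}"
  shows "(f \<circ> p, g \<circ> p) \<in> step ^^ n"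
  using assms(1)
proof (induction n arbitrary: g)
  case (Suc n)
  then obtain h where "(f, h) \<in> step ^^ n" "(h, g) \<in> step" by auto
  then show ?case using Suc.IH[of h] step_comp[OF _ assms(2), of h g] by (auto simp del: comp_apply)
qed auto

lemma steps_trans: "(f, g) \<in> step ^^ a \<Longrightarrow> (g, h) \<in> step ^^ b \<Longrightarrow> (f, h) \<in> step ^^ (a + b)"
  by (auto simp: relpow_add)

lemma steps_mono:
  assumes "(f, g) \<in> step ^^ a" "a \<le> b" "ordered_edge f"
  shows "(f, g) \<in> step ^^ b"
proof -
  have "(f, f) \<in> step ^^ n" for n
    by (induction n) (auto intro: step_refl assms(3))
  then have "(f, g) \<in> step ^^ ((b - a) + a)"
    using assms(1) steps_trans by blast
  with assms(2) show ?thesis by simp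
qed

definition swap :: "nat \<Rightarrow> (nat \<Rightarrow> 'a) \<Rightarrow> nat \<Rightarrow> nat \<Rightarrow> bool" where
  "swap c f i j \<longleftrightarrow> (f, f \<circ> Transposition.transpose i j) \<in> step ^^ c"

lemma swap_mono: "swap a f i j \<Longrightarrow> a \<le> b \<Longrightarrow> ordered_edge f \<Longrightarrow> swap b f i j"
  unfolding swap_def by (rule steps_mono)

lemma swap_commute: "swap a f i j \<Longrightarrow> swap a f j i"
  unfolding swap_def by (simp add: transpose_commute)

text \<open>The transposition of \<open>i\<close> and \<open>l\<close> is the conjugate of that of \<open>j\<close> and \<open>l\<close> by that of \<open>i\<close> and \<open>j\<close>.\<close>

lemma swap_conj:
  assumes "swap a f i j" "swap b f j l" "i < k" "j < k" "l < k" "i \<noteq> j" "i \<noteq> l" "j \<noteq> l"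
  shows "swap (2 * a + b) f i l"
proof -
  let ?s = "Transposition.transpose i j" and ?t = "Transposition.transpose j l"
  have s: "?s permutes {..<k}" and t: "?t permutes {..<k}"
    using assms by (auto intro: permutes_swap_id)
  have 1: "(f, f \<circ> ?s) \<in> step ^^ a" and 2: "(f, f \<circ> ?t) \<in> step ^^ b"
    using assms by (auto simp: swap_def)
  have "(f, f \<circ> (?s \<circ> ?t \<circ> ?s)) \<in> step ^^ (a + b + a)"
    using steps_trans[OF steps_trans[OF 1 steps_comp[OF 2 s]]]
        steps_comp[OF 1 permutes_compose[OF s t]]
    by (simp only: comp_assoc)
  moreover have "?s \<circ> ?t \<circ> ?s = Transposition.transpose i l"
    using assms by (intro transpose_comp_triple) auto
  ultimately show ?thesis by (simp add: swap_def mult_2 add.commute add.left_commute)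
qed

text \<open>A permutation of the first \<open>n\<close> positions that preserves the classes of \<open>cls\<close> is sorted by at most
  \<open>n\<close> transpositions inside classes: each of them puts the last position right.\<close>

lemma steps_permutation:
  assumes f: "ordered_edge f"
    and sw: "\<And>i j. i < k \<Longrightarrow> j < k \<Longrightarrow> i \<noteq> j \<Longrightarrow> cls i = cls j \<Longrightarrow> swap c f i j"
    and n: "n \<le> k"
    and p: "p permutes {..<n}" "\<And>i. i < n \<Longrightarrow> cls (p i) = cls i"
  shows "(f, f \<circ> p) \<in> step ^^ (c * n)"
  using n p
proof (induction n arbitrary: p)
  case 0
  then show ?case by simp
next
  case (Suc n)
  let ?t = "Transposition.transpose n (p n)"
  have pn: "p n < Suc n" using Suc.prems(2) permutes_in_image by fastforce
  have q: "?t \<circ> p permutes {..<n}"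
  proof (rule permutes_superset[where S = "{..<Suc n}"])
    show "?t \<circ> p permutes {..<Suc n}"
      using Suc.prems(2) pn by (intro permutes_compose) (auto intro: permutes_swap_id)
    show "\<And>x. x \<in> {..<Suc n} - {..<n} \<Longrightarrow> (?t \<circ> p) x = x"
      by (auto simp: less_Suc_eq)
  qed
  have cq: "cls ((?t \<circ> p) i) = cls i" if "i < n" for i
    using Suc.prems(3)[of i] Suc.prems(3)[of n] that
    by (auto simp: Transposition.transpose_def)
  have IH: "(f, f \<circ> (?t \<circ> p)) \<in> step ^^ (c * n)"
    by (rule Suc.IH[OF _ q cq]) (use Suc.prems(1) in auto)
  have t: "?t \<circ> (?t \<circ> p) = p" by (simp add: comp_assoc[symmetric])
  have qk: "?t \<circ> p permutes {..<k}"
    using q Suc.prems(1) by (auto intro: permutes_subset)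
  show ?case
  proof (cases "p n = n")
    case True
    then have "?t \<circ> p = p" by simp
    with IH have "(f, f \<circ> p) \<in> step ^^ (c * n)" by metis
    then show ?thesis by (rule steps_mono[OF _ _ f]) simp
  next
    case False
    then have "swap c f n (p n)"
      using sw[of n "p n"] Suc.prems pn by auto
    then have "(f \<circ> (?t \<circ> p), f \<circ> ?t \<circ> (?t \<circ> p)) \<in> step ^^ c"
      using steps_comp qk unfolding swap_def by blast
    moreover have "f \<circ> ?t \<circ> (?t \<circ> p) = f \<circ> p" by (simp only: comp_assoc t)
    ultimately have "(f, f \<circ> p) \<in> step ^^ (c * n + c)"
      using steps_trans[OF IH] by metis
    moreover have "c * n + c = c * Suc n" by simp
    ultimately show ?thesis by metis
  qed
qed

definition rot :: "nat \<Rightarrow> nat \<Rightarrow> nat" where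
  "rot r i = (if i < k then (i + r) mod k else i)"

lemma rot_permutes: "rot r permutes {..<k}"
proof (rule bij_imp_permutes)
  have "inj_on (rot r) {..<k}"
  proof (rule inj_onI)
    fix a b assume "a \<in> {..<k}" "b \<in> {..<k}" "rot r a = rot r b"
    then have "[a + r = b + r] (mod k)" "a < k" "b < k" by (auto simp: rot_def cong_def)
    then show "a = b" by (metis cong_add_rcancel_nat cong_less_modulus_unique_nat)
  qed
  moreover have "rot r ` {..<k} \<subseteq> {..<k}" by (auto simp: rot_def)
  ultimately show "bij_betw (rot r) {..<k} {..<k}"
    by (simp add: bij_betw_def endo_inj_surj)
qed (auto simp: rot_def)

text \<open>Write the ordered edges visited in successive rounds one after the other. A window of \<open>k\<close>
  consecutive vertices that straddles two of them is the vertex set of one of the two, as they differ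
  in at most one position. If the last ordered edge is the first one rotated by \<open>r\<close>, the sequence
  returns to its beginning \<open>r\<close> places before that edge.\<close>

lemma closed_walkI:
  assumes steps: "(f, f \<circ> rot r) \<in> step ^^ q" and f: "ordered_edge f"
    and r: "r < k" and l: "l + r = k * Q" "k \<le> l" and Q: "q < Q"
  shows "closed_walk l"
proof -
  have "(f, f \<circ> rot r) \<in> step ^^ (Q - 1)"
    using steps_mono[OF steps _ f] Q by simp
  then obtain F where F: "F 0 = f" "F (Q - 1) = f \<circ> rot r"
    "\<And>i. i < Q - 1 \<Longrightarrow> (F i, F (Suc i)) \<in> step"
    by (auto simp: relpow_fun_conv)
  \<comment> \<open>The last round changes nothing, so that the windows near the end are covered as well.\<close>
  define G where "G j = F (min j (Q - 1))" for j
  have G: "(G j, G (Suc j)) \<in> step" for j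
  proof (cases "j < Q - 1")
    case True
    then show ?thesis using F(3)[of j] by (simp add: G_def min_def)
  next
    case False
    then have "G j = f \<circ> rot r" "G (Suc j) = f \<circ> rot r" using F(2) by (auto simp: G_def min_def)
    then show ?thesis using step_refl ordered_edge_comp[OF f rot_permutes] by simp
  qed
  define x where "x t = G (t div k) (t mod k)" for t
  have k0: "0 < k" using k_ge_3 by simp
  have xG: "x (k * c + s) = G c s" if "s < k" for c s using that by (simp add: x_def)
  have window: "(\<lambda>j. x (i + j)) ` {..<k} \<in> E" for i
  proof -
    define a where "a = i div k"
    define b where "b = i mod k"
    have i: "i = a * k + b" "b < k" using k0 by (auto simp: a_def b_def)
    have x1: "x (i + j) = G a (b + j)" if "b + j < k" for j
    proof -
      have "(i + j) div k = a" "(i + j) mod k = b + j"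
        using that k0 unfolding i(1) by (simp_all add: add.assoc)
      then show ?thesis by (simp add: x_def)
    qed
    have x2: "x (i + j) = G (Suc a) (b + j - k)" if "\<not> b + j < k" "j < k" for j
    proof -
      have "i + j = Suc a * k + (b + j - k)" "b + j - k < k" using that i by auto
      then have "(i + j) div k = Suc a" "(i + j) mod k = b + j - k"
        by (metis div_mult_self3 div_less add.right_neutral k0 less_numeral_extra(3),
            metis mod_mult_self3 mod_less)
      then show ?thesis by (simp add: x_def)
    qed
    have im: "(\<lambda>j. x (i + j)) ` {..<k} = G a ` {b..<k} \<union> G (Suc a) ` {..<b}"
    proof
      show "(\<lambda>j. x (i + j)) ` {..<k} \<subseteq> G a ` {b..<k} \<union> G (Suc a) ` {..<b}"
      proof clarify
        fix j assume "j < k" "x (i + j) \<notin> G (Suc a) ` {..<b}"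
        then show "x (i + j) \<in> G a ` {b..<k}"
          using x1[of j] x2[of j] i(2) by (cases "b + j < k") auto
      qed
      have "G a s \<in> (\<lambda>j. x (i + j)) ` {..<k}" if "b \<le> s" "s < k" for s
        using x1[of "s - b"] that by (intro image_eqI[of _ _ "s - b"]) auto
      moreover have "G (Suc a) s \<in> (\<lambda>j. x (i + j)) ` {..<k}" if "s < b" for s
        using x2[of "s + k - b"] that i(2) by (intro image_eqI[of _ _ "s + k - b"]) auto
      ultimately show "G a ` {b..<k} \<union> G (Suc a) ` {..<b} \<subseteq> (\<lambda>j. x (i + j)) ` {..<k}" by auto
    qed
    obtain c w where c: "c < k" "G (Suc a) = (G a)(c := w)"
      and o: "ordered_edge (G a)" "ordered_edge (G (Suc a))"
      using G[of a] by (auto simp: step_def)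
    have sp: "{..<k} = {b..<k} \<union> {..<b}" using i(2) by auto
    show ?thesis
    proof (cases "c < b")
      case True
      then have "G a ` {b..<k} = G (Suc a) ` {b..<k}" using c by auto
      then have "G a ` {b..<k} \<union> G (Suc a) ` {..<b} = G (Suc a) ` {..<k}"
        by (subst sp) (simp add: image_Un)
      then show ?thesis using o im by (simp add: ordered_edge_def)
    next
      case False
      then have "G a ` {..<b} = G (Suc a) ` {..<b}" using c by auto
      then have "G a ` {b..<k} \<union> G (Suc a) ` {..<b} = G a ` {..<k}"
        by (subst sp) (simp add: image_Un)
      then show ?thesis using o im by (simp add: ordered_edge_def)
    qed
  qed
  have Q1: "1 \<le> Q" using Q by simp
  have per: "x (l + s) = x s" if "s < k" for s
  proof (cases "r \<le> s")
    case True
    then have "l + s = k * Q + (s - r)" using l by simp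
    moreover have "s - r < k" using that by simp
    ultimately have "x (l + s) = G Q (s - r)" using xG by metis
    also have "\<dots> = (f \<circ> rot r) (s - r)" using F(2) by (simp add: G_def)
    also have "\<dots> = f s" using True that by (auto simp: rot_def)
    finally show ?thesis using that F(1) by (simp add: x_def G_def)
  next
    case False
    have "k * Q = k * (Q - 1) + k" using Q1 by (metis mult_Suc_right Suc_diff_1 add.commute less_eq_Suc_le One_nat_def)
    then have "l + s = k * (Q - 1) + (k - r + s)" using l False r by simp
    moreover have "k - r + s < k" using False r by simp
    ultimately have "x (l + s) = G (Q - 1) (k - r + s)" using xG by metis
    also have "\<dots> = (f \<circ> rot r) (k - r + s)" using F(2) by (simp add: G_def)
    also have "\<dots> = f s" using False that r by (auto simp: rot_def)
    finally show ?thesis using that F(1) by (simp add: x_def G_def)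
  qed
  show ?thesis unfolding closed_walk_def
  proof (intro exI allI impI)
    fix i assume i: "i < l"
    have "x ((i + j) mod l) = x (i + j)" if "j < k" for j
    proof (cases "i + j < l")
      case False
      then have "(i + j) mod l = i + j - l" using i that l(2)
        by (simp add: le_mod_geq)
      moreover have "i + j - l < k" using i that by simp
      ultimately show ?thesis using per[of "i + j - l"] False by simp
    qed simp
    then have "(\<lambda>j. x ((i + j) mod l)) ` {..<k} = (\<lambda>j. x (i + j)) ` {..<k}"
      by (intro image_cong) auto
    then show "(\<lambda>j. x ((i + j) mod l)) ` {..<k} \<in> E" using window by simp
  qed
qed

lemma nbh_sub: "nbh S \<subseteq> V"
  using edge_sub by (auto simp: nbh_def)

lemma nbh_notin:
  assumes "v \<in> nbh S" "card S = k - 1" shows "v \<notin> S"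
proof
  assume "v \<in> S"
  then have "insert v S = S" by auto
  then have "card S = k" using assms(1) edge_card by (auto simp: nbh_def)
  then show False using assms(2) k_ge_3 by simp
qed

lemma finite_nbh: "finite (nbh S)"
  using nbh_sub finite_V finite_subset by blast

lemma finite_edge: "e \<in> E \<Longrightarrow> finite e"
  using edge_sub finite_V finite_subset by blast

text \<open>A common neighbour of \<open>e - {x}\<close> and \<open>e - {y}\<close> is what is needed to interchange \<open>x\<close> and \<open>y\<close> directly.\<close>

definition sim :: "'a set \<Rightarrow> 'a \<Rightarrow> 'a \<Rightarrow> bool" where
  "sim e x y \<longleftrightarrow> x = y \<or> nbh (e - {x}) \<inter> nbh (e - {y}) \<noteq> {}"

abbreviation sim_at :: "(nat \<Rightarrow> 'a) \<Rightarrow> nat \<Rightarrow> nat \<Rightarrow> bool" where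
  "sim_at f i j \<equiv> sim (f ` {..<k}) (f i) (f j)"

lemma sim_refl [simp]: "sim e x x" by (simp add: sim_def)

lemma sim_commute: "sim e x y = sim e y x" by (auto simp: sim_def)

lemma ordering_exists:
  assumes "e \<in> E" obtains f where "ordered_edge f" "f ` {..<k} = e"
proof -
  obtain f where "bij_betw f {0..<card e} e"
    using ex_bij_betw_nat_finite[OF finite_edge[OF assms]] by blast
  then have "bij_betw f {..<k} e" using edge_card[OF assms] by (simp add: atLeast0LessThan)
  then show ?thesis using that[of f] assms by (auto simp: ordered_edge_def bij_betw_def)
qed

lemma card_edge_minus: "e \<in> E \<Longrightarrow> x \<in> e \<Longrightarrow> card (e - {x}) = k - 1"
  using edge_card finite_edge by simp

text \<open>The common neighbour \<open>w\<close> serves as temporary storage: \<open>w\<close> replaces \<open>x\<close>, then \<open>x\<close> replaces \<open>y\<close>, then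
  \<open>y\<close> replaces \<open>w\<close>. The two intermediate edges are \<open>insert w (e - {x})\<close> and \<open>insert w (e - {y})\<close>.\<close>

lemma sim_swap:
  assumes f: "ordered_edge f" and ij: "i < k" "j < k" "i \<noteq> j" and s: "sim_at f i j"
  shows "swap 3 f i j"
proof -
  let ?e = "f ` {..<k}"
  have inj: "inj_on f {..<k}" and e: "?e \<in> E" using f by (auto simp: ordered_edge_def)
  have neq: "f i \<noteq> f j" using inj ij by (auto dest: inj_onD)
  with s obtain w where w: "w \<in> nbh (?e - {f i})" "w \<in> nbh (?e - {f j})"
    by (auto simp: sim_def)
  have w1: "w \<notin> ?e - {f i}" "w \<notin> ?e - {f j}"
    using nbh_notin[OF w(1)] nbh_notin[OF w(2)] card_edge_minus[OF e] ij by auto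
  have we: "w \<notin> ?e" using w1 neq by auto
  have wn: "w \<noteq> f a" if "a < k" for a using we that by auto
  have inj': "f a = f b \<longleftrightarrow> a = b" if "a < k" "b < k" for a b
    using inj that by (auto dest: inj_onD)
  let ?g = "f(i := w)" and ?h = "(f(i := w))(j := f i)"
  have img: "?g ` {..<k} = insert w (?e - {f i})"
    using ij inj' by (auto simp: image_iff)
  have imh: "?h ` {..<k} = insert w (?e - {f j})"
  proof
    show "?h ` {..<k} \<subseteq> insert w (?e - {f j})" using ij inj' by auto
    have "f a \<in> ?h ` {..<k}" if "a < k" "a \<noteq> j" for a
    proof (cases "a = i")
      case True
      then show ?thesis using ij by (intro image_eqI[of _ _ j]) auto
    next
      case False
      then show ?thesis using ij that by (intro image_eqI[of _ _ a]) auto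
    qed
    moreover have "w \<in> ?h ` {..<k}" using ij by (intro image_eqI[of _ _ i]) auto
    ultimately show "insert w (?e - {f j}) \<subseteq> ?h ` {..<k}" by auto
  qed
  have og: "ordered_edge ?g"
    unfolding ordered_edge_def
  proof
    show "inj_on ?g {..<k}" using inj' wn[symmetric] by (auto simp: inj_on_def wn)
    show "?g ` {..<k} \<in> E" using w(1) img by (simp add: nbh_def)
  qed
  have oh: "ordered_edge ?h"
    unfolding ordered_edge_def
  proof
    show "inj_on ?h {..<k}" using inj' wn[symmetric] ij by (auto simp: inj_on_def wn)
    show "?h ` {..<k} \<in> E" using w(2) imh by (simp add: nbh_def)
  qed
  have t: "f \<circ> Transposition.transpose i j = ?h(i := f j)"
    using ij(3) by (auto simp: fun_eq_iff Transposition.transpose_def)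
  have ot: "ordered_edge (f \<circ> Transposition.transpose i j)"
    using ij by (intro ordered_edge_comp f permutes_swap_id) auto
  have "(f, ?g) \<in> step" unfolding step_def using f og ij by blast
  moreover have "(?g, ?h) \<in> step" unfolding step_def using oh og ij by blast
  moreover have "(?h, f \<circ> Transposition.transpose i j) \<in> step"
    using oh ot ij t unfolding step_def by blast
  ultimately have "(f, f \<circ> Transposition.transpose i j) \<in> step O step O step" by blast
  moreover have "step ^^ 3 = step O step O step"
    by (simp add: numeral_3_eq_3 O_assoc)
  ultimately show ?thesis unfolding swap_def by simp
qed

end

text \<open>Upper bounds are proved by contradiction inside this locale: the absence of closed walks of length
  \<open>l\<close> limits the permutations of an edge that can be reached.\<close>

locale walk_free = kgraph +
  fixes l :: nat
  assumes no_walk: "\<not> closed_walk l"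
    and l_large: "20 * k\<^sup>2 \<le> l"
    and k_ndvd_l: "\<not> k dvd l"
begin

text \<open>Going round \<open>l div k + 1\<close> times overshoots \<open>l\<close> by this amount, so it is the rotation that a closed
  walk of length \<open>l\<close> has to produce.\<close>

definition offset :: nat where "offset = k - l mod k"

lemma offset_less: "offset < k"
proof -
  have "l mod k \<noteq> 0" using k_ndvd_l by (simp add: dvd_eq_mod_eq_0)
  then show ?thesis using k_ge_3 by (simp add: offset_def)
qed

lemma offset_sum: "l + offset = k * (l div k + 1)"
proof -
  have "l mod k \<le> k" using k_ge_3 by (simp add: less_imp_le)
  then have "l + offset = k * (l div k) + k"
    unfolding offset_def using mult_div_mod_eq[of k l] by linarith
  then show ?thesis by simp
qed

text \<open>Since \<open>l \<ge> 20 * k\<^sup>2\<close>, a walk of length \<open>l\<close> has at least \<open>20 * k\<close> rounds, one of which is kept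
  free for closing up.\<close>

lemma rot_unreachable:
  assumes "ordered_edge f" "q \<le> 15 * k"
  shows "(f, f \<circ> rot offset) \<notin> step ^^ q"
proof
  assume s: "(f, f \<circ> rot offset) \<in> step ^^ q"
  have "20 * k * k \<le> l" using l_large by (simp add: power2_eq_square)
  then have "20 * k \<le> l div k"
    using k_ge_3 by (metis div_le_mono nonzero_mult_div_cancel_right not_numeral_le_zero)
  moreover from this have "k \<le> l" using k_ge_3 by (metis div_le_dividend le_trans mult_le_mono1 nat_mult_1 one_le_numeral)
  ultimately show False
    using closed_walkI[OF s assms(1) offset_less offset_sum] no_walk assms(2) by auto
qed

lemma some_not_swap:
  assumes "ordered_edge f"
  shows "\<exists>i<k. \<exists>j<k. i \<noteq> j \<and> \<not> swap 15 f i j"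
proof (rule ccontr)
  assume "\<not> ?thesis"
  then have "(f, f \<circ> rot offset) \<in> step ^^ (15 * k)"
    by (intro steps_permutation[OF assms, where cls = "\<lambda>_. ()"] rot_permutes) auto
  then show False using rot_unreachable[OF assms] by blast
qed

end

text \<open>Two subsets of \<open>V\<close> with more than half of its elements meet, so all vertices of an edge are
  similar and every permutation of an edge can be reached.\<close>

lemma (in walk_free) half_codegree:
  assumes "\<And>S. S \<subseteq> V \<Longrightarrow> card S = k - 1 \<Longrightarrow> card V < 2 * card (nbh S)"
  shows "E = {}"
proof (rule ccontr)
  assume "E \<noteq> {}"
  then obtain e where e: "e \<in> E" by auto
  obtain f where f: "ordered_edge f" "f ` {..<k} = e" using ordering_exists[OF e] .
  have "sim e x y" if "x \<in> e" "y \<in> e" for x y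
  proof (rule ccontr)
    assume "\<not> sim e x y"
    then have disj: "nbh (e - {x}) \<inter> nbh (e - {y}) = {}" by (auto simp: sim_def)
    have "card (nbh (e - {x}) \<union> nbh (e - {y})) \<le> card V"
      by (intro card_mono finite_V Un_least nbh_sub)
    then have "card (nbh (e - {x})) + card (nbh (e - {y})) \<le> card V"
      using disj finite_nbh by (simp add: card_Un_disjoint)
    moreover have *: "card V < 2 * card (nbh (e - {z}))" if "z \<in> e" for z
      using that e card_edge_minus edge_sub by (intro assms) auto
    ultimately show False using *[OF that(1)] *[OF that(2)] by linarith
  qed
  then have "swap 15 f i j" if "i < k" "j < k" "i \<noteq> j" for i j
    using that f by (intro swap_mono[OF sim_swap[OF f(1)]]) auto
  then show False using some_not_swap[OF f(1)] by blast
qed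

section \<open>Codegree above one third\<close>

locale third_codegree = walk_free +
  assumes codegree_third: "S \<subseteq> V \<Longrightarrow> card S = k - 1 \<Longrightarrow> card V < 3 * card (nbh S)"
begin

lemma three_large_meet:
  assumes "A \<subseteq> V" "B \<subseteq> V" "C \<subseteq> V"
    "card V < 3 * card A" "card V < 3 * card B" "card V < 3 * card C"
    "A \<inter> B = {}" "A \<inter> C = {}" "B \<inter> C = {}"
  shows False
proof -
  have fin: "finite A" "finite B" "finite C" using assms finite_V finite_subset by blast+
  have "card (A \<union> B \<union> C) \<le> card V" using assms by (intro card_mono finite_V) auto
  moreover have "card (A \<union> B \<union> C) = card A + card B + card C"
    using fin assms by (subst card_Un_disjoint, auto)+
  ultimately show False using assms by linarith
qed

lemma nbh_edge_large: "e \<in> E \<Longrightarrow> x \<in> e \<Longrightarrow> card V < 3 * card (nbh (e - {x}))"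
  using card_edge_minus edge_sub by (intro codegree_third) auto

lemma sim_three:
  assumes "e \<in> E" "x \<in> e" "y \<in> e" "z \<in> e"
  shows "sim e x y \<or> sim e y z \<or> sim e x z"
proof (rule ccontr)
  assume "\<not> ?thesis"
  then show False
    using three_large_meet[of "nbh (e - {x})" "nbh (e - {y})" "nbh (e - {z})"]
      nbh_sub nbh_edge_large assms by (auto simp: sim_def)
qed

lemma sim_at_three:
  assumes "ordered_edge f" "a < k" "b < k" "c < k"
  shows "sim_at f a b \<or> sim_at f b c \<or> sim_at f a c"
  using assms by (intro sim_three) (auto simp: ordered_edge_def)

text \<open>A chain of two similarities costs \<open>2 * 3 + 3 = 9\<close> rounds by conjugation, a chain of three
  \<open>2 * 3 + 9 = 15\<close>.\<close>

lemma swap_path: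
  assumes f: "ordered_edge f" and "i < k" "j < k" "w < k" "w' < k" "i \<noteq> j"
    and R: "sim_at f i w" "sim_at f w w'" "sim_at f w' j"
  shows "swap 15 f i j"
proof -
  have s3: "swap 3 f a b" if "sim_at f a b" "a < k" "b < k" "a \<noteq> b" for a b
    using sim_swap[OF f] that by blast
  have s9: "swap 9 f a c" if "sim_at f a b" "sim_at f b c" "a < k" "b < k" "c < k" "a \<noteq> c" for a b c
  proof (cases "a = b \<or> b = c")
    case True
    then have "swap 3 f a c" using s3 that by auto
    then show ?thesis by (rule swap_mono[OF _ _ f]) simp
  next
    case False
    then show ?thesis using swap_conj[OF s3[of a b] s3[of b c]] that by auto
  qed
  show ?thesis
  proof (cases "i = w \<or> w = j")
    case True
    then have "swap 9 f i j"
      using s9[of i w' j] s3[of i j] R assms swap_mono[OF _ _ f, of 3 i j 9] by auto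
    then show ?thesis by (rule swap_mono[OF _ _ f]) simp
  next
    case False
    then show ?thesis using swap_conj[OF s3[of i w] s9[of w w' j]] R assms by auto
  qed
qed

text \<open>Suppose \<open>a\<close>, \<open>c\<close>, \<open>b\<close> violate transitivity. Any further vertex is similar to \<open>a\<close> or to \<open>b\<close>, as two
  of any three vertices are similar. Hence any two vertices are joined by a chain of at most three
  similarities, and all transpositions are available.\<close>

lemma sim_at_trans:
  assumes f: "ordered_edge f" and lt: "a < k" "b < k" "c < k"
    and R: "sim_at f a c" "sim_at f c b"
  shows "sim_at f a b"
proof (rule ccontr)
  assume nR: "\<not> sim_at f a b"
  have "\<exists>w<k. \<exists>w'<k. sim_at f i w \<and> sim_at f w w' \<and> sim_at f w' j" if ij: "i < k" "j < k" for i j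
  proof (cases "sim_at f i j")
    case True
    then show ?thesis using ij sim_refl by blast
  next
    case False
    note t = sim_at_three[OF f]
    have 1: "sim_at f i c \<or> sim_at f c j" using t[of i c j] False ij lt by blast
    have 2: "sim_at f i a \<or> sim_at f a j" using t[of i a j] False ij lt by blast
    have 3: "sim_at f i b \<or> sim_at f b j" using t[of i b j] False ij lt by blast
    have 4: "\<not> (\<not> sim_at f a j \<and> \<not> sim_at f b j)"
      using t[of a b j] nR lt ij by blast
    have 5: "\<not> (\<not> sim_at f i a \<and> \<not> sim_at f i b)"
      using t[of a b i] nR lt ij sim_commute by blast
    from 1 2 3 4 5 show ?thesis using R lt by (metis sim_commute)
  qed
  then have "swap 15 f i j" if "i < k" "j < k" "i \<noteq> j" for i j
    using that swap_path[OF f] by metis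
  then show False using some_not_swap[OF f] by blast
qed

lemma sim_trans:
  assumes "e \<in> E" "x \<in> e" "y \<in> e" "z \<in> e" "sim e x y" "sim e y z"
  shows "sim e x z"
proof -
  obtain f where f: "ordered_edge f" "f ` {..<k} = e" using ordering_exists[OF assms(1)] .
  obtain a b c where "a < k" "b < k" "c < k" "x = f a" "y = f b" "z = f c"
    using assms f(2) by auto
  then show ?thesis using sim_at_trans[OF f(1), of a c b] assms f(2) by auto
qed

text \<open>If all vertices of an edge were similar, every permutation of it would be reachable; so
  similarity has exactly two classes on each edge.\<close>

lemma some_not_sim_at:
  assumes f: "ordered_edge f"
  shows "\<exists>i<k. \<exists>j<k. \<not> sim_at f i j"
proof (rule ccontr)
  assume "\<not> ?thesis"
  then have "swap 15 f i j" if "i < k" "j < k" "i \<noteq> j" for i j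
    using that by (intro swap_mono[OF sim_swap[OF f]] f) auto
  then show False using some_not_swap[OF f] by blast
qed

lemma not_all_sim:
  assumes e: "e \<in> E" and "x \<in> e"
  shows "\<exists>y\<in>e. \<not> sim e x y"
proof -
  obtain f where f: "ordered_edge f" "f ` {..<k} = e" using ordering_exists[OF e] .
  obtain i j where "i < k" "j < k" "\<not> sim_at f i j" using some_not_sim_at[OF f(1)] by blast
  then have "f i \<in> e" "f j \<in> e" "\<not> sim e (f i) (f j)" using f(2) by auto
  then show ?thesis using sim_trans[OF e, of "f i" x "f j"] sim_commute assms(2) by blast
qed

text \<open>Transpositions for the adjacent edge are available after one round there and one round back. If
  the two partitions into two classes differed, then any two positions separated by both of them would
  both be joined to some third position, once by each partition, and all transpositions would be
  available within \<open>2 * 5 + 5\<close> rounds.\<close>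

lemma sim_step:
  assumes fg: "(f, g) \<in> step" and ab: "a < k" "b < k"
  shows "sim_at f a b = sim_at g a b"
proof (rule ccontr)
  assume ne: "\<not> ?thesis"
  have f: "ordered_edge f" and g: "ordered_edge g" using fg by (auto simp: step_def)
  have sf: "swap 5 f i j" if "sim_at f i j" "i < k" "j < k" "i \<noteq> j" for i j
    using that by (intro swap_mono[OF sim_swap[OF f]] f) auto
  have sg: "swap 5 f i j" if R: "sim_at g i j" "i < k" "j < k" "i \<noteq> j" for i j
  proof -
    let ?t = "Transposition.transpose i j"
    have "(g, g \<circ> ?t) \<in> step ^^ 3" using sim_swap[OF g] R unfolding swap_def by blast
    moreover have "(g \<circ> ?t, f \<circ> ?t) \<in> step"
      using step_comp[OF step_sym[OF fg]] R permutes_swap_id[of i _ j] by blast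
    ultimately have "(f, f \<circ> ?t) \<in> step ^^ (1 + 3 + 1)"
      using fg by (intro steps_trans[of f g] steps_trans[of f "g \<circ> ?t"]) (auto simp del: comp_apply)
    then show ?thesis by (simp add: swap_def eval_nat_numeral del: comp_apply relpow.simps)
  qed
  have "swap 15 f i j" if ij: "i < k" "j < k" "i \<noteq> j" for i j
  proof (cases "sim_at f i j \<or> sim_at g i j")
    case True
    then show ?thesis using sf sg ij swap_mono[OF _ _ f] by (meson numeral_le_iff semiring_norm(68,73,71,69,72))
  next
    case False
    have "\<exists>w<k. (sim_at f i w \<and> sim_at g w j) \<or> (sim_at f j w \<and> sim_at g w i)"
    proof (rule ccontr)
      assume no: "\<not> ?thesis"
      have eq: "sim_at f i w = sim_at g i w" if "w < k" for w
        using no sim_at_three[OF f, of i w j] sim_at_three[OF g, of i w j] False ij that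
          sim_at_trans[OF f, of i j w] sim_at_trans[OF g, of i j w] sim_commute by metis
      have "sim_at f a b \<longleftrightarrow> (sim_at f i a \<longleftrightarrow> sim_at f i b)"
        using sim_at_three[OF f, of i a b] sim_at_trans[OF f] ij ab sim_commute by metis
      moreover have "sim_at g a b \<longleftrightarrow> (sim_at g i a \<longleftrightarrow> sim_at g i b)"
        using sim_at_three[OF g, of i a b] sim_at_trans[OF g] ij ab sim_commute by metis
      ultimately show False using eq ne ab by blast
    qed
    then obtain w where w: "w < k" "(sim_at f i w \<and> sim_at g w j) \<or> (sim_at f j w \<and> sim_at g w i)" by blast
    have "w \<noteq> i" "w \<noteq> j" using w False sim_commute by metis+
    from w(2) have "swap (2 * 5 + 5) f i j"
    proof
      assume "sim_at f i w \<and> sim_at g w j"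
      then show ?thesis using ij w(1) \<open>w \<noteq> i\<close> \<open>w \<noteq> j\<close>
        by (intro swap_conj[of 5 f i w 5 j] sf sg) auto
    next
      assume "sim_at f j w \<and> sim_at g w i"
      then have "swap (2 * 5 + 5) f j i" using ij w(1) \<open>w \<noteq> i\<close> \<open>w \<noteq> j\<close>
        by (intro swap_conj[of 5 f j w 5 i] sf sg) auto
      then show ?thesis by (rule swap_commute)
    qed
    then show ?thesis by simp
  qed
  then show False using some_not_swap[OF f] by blast
qed

lemma sim_adjacent:
  assumes S: "card S = k - 1" and v: "v \<in> nbh S" "v' \<in> nbh S" and s: "s \<in> S"
  shows "sim (insert v S) s v = sim (insert v' S) s v'"
proof -
  have e: "insert v S \<in> E" "insert v' S \<in> E" using v by (auto simp: nbh_def)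
  have nv: "v \<notin> S" "v' \<notin> S" using nbh_notin v S by auto
  obtain f where f: "ordered_edge f" "f ` {..<k} = insert v S" using ordering_exists[OF e(1)] .
  obtain i where i: "i < k" "f i = v" using f(2) by (metis image_iff insertI1 lessThan_iff)
  obtain a where a: "a < k" "f a = s" using f(2) s by (metis image_iff insertI2 lessThan_iff)
  have inj: "inj_on f {..<k}" using f by (simp add: ordered_edge_def)
  let ?g = "f(i := v')"
  have rest: "f ` ({..<k} - {i}) = S"
    using inj_on_image_set_diff[OF inj, of "{..<k}" "{i}"] i f(2) nv by auto
  have split: "{..<k} = insert i ({..<k} - {i})" using i by auto
  have img: "?g ` {..<k} = insert v' S"
    by (subst split) (use rest in auto)
  have "inj_on ?g {..<k}"
    by (rule eq_card_imp_inj_on, simp, simp only: img edge_card[OF e(2)] card_lessThan)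
  then have "(f, ?g) \<in> step"
    using f e img i unfolding step_def ordered_edge_def by auto
  note tr = sim_step[OF this]
  have "a \<noteq> i" using a i nv s by auto
  then show ?thesis using tr[of a i] a i f(2) img by simp
qed

text \<open>The part of \<open>S\<close> in the class of a vertex that completes \<open>S\<close> to an edge. By \<open>sim_adjacent\<close> all
  completing vertices give the same set, so quantifying over all of them is harmless.\<close>

definition mates :: "'a set \<Rightarrow> 'a set" where
  "mates S = {s \<in> S. \<forall>v\<in>nbh S. sim (insert v S) s v}"

lemma mates_minus_iff:
  assumes "e \<in> E" "x \<in> e" "y \<in> e" "x \<noteq> y"
  shows "y \<in> mates (e - {x}) \<longleftrightarrow> sim e x y"
proof -
  have xe: "x \<in> nbh (e - {x})" "insert x (e - {x}) = e" using assms by (auto simp: nbh_def insert_absorb)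
  have "sim (insert v (e - {x})) y v = sim e y x" if "v \<in> nbh (e - {x})" for v
    using sim_adjacent[OF card_edge_minus that xe(1)] assms xe(2) by auto
  then show ?thesis using assms xe sim_commute by (auto simp: mates_def)
qed

lemma mates_iff:
  assumes "card S = k - 1" "v \<in> nbh S" "y \<in> S"
  shows "y \<in> mates S \<longleftrightarrow> sim (insert v S) v y"
proof -
  have "v \<notin> S" using nbh_notin assms by blast
  then show ?thesis using mates_minus_iff[of "insert v S" v y] assms by (auto simp: nbh_def)
qed

text \<open>The argument is organised around the links of sets of \<open>k - 2\<close> vertices. The link of \<open>T\<close> is a graph on
  \<open>V - T\<close>, and the neighbourhood of \<open>x\<close> in it is \<open>nbh (insert x T)\<close>.\<close>

definition codim2 :: "'a set \<Rightarrow> bool" where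
  "codim2 T \<longleftrightarrow> T \<subseteq> V \<and> card T = k - 2"

lemma codim2D:
  assumes "codim2 T" shows "finite T" "T \<subseteq> V" "card T = k - 2"
  using assms finite_V finite_subset by (auto simp: codim2_def)

lemma card_insert_codim2: "codim2 T \<Longrightarrow> x \<in> V - T \<Longrightarrow> card (insert x T) = k - 1"
  using codim2D[of T] k_ge_3 by simp

lemma codim2_swap:
  assumes "codim2 T" "y \<in> T" "x \<in> V - T"
  shows "codim2 (insert x (T - {y}))"
  using assms codim2D[OF assms(1)] k_ge_3 by (auto simp: codim2_def)

lemma nbh_insert_large: "codim2 T \<Longrightarrow> x \<in> V - T \<Longrightarrow> card V < 3 * card (nbh (insert x T))"
  using card_insert_codim2 codim2D by (intro codegree_third) auto

lemma nbh_nonempty: "codim2 T \<Longrightarrow> x \<in> V - T \<Longrightarrow> \<exists>w. w \<in> nbh (insert x T)"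
  using nbh_insert_large[of T x] by (metis all_not_in_conv card.empty less_nat_zero_code mult_0_right)

lemma nbh_insertD:
  assumes "codim2 T" "x \<in> V - T" "w \<in> nbh (insert x T)"
  shows "w \<in> V - T" "w \<noteq> x" "x \<in> nbh (insert w T)"
  using assms nbh_notin[OF assms(3)] card_insert_codim2[OF assms(1,2)] nbh_sub
  by (auto simp: nbh_def insert_commute)

lemma mates_subset: "mates S \<subseteq> S" by (auto simp: mates_def)

text \<open>Apart from \<open>w\<close> itself, the mates of \<open>insert x T\<close> are the class of \<open>w\<close> in the edge
  \<open>insert w (insert x T)\<close>; likewise for \<open>insert w T\<close> and the class of \<open>x\<close>. An edge has only two classes.\<close>

lemma mates_adjacent:
  assumes T: "codim2 T" and x: "x \<in> V - T" and w: "w \<in> nbh (insert x T)"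
  shows "x \<in> mates (insert x T) \<longleftrightarrow> w \<in> mates (insert w T)"
    and "x \<in> mates (insert x T) \<Longrightarrow> mates (insert x T) - {x} = mates (insert w T) - {w}"
    and "x \<notin> mates (insert x T) \<Longrightarrow> mates (insert w T) = T - mates (insert x T)"
proof -
  note n = nbh_insertD[OF T x w]
  let ?e = "insert w (insert x T)"
  have e: "?e \<in> E" using w by (simp add: nbh_def)
  have Mx: "y \<in> mates (insert x T) \<longleftrightarrow> sim ?e w y" if "y \<in> insert x T" for y
    using mates_iff[OF card_insert_codim2[OF T x] w that] .
  have Mw: "y \<in> mates (insert w T) \<longleftrightarrow> sim ?e x y" if "y \<in> insert w T" for y
    using mates_iff[OF card_insert_codim2[OF T n(1)] n(3) that] by (simp add: insert_commute)
  show iff: "x \<in> mates (insert x T) \<longleftrightarrow> w \<in> mates (insert w T)"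
    using Mx[of x] Mw[of w] sim_commute by auto
  {
    assume "x \<in> mates (insert x T)"
    then have s: "sim ?e w x" using Mx by auto
    have "y \<in> mates (insert x T) \<longleftrightarrow> y \<in> mates (insert w T)" if "y \<in> T" for y
    proof -
      have "sim ?e w y \<longleftrightarrow> sim ?e x y"
        using s sim_trans[OF e, of w x y] sim_trans[OF e, of x w y] sim_commute that by auto
      then show ?thesis using Mx Mw that by auto
    qed
    then show "mates (insert x T) - {x} = mates (insert w T) - {w}"
      using mates_subset[of "insert x T"] mates_subset[of "insert w T"] x n by blast
  next
    assume nx: "x \<notin> mates (insert x T)"
    then have s: "\<not> sim ?e w x" using Mx by auto
    have "y \<in> mates (insert w T) \<longleftrightarrow> y \<notin> mates (insert x T)" if "y \<in> T" for y
    proof -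
      have "sim ?e w y \<longleftrightarrow> \<not> sim ?e x y"
        using s sim_trans[OF e, of w y x] sim_three[OF e, of w y x] sim_commute that by blast
      then show ?thesis using Mx Mw that by auto
    qed
    moreover have "w \<notin> mates (insert w T)" using nx iff by simp
    ultimately show "mates (insert w T) = T - mates (insert x T)"
      using mates_subset[of "insert w T"] by blast
  }
qed

text \<open>Call the link of \<open>T\<close> crossing if the two vertices that extend \<open>T\<close> to an edge are always dissimilar.
  One such pair \<open>x\<close>, \<open>y\<close> suffices for this: the neighbourhoods of \<open>x\<close> and \<open>y\<close> in the link are disjoint
  and contain more than a third of the vertices each, so the neighbourhood of any further \<open>z\<close> meets one
  of them, which ties \<open>z\<close> to the partition of \<open>T\<close> seen from \<open>x\<close>.\<close>

lemma crossing_link: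
  assumes T: "codim2 T" and x: "x \<in> V - T" "x \<notin> mates (insert x T)" and z: "z \<in> V - T"
  shows "z \<notin> mates (insert z T)"
    and "mates (insert z T) = mates (insert x T) \<or> mates (insert z T) = T - mates (insert x T)"
proof -
  obtain y where y: "y \<in> nbh (insert x T)" using nbh_nonempty[OF T x(1)] by blast
  note ny = nbh_insertD[OF T x(1) y]
  have y': "y \<notin> mates (insert y T)" using mates_adjacent(1)[OF T x(1) y] x by simp
  have My: "mates (insert y T) = T - mates (insert x T)" using mates_adjacent(3)[OF T x(1) y x(2)] .
  have xT: "mates (insert x T) \<subseteq> T" using mates_subset[of "insert x T"] x by blast
  let ?e = "insert y (insert x T)"
  have e: "?e \<in> E" using y by (simp add: nbh_def)
  have "\<not> sim ?e y x" using mates_iff[OF card_insert_codim2[OF T x(1)] y, of x] x by simp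
  then have d: "nbh (insert x T) \<inter> nbh (insert y T) = {}"
  proof -
    have "?e - {y} = insert x T" "?e - {x} = insert y T" using ny x by auto
    then show ?thesis using \<open>\<not> sim ?e y x\<close> by (auto simp: sim_def)
  qed
  have "nbh (insert z T) \<inter> nbh (insert x T) \<noteq> {} \<or> nbh (insert z T) \<inter> nbh (insert y T) \<noteq> {}"
    using three_large_meet[of "nbh (insert z T)" "nbh (insert x T)" "nbh (insert y T)"]
      nbh_sub nbh_insert_large[OF T] z x ny d by blast
  then obtain q w where q: "q \<in> V - T" "q \<notin> mates (insert q T)"
    "mates (insert q T) = mates (insert x T) \<or> mates (insert q T) = T - mates (insert x T)"
    and w: "w \<in> nbh (insert z T)" "w \<in> nbh (insert q T)"
    using x y' My ny by auto
  have w1: "w \<notin> mates (insert w T)" "mates (insert w T) = T - mates (insert q T)"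
    using mates_adjacent[OF T q(1) w(2)] q by auto
  note nw = nbh_insertD[OF T z w(1)]
  have z1: "z \<notin> mates (insert z T)" using mates_adjacent(1)[OF T z w(1)] w1 by simp
  then show "z \<notin> mates (insert z T)" .
  have "mates (insert z T) = T - mates (insert w T)" using mates_adjacent(3)[OF T nw(1) nw(3) w1(1)] .
  then show "mates (insert z T) = mates (insert x T) \<or> mates (insert z T) = T - mates (insert x T)"
    using q(3) w1(2) xT by blast
qed

lemma parallel_link:
  assumes "codim2 T" "x \<in> V - T" "x \<in> mates (insert x T)" "z \<in> V - T"
  shows "z \<in> mates (insert z T)"
  using crossing_link(1)[OF assms(1) assms(4) _ assms(2)] assms(3) by blast

text \<open>The vertices that form a class together with \<open>A\<close> and any one of their neighbours in the link of \<open>T\<close>.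
  If the link joins similar vertices, the levels partition \<open>V - T\<close>.\<close>

definition level :: "'a set \<Rightarrow> 'a set \<Rightarrow> 'a set" where
  "level T A = {x \<in> V - T. mates (insert x T) = insert x A}"

lemma level_sub: "level T A \<subseteq> V" by (auto simp: level_def)

text \<open>Levels are unions of connected components of the link.\<close>

lemma level_closed:
  assumes T: "codim2 T" and A: "A \<subseteq> T" and x: "x \<in> level T A"
  shows "nbh (insert x T) \<subseteq> level T A"
proof
  fix w assume w: "w \<in> nbh (insert x T)"
  have x': "x \<in> V - T" "mates (insert x T) = insert x A" using x by (auto simp: level_def)
  note n = nbh_insertD[OF T x'(1) w]
  have "w \<in> mates (insert w T)" using mates_adjacent(1)[OF T x'(1) w] x' by simp
  moreover have "mates (insert w T) - {w} = A"
    using mates_adjacent(2)[OF T x'(1) w] x' A by auto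
  ultimately have "mates (insert w T) = insert w A" by blast
  then show "w \<in> level T A" using n by (simp add: level_def)
qed

lemma level_large:
  assumes "codim2 T" "A \<subseteq> T" "x \<in> level T A"
  shows "card V < 3 * card (level T A)"
proof -
  have "card (nbh (insert x T)) \<le> card (level T A)"
    by (intro card_mono level_closed[OF assms] finite_subset[OF level_sub finite_V])
  then show ?thesis using nbh_insert_large[OF assms(1), of x] assms(3) by (auto simp: level_def)
qed

lemma level_disjoint:
  assumes "A \<subseteq> T" "B \<subseteq> T" "A \<noteq> B"
  shows "level T A \<inter> level T B = {}"
proof (rule ccontr)
  assume "\<not> ?thesis"
  then obtain x where "x \<notin> T" "insert x A = insert x B" by (auto simp: level_def)
  then have "x \<notin> A" "x \<notin> B" using assms by auto
  then show False using \<open>insert x A = insert x B\<close> assms(3) by (simp add: insert_ident)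
qed

lemma in_level:
  assumes "codim2 T" "u \<in> level T A" "z \<in> V - T"
  obtains C where "C \<subseteq> T" "z \<in> level T C"
proof
  have u: "u \<in> V - T" "u \<in> mates (insert u T)" using assms by (auto simp: level_def)
  have z: "z \<in> mates (insert z T)" using parallel_link[OF assms(1) u assms(3)] .
  show "mates (insert z T) - {z} \<subseteq> T" using mates_subset[of "insert z T"] by blast
  show "z \<in> level T (mates (insert z T) - {z})" using z assms(3) by (auto simp: level_def)
qed

text \<open>The rest \<open>T - A\<close> is the second class of an edge, which cannot be empty.\<close>

lemma level_proper:
  assumes T: "codim2 T" and u: "u \<in> level T A"
  shows "\<not> T \<subseteq> A"
proof
  assume TA: "T \<subseteq> A"
  have u': "u \<in> V - T" "mates (insert u T) = insert u A" using u by (auto simp: level_def)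
  obtain w where w: "w \<in> nbh (insert u T)" using nbh_nonempty[OF T u'(1)] by blast
  have e: "insert w (insert u T) \<in> E" using w by (simp add: nbh_def)
  have "sim (insert w (insert u T)) w y" if "y \<in> insert u T" for y
    using mates_iff[OF card_insert_codim2[OF T u'(1)] w that] u' TA that by auto
  then show False using not_all_sim[OF e, of w] by auto
qed

text \<open>Three disjoint levels, each with more than a third of the vertices, do not fit into \<open>V\<close>.\<close>

lemma two_levels_only:
  assumes T: "codim2 T" and A: "A \<subseteq> T" "u \<in> level T A"
    and z: "z \<in> V - T" "z \<notin> level T A" and C: "C \<subseteq> T" "y \<in> level T C" "C \<noteq> A"
  shows "z \<in> level T C"
proof -
  obtain D where D: "D \<subseteq> T" "z \<in> level T D" using in_level[OF T A(2) z(1)] .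
  show ?thesis
  proof (rule ccontr)
    assume "z \<notin> level T C"
    then have "D \<noteq> C" "D \<noteq> A" using D z by auto
    then show False
      using three_large_meet[OF level_sub level_sub level_sub level_large[OF T A] level_large[OF T C(1,2)]
          level_large[OF T D]] level_disjoint A C D by metis
  qed
qed

text \<open>In the set \<open>insert v (T - {y})\<close>, with \<open>y\<close> from the class not containing \<open>v\<close>, the vertex \<open>y\<close> has moved
  outside and is dissimilar to its neighbours there; so the link is a crossing one and the partition
  into \<open>insert v A\<close> and the rest is seen from every vertex.\<close>

lemma exchange_crossing:
  assumes T: "codim2 T" and A: "A \<subseteq> T" "v \<in> level T A" and y: "y \<in> T - A" and w: "w \<in> V - insert v (T - {y})"
  shows "w \<notin> mates (insert w (insert v (T - {y})))"
    and "mates (insert w (insert v (T - {y}))) = insert v A \<or> mates (insert w (insert v (T - {y}))) = T - {y} - A"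
proof -
  have v: "v \<in> V - T" "mates (insert v T) = insert v A" using A by (auto simp: level_def)
  let ?R = "insert v (T - {y})"
  have R: "codim2 ?R" using codim2_swap[OF T _ v(1)] y by blast
  have yR: "insert y ?R = insert v T" using y by auto
  have y1: "y \<in> V - ?R" using y v codim2D[OF T] by auto
  have y2: "y \<notin> mates (insert y ?R)" using y v unfolding yR by auto
  note t = crossing_link[OF R y1 y2 w]
  show "w \<notin> mates (insert w ?R)" by (rule t)
  have "?R - insert v A = T - {y} - A" using v A y by auto
  then show "mates (insert w ?R) = insert v A \<or> mates (insert w ?R) = T - {y} - A"
    using t(2) v unfolding yR by simp
qed

text \<open>Adding either of \<open>v\<close>, \<open>v'\<close> to \<open>T - {y}\<close> gives a set with a crossing link, so neither of them is
  among the mates. This leaves only the part that avoids \<open>v\<close>.\<close>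

lemma exchange_same_level:
  assumes T: "codim2 T" and A: "A \<subseteq> T" "v \<in> level T A" "v' \<in> level T A" "v \<noteq> v'" and y: "y \<in> T - A"
  shows "mates (insert v' (insert v (T - {y}))) = T - {y} - A"
proof -
  have V: "v \<in> V - T" "v' \<in> V - T" using A by (auto simp: level_def)
  have "v \<notin> mates (insert v (insert v' (T - {y})))"
    using exchange_crossing(1)[OF T A(1,3) y, of v] V A(4) by blast
  then show ?thesis
    using exchange_crossing(2)[OF T A(1,2) y, of v'] V A(4) by (auto simp: insert_commute)
qed

text \<open>A neighbour \<open>v'\<close> of \<open>v\<close> in the link of \<open>T\<close> lies in the same level as \<open>v\<close>. In the crossing link of
  \<open>insert v (T - {y})\<close> the neighbours of \<open>v'\<close> see the part complementary to the one seen from \<open>v'\<close>,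
  hence are not in the level of \<open>v\<close>; and there are more of them than just \<open>y\<close>.\<close>

lemma second_level_exists:
  assumes T: "codim2 T" and A: "A \<subseteq> T" "v \<in> level T A" and y: "y \<in> T - A"
  obtains z where "z \<in> V - T" "z \<notin> level T A" "mates (insert z (insert v (T - {y}))) = insert v A"
proof -
  have v: "v \<in> V - T" "mates (insert v T) = insert v A" using A by (auto simp: level_def)
  let ?R = "insert v (T - {y})"
  have R: "codim2 ?R" using codim2_swap[OF T _ v(1)] y by blast
  obtain v' where v': "v' \<in> nbh (insert v T)" using nbh_nonempty[OF T v(1)] by blast
  note n = nbh_insertD[OF T v(1) v']
  have v'A: "v' \<in> level T A" using level_closed[OF T A] v' by blast
  have v'R: "v' \<in> V - ?R" using n by blast
  have M': "mates (insert v' ?R) = T - {y} - A"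
    using exchange_same_level[OF T A v'A _ y] n by blast
  have nv': "v' \<notin> mates (insert v' ?R)" using M' n by blast
  have big: "card V < 3 * card (nbh (insert v' ?R))" using nbh_insert_large[OF R v'R] .
  have "3 \<le> card V" 
  proof -
    have "insert v' (insert v T) \<in> E" using v' by (simp add: nbh_def)
    then show ?thesis using edge_card edge_sub card_mono[OF finite_V] k_ge_3 by (metis le_trans)
  qed
  then have "\<not> nbh (insert v' ?R) \<subseteq> {y}"
    using big card_mono[of "{y}" "nbh (insert v' ?R)"] by auto
  then obtain z where z: "z \<in> nbh (insert v' ?R)" "z \<noteq> y" by blast
  have nz: "z \<in> V - T" "z \<noteq> v" using nbh_insertD[OF R v'R z(1)] z(2) by auto
  have Mz: "mates (insert z ?R) = insert v A"
    using mates_adjacent(3)[OF R v'R z(1) nv'] M' y A v by auto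
  have "z \<notin> level T A"
    using exchange_same_level[OF T A(1,2) _ _ y, of z] Mz nz v by auto
  then show ?thesis using that nz Mz by blast
qed

text \<open>It suffices to see this for one vertex \<open>z0\<close> outside the level, as only one other level exists. For
  the \<open>z0\<close> given by \<open>second_level_exists\<close>, the link of \<open>insert z0 (T - {y})\<close> joins similar vertices, and
  \<open>y\<close> is one of its vertices.\<close>

lemma other_level_contains_complement:
  assumes T: "codim2 T" and A: "A \<subseteq> T" "u \<in> level T A" and z: "z \<in> V - T" "z \<notin> level T A"
    and y: "y \<in> T - A"
  shows "y \<in> mates (insert z T)"
proof -
  obtain z0 where z0: "z0 \<in> V - T" "z0 \<notin> level T A" "mates (insert z0 (insert u (T - {y}))) = insert u A"
    using second_level_exists[OF T A y] .
  have u: "u \<in> V - T" using A by (auto simp: level_def)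
  have uz: "u \<noteq> z0" using A z0 by auto
  obtain C where C: "C \<subseteq> T" "z0 \<in> level T C" using in_level[OF T A(2) z0(1)] .
  have "C \<noteq> A" using C z0 by auto
  then have zC: "z \<in> level T C" using two_levels_only[OF T A z C] by blast
  let ?R = "insert z0 (T - {y})"
  have R: "codim2 ?R" using codim2_swap[OF T _ z0(1)] y by blast
  have uR: "u \<in> V - ?R" using u uz by blast
  have "u \<in> mates (insert u ?R)" using z0(3) by (simp add: insert_commute)
  moreover have yR: "y \<in> V - ?R" using y z0 codim2D[OF T] by auto
  ultimately have "y \<in> mates (insert y ?R)" using parallel_link[OF R uR] by blast
  moreover have "insert y ?R = insert z0 T" using y by auto
  ultimately have "y \<in> insert z0 C" using C by (simp add: level_def)
  then have "y \<in> C" using y z0 by auto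
  then show ?thesis using zC by (simp add: level_def)
qed

text \<open>Otherwise \<open>insert z (T - {y})\<close> would have a crossing link, in which \<open>y\<close> would be dissimilar to
  its neighbours, contrary to \<open>other_level_contains_complement\<close>.\<close>

lemma exchange_other_level:
  assumes T: "codim2 T" and A: "A \<subseteq> T" "v \<in> level T A" and z: "z \<in> V - T" "z \<notin> level T A"
    and y: "y \<in> T - A"
  shows "mates (insert z (insert v (T - {y}))) = insert v A"
proof (rule ccontr)
  assume neq: "\<not> ?thesis"
  have v: "v \<in> V - T" using A by (auto simp: level_def)
  have vz: "v \<noteq> z" using A z by auto
  have Mz: "mates (insert z (insert v (T - {y}))) = T - {y} - A"
    using exchange_crossing(2)[OF T A y, of z] neq z vz by blast
  let ?R = "insert z (T - {y})"
  have R: "codim2 ?R" using codim2_swap[OF T _ z(1)] y by blast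
  have vR: "v \<in> V - ?R" using v vz by blast
  have "v \<notin> mates (insert v ?R)" using Mz v by (simp add: insert_commute)
  moreover have yR: "y \<in> V - ?R" using y z codim2D[OF T] by auto
  ultimately have "y \<notin> mates (insert y ?R)" using crossing_link(1)[OF R vR] by blast
  moreover have "insert y ?R = insert z T" using y by auto
  ultimately show False using other_level_contains_complement[OF T A z y] by simp
qed

text \<open>The second level of \<open>T\<close> sees exactly the complementary part. It sees at least \<open>T - A\<close>; suppose that
  it also sees some \<open>x \<in> A\<close>, that is, \<open>x\<close> and some \<open>z\<close> of the second level are in one class. Replace \<open>x\<close>
  by a vertex \<open>v\<close> of the first level: the levels of the new set are essentially those of \<open>T\<close>, so the
  neighbours of \<open>v\<close> in the link of \<open>insert z (T - {x})\<close> all lie in the second level of \<open>T\<close>, and so do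
  those of \<open>x\<close>. The second level has fewer than two thirds of the vertices, so these neighbourhoods
  meet. Hence the whole first level, \<open>x\<close>, and the neighbours of \<open>x\<close> are in one level of the link of
  \<open>insert z (T - {x})\<close>, and no room is left for the other level.\<close>

lemma classes_exchanged:
  assumes T: "codim2 T" and A: "A \<subseteq> T" "u \<in> level T A"
  shows "\<exists>z. z \<in> level T (T - A)"
proof -
  obtain y where y: "y \<in> T - A" using level_proper[OF T A(2)] by blast
  obtain z where z: "z \<in> V - T" "z \<notin> level T A" using second_level_exists[OF T A y] by metis
  obtain C where C: "C \<subseteq> T" "z \<in> level T C" using in_level[OF T A(2) z(1)] .
  have MzC: "mates (insert z T) = insert z C" using C by (simp add: level_def)
  have "C \<noteq> A" using C z by auto
  have "T - A \<subseteq> C" using other_level_contains_complement[OF T A z] MzC z by auto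
  moreover have "x \<notin> A" if xC: "x \<in> C" for x
  proof
    assume xA: "x \<in> A"
    then have xT: "x \<in> T" using A by auto
    let ?Q2 = "level T C"
    let ?S = "insert z (T - {x})"
    have S: "codim2 ?S" using codim2_swap[OF T xT z(1)] .
    have Q2_iff: "w \<in> ?Q2 \<longleftrightarrow> w \<notin> level T A" if "w \<in> V - T" for w
      using two_levels_only[OF T A that _ C \<open>C \<noteq> A\<close>] level_disjoint[OF A(1) C(1)] \<open>C \<noteq> A\<close> by blast
    have sub: "nbh (insert v ?S) \<subseteq> ?Q2" if v: "v \<in> level T A" for v
    proof -
      have v': "v \<in> V - T" "mates (insert v T) = insert v A" using v by (auto simp: level_def)
      have vz: "v \<noteq> z" using v z by auto
      let ?T = "insert v (T - {x})" and ?A = "insert v (A - {x})"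
      have T': "codim2 ?T" using codim2_swap[OF T xT v'(1)] .
      have A': "?A \<subseteq> ?T" using A by auto
      have xT': "insert x ?T = insert v T" using xT by auto
      have x': "x \<in> level ?T ?A"
      proof -
        have "mates (insert x ?T) = insert x ?A" unfolding xT' using v' xA by auto
        moreover have "x \<in> V - ?T" using v' xT codim2D[OF T] by auto
        ultimately show ?thesis by (simp add: level_def)
      qed
      have y': "y \<in> ?T - ?A" using y v' xA by auto
      have same: "insert w (insert x (?T - {y})) = insert w (insert v (T - {y}))" for w
        using xT v' y xA by auto
      have eqA: "insert x ?A = insert v A" using xA by auto
      have iff: "w \<in> level ?T ?A \<longleftrightarrow> w \<in> level T A" if w: "w \<in> V - insert v T" for w
      proof
        assume "w \<in> level ?T ?A"
        then have "mates (insert w (insert x (?T - {y}))) = ?T - {y} - ?A"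
          using exchange_same_level[OF T' A' x' _ _ y'] w xT by auto
        then have "v \<notin> mates (insert w (insert v (T - {y})))" unfolding same by auto
        then show "w \<in> level T A" using exchange_other_level[OF T A(1) v _ _ y, of w] w by auto
      next
        assume wA: "w \<in> level T A"
        show "w \<in> level ?T ?A"
        proof (rule ccontr)
          assume "w \<notin> level ?T ?A"
          then have "mates (insert w (insert x (?T - {y}))) = insert x ?A"
            using exchange_other_level[OF T' A' x' _ _ y', of w] w by auto
          moreover have "mates (insert w (insert v (T - {y}))) = T - {y} - A"
            using exchange_same_level[OF T A(1) v wA _ y] w by auto
          ultimately show False unfolding same eqA using v'(1) by blast
        qed
      qed
      have z'T: "z \<in> V - ?T" using z vz by auto
      have zn: "z \<notin> level ?T ?A" using iff[of z] z vz by auto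
      obtain D where D: "D \<subseteq> ?T" "z \<in> level ?T D" using in_level[OF T' x' z'T] .
      have "D \<noteq> ?A" using D zn by auto
      have "nbh (insert z ?T) \<subseteq> level ?T D" using level_closed[OF T' D] .
      moreover have "insert z ?T = insert v ?S" by auto
      moreover have "w \<in> ?Q2" if w: "w \<in> level ?T D" for w
      proof -
        have "w \<notin> level ?T ?A" using level_disjoint[OF D(1) A' \<open>D \<noteq> ?A\<close>] w by blast
        moreover have "w \<noteq> x" using calculation x' by auto
        moreover have "w \<in> V - ?T" using w by (auto simp: level_def)
        ultimately show ?thesis using iff[of w] Q2_iff[of w] by auto
      qed
      ultimately show ?thesis by auto
    qed
    have xS: "insert x ?S = insert z T" using xT by auto
    have x_in: "x \<in> V - ?S" using xT codim2D[OF T] z by auto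
    have "x \<in> mates (insert x ?S)" using MzC xC unfolding xS by auto
    then have "x \<in> level ?S (mates (insert x ?S) - {x})" using x_in by (auto simp: level_def)
    moreover have "mates (insert x ?S) - {x} \<subseteq> ?S" using mates_subset[of "insert x ?S"] by blast
    ultimately obtain D where D: "D \<subseteq> ?S" "x \<in> level ?S D" by blast
    have NzS: "nbh (insert x ?S) \<subseteq> ?Q2" unfolding xS using level_closed[OF T C] .
    have Q1: "level T A \<subseteq> level ?S D"
    proof
      fix v assume v: "v \<in> level T A"
      have v': "v \<in> V - ?S" using v z by (auto simp: level_def)
      have "nbh (insert v ?S) \<inter> nbh (insert x ?S) \<noteq> {}"
        using three_large_meet[OF level_sub nbh_sub nbh_sub level_large[OF T A] nbh_insert_large[OF S v'] nbh_insert_large[OF S x_in]]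
          sub[OF v] NzS level_disjoint[OF A(1) C(1)] \<open>C \<noteq> A\<close> by blast
      then obtain w where w: "w \<in> nbh (insert v ?S)" "w \<in> nbh (insert x ?S)" by blast
      have "w \<in> level ?S D" using level_closed[OF S D] w by blast
      then have "nbh (insert w ?S) \<subseteq> level ?S D" using level_closed[OF S D(1)] by blast
      then show "v \<in> level ?S D" using nbh_insertD(3)[OF S v' w(1)] by blast
    qed
    obtain y' where y': "y' \<in> ?S - D" using level_proper[OF S D(2)] by blast
    obtain q where q: "q \<in> V - ?S" "q \<notin> level ?S D" using second_level_exists[OF S D y'] by metis
    obtain F where F: "F \<subseteq> ?S" "q \<in> level ?S F" using in_level[OF S D(2) q(1)] .
    have "F \<noteq> D" using F q by auto
    have df: "level ?S D \<inter> level ?S F = {}" using level_disjoint[OF D(1) F(1)] \<open>F \<noteq> D\<close> by blast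
    have "level T A \<inter> nbh (insert x ?S) = {}" using NzS level_disjoint[OF A(1) C(1)] \<open>C \<noteq> A\<close> by blast
    moreover have "nbh (insert x ?S) \<subseteq> level ?S D" using level_closed[OF S D] .
    ultimately show False
      using three_large_meet[OF level_sub nbh_sub level_sub level_large[OF T A] nbh_insert_large[OF S x_in] level_large[OF S F]]
        Q1 df by blast
  qed
  ultimately have "C = T - A" using C(1) by blast
  then show ?thesis using C by blast
qed

definition sim_class :: "'a set \<Rightarrow> 'a \<Rightarrow> 'a set" where
  "sim_class e x = {y \<in> e. sim e x y}"

definition class_sizes :: "nat set" where
  "class_sizes = {card (sim_class e x) | e x. e \<in> E \<and> x \<in> e}"

lemma sim_class_complement:
  assumes e: "e \<in> E" and x: "x \<in> e" and y: "y \<in> e" "\<not> sim e x y"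
  shows "sim_class e y = e - sim_class e x"
proof -
  have "sim e y z \<longleftrightarrow> \<not> sim e x z" if "z \<in> e" for z
    using sim_three[OF e x that y(1)] sim_trans[OF e x that y(1)] y(2) sim_commute[of e y z] by auto
  then show ?thesis by (auto simp: sim_class_def)
qed

lemma class_sizes_bounds:
  assumes "a \<in> class_sizes" shows "1 \<le> a \<and> a \<le> k - 1"
proof -
  obtain e x where e: "e \<in> E" "x \<in> e" "a = card (sim_class e x)"
    using assms by (auto simp: class_sizes_def)
  obtain y where y: "y \<in> e" "\<not> sim e x y" using not_all_sim[OF e(1,2)] by blast
  have "sim_class e x \<subseteq> e - {y}" "x \<in> sim_class e x" using y e by (auto simp: sim_class_def)
  moreover have "finite (e - {y})" using finite_edge e by blast
  ultimately have "0 < a" "a \<le> card (e - {y})"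
    using e card_mono[of "e - {y}" "sim_class e x"] finite_subset[of "sim_class e x" "e - {y}"]
    by (auto simp: card_gt_0_iff)
  then show ?thesis using card_edge_minus[OF e(1) y(1)] by simp
qed

lemma class_sizes_complement:
  assumes "a \<in> class_sizes" shows "k - a \<in> class_sizes"
proof -
  obtain e x where e: "e \<in> E" "x \<in> e" "a = card (sim_class e x)"
    using assms by (auto simp: class_sizes_def)
  obtain y where y: "y \<in> e" "\<not> sim e x y" using not_all_sim[OF e(1,2)] by blast
  have "card (sim_class e y) = k - a"
    unfolding sim_class_complement[OF e(1,2) y] e(3)
    using finite_edge[OF e(1)] edge_card[OF e(1)]
    by (subst card_Diff_subset) (auto simp: sim_class_def)
  then show ?thesis using e y unfolding class_sizes_def
    by (intro CollectI exI[of _ e] exI[of _ y]) simp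
qed

lemma card_class_level:
  assumes T: "codim2 T" and A: "A \<subseteq> T" "u \<in> level T A"
  shows "card A + 2 \<in> class_sizes"
proof -
  have u: "u \<in> V - T" "mates (insert u T) = insert u A" using A by (auto simp: level_def)
  obtain w where w: "w \<in> nbh (insert u T)" using nbh_nonempty[OF T u(1)] by blast
  note n = nbh_insertD[OF T u(1) w]
  let ?e = "insert w (insert u T)"
  have e: "?e \<in> E" using w by (simp add: nbh_def)
  have "sim_class ?e w = insert w (insert u A)"
    using mates_iff[OF card_insert_codim2[OF T u(1)] w] u A by (auto simp: sim_class_def)
  moreover have "card (insert w (insert u A)) = card A + 2"
    using n u A finite_subset[OF A(1) codim2D(1)[OF T]] by (auto simp: card_insert_if)
  moreover have "card (sim_class ?e w) \<in> class_sizes" using e unfolding class_sizes_def by blast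
  ultimately show ?thesis by simp
qed

text \<open>Remove two vertices \<open>x\<close>, \<open>w\<close> of the class and let \<open>T\<close> be the rest of the edge. By
  \<open>classes_exchanged\<close>, \<open>T\<close> also extends to an edge in which the two new vertices join the opposite
  class.\<close>

lemma class_sizes_step:
  assumes "a \<in> class_sizes" "2 \<le> a" shows "a - 2 \<in> class_sizes"
proof -
  obtain e x where e: "e \<in> E" "x \<in> e" "a = card (sim_class e x)"
    using assms by (auto simp: class_sizes_def)
  have "sim_class e x \<noteq> {x}" using assms(2) e(3) by auto
  moreover have "x \<in> sim_class e x" using e(2) by (simp add: sim_class_def)
  ultimately obtain w where "w \<in> sim_class e x" "w \<noteq> x" by blast
  then have w: "w \<in> e" "w \<noteq> x" "sim e x w" by (simp_all add: sim_class_def)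
  define T where "T = e - {x, w}"
  define A where "A = sim_class e x - {x, w}"
  have eq: "insert x T = e - {w}" using e w by (auto simp: T_def)
  have "card T = k - card {x, w}"
    unfolding T_def edge_card[OF e(1), symmetric] using e w by (intro card_Diff_subset) auto
  then have T: "codim2 T" using edge_sub[OF e(1)] w(2) by (auto simp: codim2_def T_def)
  have A: "A \<subseteq> T" by (auto simp: A_def T_def sim_class_def)
  have "mates (e - {w}) = insert x A"
  proof -
    have "y \<in> mates (e - {w}) \<longleftrightarrow> y \<in> e \<and> y \<noteq> w \<and> sim e x y" for y
    proof (cases "y \<in> e - {w}")
      case True
      then have "y \<in> mates (e - {w}) \<longleftrightarrow> sim e w y" using mates_minus_iff[OF e(1) w(1), of y] by auto
      also have "\<dots> \<longleftrightarrow> sim e x y"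
      proof
        assume "sim e w y"
        then show "sim e x y" using sim_trans[OF e(1,2) w(1) _ w(3)] True by blast
      next
        assume "sim e x y"
        moreover have "sim e w x" using w(3) sim_commute by blast
        ultimately show "sim e w y" using sim_trans[OF e(1) w(1) e(2)] True by blast
      qed
      finally show ?thesis using True by simp
    next
      case False
      then show ?thesis using mates_subset[of "e - {w}"] by auto
    qed
    then have "mates (e - {w}) = {y \<in> e. y \<noteq> w \<and> sim e x y}" by blast
    also have "\<dots> = insert x A" using e(2) w(2) by (auto simp: A_def sim_class_def)
    finally show ?thesis .
  qed
  then have x: "x \<in> level T A"
  proof -
    have "x \<in> V - T" using e(2) edge_sub[OF e(1)] by (auto simp: T_def)
    then show ?thesis using \<open>mates (e - {w}) = insert x A\<close> by (simp add: level_def eq)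
  qed
  obtain z where z: "z \<in> level T (T - A)" using classes_exchanged[OF T A x] by blast
  have "card (T - A) + 2 \<in> class_sizes" using card_class_level[OF T _ z] by blast
  then have "k - (card (T - A) + 2) \<in> class_sizes" by (rule class_sizes_complement)
  moreover have "card A = a - card {x, w}"
    unfolding A_def e(3) using w e by (intro card_Diff_subset) (auto simp: sim_class_def)
  then have "card A = a - 2" using w(2) by simp
  moreover have "card (T - A) = card T - card A"
    by (rule card_Diff_subset[OF finite_subset[OF A codim2D(1)[OF T]] A])
  moreover have "card A \<le> card T" by (rule card_mono[OF codim2D(1)[OF T] A])
  moreover have "k - (k - 2 - (a - 2) + 2) = a - 2" if "a - 2 \<le> k - 2"
    using that k_ge_3 by linarith
  ultimately show ?thesis using codim2D(3)[OF T] by metis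
qed

lemma class_sizes_descend:
  "a \<in> class_sizes \<Longrightarrow> 2 * j \<le> a \<Longrightarrow> a - 2 * j \<in> class_sizes"
proof (induction j)
  case (Suc j)
  then show ?case using class_sizes_step[of "a - 2 * j"] by simp
qed simp

text \<open>Descending in steps of two from an even size would lead to an empty class.\<close>

lemma class_sizes_odd: "a \<in> class_sizes \<Longrightarrow> odd a"
  using class_sizes_descend[of a "a div 2"] class_sizes_bounds[of 0] by auto

lemma all_odd_class_sizes:
  assumes "E \<noteq> {}"
  shows "even k" and "\<And>b. odd b \<Longrightarrow> b < k \<Longrightarrow> b \<in> class_sizes"
proof -
  obtain e where e: "e \<in> E" using assms by blast
  then have "e \<noteq> {}" using edge_card[OF e] k_ge_3 by auto
  then obtain a where a: "a \<in> class_sizes" using e by (auto simp: class_sizes_def)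
  have oa: "odd a" "odd (k - a)" "a \<le> k - 1"
    using class_sizes_odd[OF a] class_sizes_odd[OF class_sizes_complement[OF a]]
      class_sizes_bounds[OF a] by blast+
  have "even (a + (k - a))" using oa by simp
  moreover have "a + (k - a) = k" using oa k_ge_3 by simp
  ultimately show ev: "even k" by simp
  have "1 \<in> class_sizes"
  proof -
    have "a - 2 * (a div 2) = 1" using oa(1) by presburger
    then show ?thesis using class_sizes_descend[OF a, of "a div 2"] by simp
  qed
  then have km: "k - 1 \<in> class_sizes" by (rule class_sizes_complement)
  fix b :: nat assume b: "odd b" "b < k"
  then have "2 * ((k - 1 - b) div 2) = k - 1 - b" using ev by auto
  then show "b \<in> class_sizes"
    using class_sizes_descend[OF km, of "(k - 1 - b) div 2"] b by simp
qed

text \<open>Put a class of size \<open>m\<close> on the positions divisible by \<open>d\<close>. Rotation by a multiple of \<open>d\<close> then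
  permutes the positions within the two classes, and transpositions within a class take three rounds.\<close>

lemma class_size_not_quotient:
  assumes m: "k = m * d" and d: "d dvd l"
  shows "m \<notin> class_sizes"
proof
  assume mc: "m \<in> class_sizes"
  obtain e x where e: "e \<in> E" "x \<in> e" "m = card (sim_class e x)"
    using mc by (auto simp: class_sizes_def)
  define A where "A = sim_class e x"
  have Ae: "A \<subseteq> e" "card A = m" "finite e" "card e = k"
    using e finite_edge edge_card by (auto simp: A_def sim_class_def)
  have d0: "0 < d" using m k_ge_3 by (cases d) auto
  define I where "I = {i. i < k \<and> d dvd i}"
  have I: "I = (\<lambda>j. d * j) ` {..<m}"
  proof -
    have "i < m * d \<and> d dvd i \<longleftrightarrow> (\<exists>j<m. i = d * j)" for i
      using d0 by (auto simp: dvd_def mult.commute)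
    then show ?thesis by (auto simp: I_def m[symmetric] image_iff)
  qed
  have cI: "card I = m" unfolding I using d0 by (subst card_image) (auto simp: inj_on_def)
  have Ik: "I \<subseteq> {..<k}" by (auto simp: I_def)
  obtain g where g: "bij_betw g I A"
    using finite_same_card_bij[of I A] cI Ae(2) finite_subset[OF Ik] finite_subset[OF Ae(1,3)] by auto
  have "card ({..<k} - I) = card (e - A)"
    using cI Ae(2,4) card_Diff_subset[OF finite_subset[OF Ik] Ik]
      card_Diff_subset[OF finite_subset[OF Ae(1,3)] Ae(1)] by simp
  then obtain h where h: "bij_betw h ({..<k} - I) (e - A)"
    using finite_same_card_bij[of "{..<k} - I" "e - A"] Ae by auto
  define f where "f i = (if i \<in> I then g i else h i)" for i
  have "bij_betw f (I \<union> ({..<k} - I)) (A \<union> (e - A))"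
  proof -
    have "f = (\<lambda>i. if i \<in> I then g i else h i)" by (auto simp: f_def)
    then show ?thesis using bij_betw_disjoint_Un[OF g h] by (simp only:) blast
  qed
  moreover have "I \<union> ({..<k} - I) = {..<k}" "A \<union> (e - A) = e" using Ik Ae(1) by auto
  ultimately have f: "bij_betw f {..<k} e" by simp
  then have of: "ordered_edge f" and fe: "f ` {..<k} = e" using e by (auto simp: ordered_edge_def bij_betw_def)
  have fA: "f i \<in> A \<longleftrightarrow> d dvd i" if "i < k" for i
  proof (cases "i \<in> I")
    case True
    then show ?thesis using g by (auto simp: f_def I_def bij_betw_def)
  next
    case False
    then show ?thesis using h that by (auto simp: f_def I_def bij_betw_def)
  qed
  have sw: "swap 3 f i j" if "i < k" "j < k" "i \<noteq> j" "(d dvd i) = (d dvd j)" for i j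
  proof (rule sim_swap[OF of that(1-3)])
    have ij: "f i \<in> e" "f j \<in> e" using that fe by auto
    have "sim e x (f i) \<longleftrightarrow> sim e x (f j)"
      using fA[of i] fA[of j] that ij by (simp add: A_def sim_class_def)
    then show "sim_at f i j"
      unfolding fe using ij sim_three[OF e(1,2) ij]
        sim_trans[OF e(1) ij(1) e(2) ij(2)] sim_commute[of e x "f i"] by metis
  qed
  have rot: "(d dvd rot offset i) = (d dvd i)" if "i < k" for i
  proof -
    have "d dvd k" using m by simp
    moreover from this have "d dvd offset" unfolding offset_def
      by (intro dvd_diff_nat dvd_mod d)
    ultimately show ?thesis using that by (simp only: rot_def if_True dvd_mod_iff dvd_add_left_iff)
  qed
  have "(f, f \<circ> rot offset) \<in> step ^^ (3 * k)"
    by (rule steps_permutation[where cls = "\<lambda>i. d dvd i", OF of sw order.refl rot_permutes rot])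
  then show False using rot_unreachable[OF of, of "3 * k"] by simp
qed

lemma odd_quotient_contradiction:
  assumes "E \<noteq> {}" "odd (k div gcd k l)"
  shows False
proof -
  define d where "d = gcd k l"
  have d: "d dvd k" "d dvd l" by (simp_all add: d_def)
  define m where "m = k div d"
  have m: "k = m * d" using d(1) by (simp add: m_def)
  have "odd m" using assms(2) by (simp add: m_def d_def)
  have "even k" using all_odd_class_sizes(1)[OF assms(1)] .
  then have "m \<noteq> k" using \<open>odd m\<close> by blast
  moreover have "m \<le> k" unfolding m_def by (rule div_le_dividend)
  ultimately have "m < k" by simp
  then have "m \<in> class_sizes" using all_odd_class_sizes(2)[OF assms(1) \<open>odd m\<close>] by blast
  then show False using class_size_not_quotient[OF m d(2)] by blast
qed

end

section \<open>Random samples of vertices\<close>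

text \<open>Both sides agree at \<open>t = 1\<close>, where the left one has the larger derivative.\<close>

lemma chernoff_parameter:
  fixes \<alpha> \<beta> :: real
  assumes "\<beta> < \<alpha>"
  obtains t where "0 < t" "t < 1" "1 - (1 - t) * \<alpha> < t powr \<beta>"
proof -
  let ?h = "\<lambda>t. t powr \<beta> + (1 - t) * \<alpha>"
  have "(?h has_real_derivative (\<beta> - \<alpha>)) (at 1)"
    by (auto intro!: derivative_eq_intros)
  from DERIV_neg_dec_left[OF this] obtain d where
    d: "d > 0" "\<And>h. 0 < h \<Longrightarrow> h < d \<Longrightarrow> ?h 1 < ?h (1 - h)"
    using assms by auto
  define s where "s = min (d / 2) (1 / 2)"
  have "0 < s" "s < d" "s < 1" using d by (auto simp: s_def min_def)
  then show ?thesis using d(2)[of s] that[of "1 - s"] by auto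
qed

lemma card_PiE_const: "finite I \<Longrightarrow> card (I \<rightarrow>\<^sub>E V) = card V ^ card I"
  by (rule card_funcsetE)

text \<open>Exponential moment bound for random maps of \<open>N\<close> points to \<open>V\<close>. Once the images of the points of \<open>I\<close> are
  fixed, the images of the other points are independent. The map is weighted by \<open>t\<close> to the power of
  the number of them that complete an edge, and the sum of the weights factorises over the points.\<close>

lemma few_low_codegree_maps:
  fixes \<alpha> \<beta> t :: real
  assumes V: "finite V" "card V = n" and I: "I \<subseteq> {..<N}" "card I = q" and t: "0 < t" "t < 1"
    and \<alpha>: "\<alpha> \<le> 1"
    and deg: "\<And>S. S \<subseteq> V \<Longrightarrow> card S = q \<Longrightarrow> \<alpha> * n \<le> card {v \<in> V. insert v S \<in> E}"
  defines "B \<equiv> {f \<in> {..<N} \<rightarrow>\<^sub>E V. inj_on f {..<N} \<and>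
                  real (card {j \<in> {..<N}. insert (f j) (f ` I) \<in> E}) < \<beta> * N}"
  shows "card B * t powr (\<beta> * N) \<le> real n ^ N * (1 - (1 - t) * \<alpha>) ^ (N - q)"
proof -
  define J where "J = {..<N} - I"
  define w where "w g x = (if insert x (g ` I) \<in> E then t else 1)" for g :: "nat \<Rightarrow> 'a" and x
  define G where "G = {g \<in> I \<rightarrow>\<^sub>E V. inj_on g I}"
  have finI: "finite I" "finite J" using I finite_subset by (auto simp: J_def)
  have cJ: "card J = N - q" using I finI by (simp add: J_def card_Diff_subset)
  have qN: "q \<le> N" using I card_mono[of "{..<N}" I] by auto
  have fG: "finite G" unfolding G_def using finite_PiE[of I "\<lambda>_. V"] finI V by auto
  have fJ: "finite (J \<rightarrow>\<^sub>E V)" using finite_PiE[of J "\<lambda>_. V"] finI V by auto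
  have c0: "0 \<le> 1 - (1 - t) * \<alpha>"
  proof -
    have "1 - (1 - t) * \<alpha> = t + (1 - t) * (1 - \<alpha>)" by (simp add: algebra_simps)
    moreover have "0 \<le> (1 - t) * (1 - \<alpha>)" using t \<alpha> by (intro mult_nonneg_nonneg) auto
    ultimately show ?thesis using t by linarith
  qed
  have fB: "finite B" unfolding B_def using finite_PiE[of "{..<N}" "\<lambda>_. V"] V by auto
  have low: "t powr (\<beta> * N) \<le> (\<Prod>j\<in>J. w f (f j))" if f: "f \<in> B" for f
  proof -
    have "(\<Prod>j\<in>J. w f (f j)) = t ^ card {j \<in> J. insert (f j) (f ` I) \<in> E}"
    proof -
      have "(\<Prod>j\<in>J. w f (f j)) = (\<Prod>j\<in>{j \<in> J. insert (f j) (f ` I) \<in> E}. t)"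
        unfolding w_def using finI by (intro prod.mono_neutral_cong_right) auto
      then show ?thesis by simp
    qed
    also have "\<dots> = t powr card {j \<in> J. insert (f j) (f ` I) \<in> E}"
      using t by (simp add: powr_realpow)
    also have "\<dots> \<ge> t powr (\<beta> * N)"
    proof (rule powr_mono')
      have "card {j \<in> J. insert (f j) (f ` I) \<in> E} \<le> card {j \<in> {..<N}. insert (f j) (f ` I) \<in> E}"
        by (intro card_mono) (auto simp: J_def)
      then show "real (card {j \<in> J. insert (f j) (f ` I) \<in> E}) \<le> \<beta> * N"
        using f by (auto simp: B_def)
    qed (use t in auto)
    finally show ?thesis .
  qed
  have "card B * t powr (\<beta> * N) = (\<Sum>f\<in>B. t powr (\<beta> * N))" by simp
  also have "\<dots> \<le> (\<Sum>f\<in>B. \<Prod>j\<in>J. w f (f j))" by (intro sum_mono low)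
  also have "\<dots> = (\<Sum>f\<in>B. \<Prod>j\<in>J. w (restrict f I) (restrict f J j))"
    by (intro sum.cong prod.cong refl) (simp add: w_def)
  also have "\<dots> = (\<Sum>p\<in>(\<lambda>f. (restrict f I, restrict f J)) ` B. \<Prod>j\<in>J. w (fst p) (snd p j))"
  proof -
    have "inj_on (\<lambda>f. (restrict f I, restrict f J)) B"
    proof (rule inj_onI)
      fix f g assume fg: "f \<in> B" "g \<in> B" and eq: "(restrict f I, restrict f J) = (restrict g I, restrict g J)"
      have "f j = g j" if "j \<in> {..<N}" for j
        using that eq unfolding J_def by (metis Diff_iff Pair_inject restrict_apply')
      then show "f = g" using fg by (intro PiE_ext[of f "{..<N}" "\<lambda>_. V" g]) (auto simp: B_def)
    qed
    then show ?thesis by (simp add: sum.reindex)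
  qed
  also have "\<dots> \<le> (\<Sum>p\<in>G \<times> (J \<rightarrow>\<^sub>E V). \<Prod>j\<in>J. w (fst p) (snd p j))"
  proof (rule sum_mono2)
    show "finite (G \<times> (J \<rightarrow>\<^sub>E V))" using fG fJ by simp
    show "(\<lambda>f. (restrict f I, restrict f J)) ` B \<subseteq> G \<times> (J \<rightarrow>\<^sub>E V)"
    proof (rule image_subsetI)
      fix f assume f: "f \<in> B"
      then have fV: "f x \<in> V" if "x < N" for x using that by (simp add: B_def PiE_iff)
      have "inj_on f I" using f I inj_on_subset by (auto simp: B_def)
      then have "restrict f I \<in> G" using fV I by (auto simp: G_def inj_on_def)
      moreover have "restrict f J \<in> J \<rightarrow>\<^sub>E V" using fV by (simp add: J_def)
      ultimately show "(restrict f I, restrict f J) \<in> G \<times> (J \<rightarrow>\<^sub>E V)" by simp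
    qed
    show "0 \<le> (\<Prod>j\<in>J. w (fst p) (snd p j))" for p
      using t by (intro prod_nonneg) (auto simp: w_def)
  qed
  also have "\<dots> = (\<Sum>g\<in>G. \<Sum>h\<in>J \<rightarrow>\<^sub>E V. \<Prod>j\<in>J. w g (h j))"
    by (simp add: sum.cartesian_product case_prod_beta)
  also have "\<dots> = (\<Sum>g\<in>G. \<Prod>j\<in>J. \<Sum>x\<in>V. w g x)"
    using finI V by (subst prod_sum_PiE) auto
  also have "\<dots> \<le> (\<Sum>g\<in>G. (n * (1 - (1 - t) * \<alpha>)) ^ card J)"
  proof (rule sum_mono)
    fix g assume g: "g \<in> G"
    let ?D = "{v \<in> V. insert v (g ` I) \<in> E}"
    have "g ` I \<subseteq> V" "card (g ` I) = q" using g I by (auto simp: G_def card_image)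
    then have d: "\<alpha> * n \<le> card ?D" by (rule deg)
    have "(\<Sum>x\<in>V. w g x) = (\<Sum>x\<in>V. 1 - (if x \<in> ?D then 1 - t else 0))"
      by (intro sum.cong refl) (auto simp: w_def)
    also have "\<dots> = n - (\<Sum>x\<in>V. if x \<in> ?D then 1 - t else 0)"
      using V by (simp add: sum_subtractf)
    also have "(\<Sum>x\<in>V. if x \<in> ?D then 1 - t else 0) = (\<Sum>x\<in>?D. 1 - t)"
      using V by (intro sum.mono_neutral_cong_right) auto
    also have "\<dots> = card ?D * (1 - t)" by simp
    finally have "(\<Sum>x\<in>V. w g x) = n - card ?D * (1 - t)" .
    also have "\<dots> \<le> n * (1 - (1 - t) * \<alpha>)"
      using mult_right_mono[OF d, of "1 - t"] t by (simp add: algebra_simps)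
    finally have s: "(\<Sum>x\<in>V. w g x) \<le> n * (1 - (1 - t) * \<alpha>)" .
    have "0 \<le> (\<Sum>x\<in>V. w g x)" using t by (intro sum_nonneg) (auto simp: w_def)
    then show "(\<Prod>j\<in>J. \<Sum>x\<in>V. w g x) \<le> (n * (1 - (1 - t) * \<alpha>)) ^ card J"
      using s by (simp add: power_mono)
  qed
  also have "\<dots> = card G * (n * (1 - (1 - t) * \<alpha>)) ^ (N - q)" by (simp add: cJ)
  also have "\<dots> \<le> real n ^ q * (n * (1 - (1 - t) * \<alpha>)) ^ (N - q)"
  proof (rule mult_right_mono)
    have "card G \<le> card (I \<rightarrow>\<^sub>E V)"
      unfolding G_def using finite_PiE[of I "\<lambda>_. V"] finI V by (intro card_mono) auto
    then have "card G \<le> n ^ q" using finI V I by (simp add: card_PiE_const)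
    then show "real (card G) \<le> real n ^ q" unfolding of_nat_power[symmetric] by (rule of_nat_mono)
    show "0 \<le> (real n * (1 - (1 - t) * \<alpha>)) ^ (N - q)" using c0 by simp
  qed
  also have "\<dots> = real n ^ N * (1 - (1 - t) * \<alpha>) ^ (N - q)"
    using qN by (simp add: power_mult_distrib power_add[symmetric])
  finally show ?thesis .
qed

lemma few_noninjective_maps:
  assumes "finite V" "card V = n"
  shows "card {f \<in> {..<N} \<rightarrow>\<^sub>E V. \<not> inj_on f {..<N}} \<le> N * N * n ^ (N - 1)"
proof -
  let ?P = "{p \<in> {..<N} \<times> {..<N}. fst p \<noteq> snd p}"
  let ?C = "\<lambda>p. {f \<in> {..<N} \<rightarrow>\<^sub>E V. f (fst p) = f (snd p)}"
  have fin: "finite ({..<N} \<rightarrow>\<^sub>E V)" using finite_PiE[of "{..<N}" "\<lambda>_. V"] assms by auto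
  have C: "card (?C p) \<le> n ^ (N - 1)" if p: "p \<in> ?P" for p
  proof -
    obtain i j where ij: "p = (i, j)" "i < N" "j < N" "i \<noteq> j" using p by auto
    have "inj_on (\<lambda>f. restrict f ({..<N} - {j})) (?C p)"
    proof (rule inj_onI)
      fix f g assume fg: "f \<in> ?C p" "g \<in> ?C p"
        and eq: "restrict f ({..<N} - {j}) = restrict g ({..<N} - {j})"
      have e: "f x = g x" if "x \<in> {..<N} - {j}" for x using fun_cong[OF eq, of x] that by simp
      have "f j = g j" using e[of i] fg ij by auto
      then have "f x = g x" if "x \<in> {..<N}" for x using e[of x] that by (cases "x = j") auto
      then show "f = g" using fg by (intro PiE_ext[of f "{..<N}" "\<lambda>_. V" g]) auto
    qed
    moreover have "(\<lambda>f. restrict f ({..<N} - {j})) ` ?C p \<subseteq> ({..<N} - {j}) \<rightarrow>\<^sub>E V"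
    proof (rule image_subsetI)
      fix f assume "f \<in> ?C p"
      then have "f x \<in> V" if "x < N" for x using that by (simp add: PiE_iff)
      then show "restrict f ({..<N} - {j}) \<in> ({..<N} - {j}) \<rightarrow>\<^sub>E V" by simp
    qed
    moreover have "finite (({..<N} - {j}) \<rightarrow>\<^sub>E V)" using assms by (intro finite_PiE) auto
    ultimately have "card (?C p) \<le> card (({..<N} - {j}) \<rightarrow>\<^sub>E V)" by (rule card_inj_on_le)
    then show ?thesis using ij assms by (simp add: card_PiE_const)
  qed
  have "{f \<in> {..<N} \<rightarrow>\<^sub>E V. \<not> inj_on f {..<N}} \<subseteq> (\<Union>p\<in>?P. ?C p)"
  proof
    fix f assume f: "f \<in> {f \<in> {..<N} \<rightarrow>\<^sub>E V. \<not> inj_on f {..<N}}"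
    then obtain i j where "i < N" "j < N" "i \<noteq> j" "f i = f j" unfolding inj_on_def by blast
    then have "(i, j) \<in> ?P" "f \<in> ?C (i, j)" using f by auto
    then show "f \<in> (\<Union>p\<in>?P. ?C p)" by blast
  qed
  then have "card {f \<in> {..<N} \<rightarrow>\<^sub>E V. \<not> inj_on f {..<N}} \<le> card (\<Union>p\<in>?P. ?C p)"
    using fin by (intro card_mono) auto
  also have "\<dots> \<le> (\<Sum>p\<in>?P. card (?C p))" by (intro card_UN_le) auto
  also have "\<dots> \<le> (\<Sum>p\<in>?P. n ^ (N - 1))" by (intro sum_mono C)
  also have "\<dots> = card ?P * n ^ (N - 1)" by simp
  also have "\<dots> \<le> N * N * n ^ (N - 1)"
  proof (rule mult_right_mono)
    have "card ?P \<le> card ({..<N} \<times> {..<N})" by (intro card_mono) auto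
    then show "card ?P \<le> N * N" by simp
  qed simp
  finally show ?thesis .
qed

lemma poly_times_power_tendsto_0:
  fixes \<rho> :: real
  assumes "0 < \<rho>" "\<rho> < 1"
  shows "(\<lambda>N. real N ^ q * \<rho> ^ N) \<longlonglongrightarrow> 0"
proof -
  define \<sigma> where "\<sigma> = root (Suc q) \<rho>"
  have s: "0 < \<sigma>" "\<sigma> < 1" "\<sigma> ^ Suc q = \<rho>"
    unfolding \<sigma>_def using assms real_root_gt_zero[of "Suc q" \<rho>] real_root_lt_1_iff[of "Suc q" \<rho>]
      real_root_pow_pos2[of "Suc q" \<rho>] by (simp_all del: power_Suc)
  have "(\<lambda>N. real N * \<sigma> ^ N) \<longlonglongrightarrow> 0" using powser_times_n_limit_0[of \<sigma>] s by simp
  moreover have "(\<lambda>N. \<sigma> ^ N) \<longlonglongrightarrow> 0" using s by (intro LIMSEQ_power_zero) auto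
  ultimately have lim: "(\<lambda>N. \<sigma> ^ N * (real N * \<sigma> ^ N) ^ q) \<longlonglongrightarrow> 0 * 0 ^ q"
    by (intro tendsto_mult tendsto_power)
  have eq: "\<sigma> ^ N * (real N * \<sigma> ^ N) ^ q = real N ^ q * \<rho> ^ N" for N
  proof -
    have "\<rho> ^ N = \<sigma> ^ (Suc q * N)" by (simp only: s(3)[symmetric] power_mult)
    also have "\<dots> = (\<sigma> ^ N) ^ Suc q" by (simp only: power_mult[symmetric] mult.commute)
    finally show ?thesis by (simp add: power_mult_distrib)
  qed
  show ?thesis using lim unfolding eq by simp
qed

text \<open>The points are required to have distinct images, so that the sampled hypergraph is an induced
  subhypergraph.\<close>

definition faithful_sample :: "nat \<Rightarrow> real \<Rightarrow> 'a set set \<Rightarrow> nat \<Rightarrow> (nat \<Rightarrow> 'a) \<Rightarrow> bool" where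
  "faithful_sample q \<beta> E N f \<longleftrightarrow> inj_on f {..<N} \<and>
     (\<forall>I\<subseteq>{..<N}. card I = q \<longrightarrow> \<beta> * N \<le> card {j \<in> {..<N}. insert (f j) (f ` I) \<in> E})"

text \<open>The number of sets \<open>I\<close> grows polynomially in \<open>N\<close>, whereas the proportion of maps failing at a given \<open>I\<close>
  decays exponentially. The bound \<open>N0\<close> on the sample size depends on \<open>\<alpha>\<close> and \<open>\<beta>\<close> only; the bound
  \<open>n0\<close> on the host makes repeated images rare.\<close>

lemma most_samples_faithful:
  fixes \<alpha> \<beta> :: real
  assumes ab: "\<beta> < \<alpha>" "\<alpha> \<le> 1"
  shows "\<exists>N0. \<forall>N\<ge>N0. \<exists>n0. \<forall>n\<ge>n0. \<forall>(V :: 'a set) E. finite V \<and> card V = n \<and>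
           (\<forall>S\<subseteq>V. card S = q \<longrightarrow> \<alpha> * n \<le> card {v \<in> V. insert v S \<in> E}) \<longrightarrow>
           real n ^ N \<le> 2 * card {f \<in> {..<N} \<rightarrow>\<^sub>E V. faithful_sample q \<beta> E N f}"
proof -
  obtain t where t: "0 < t" "t < 1" "1 - (1 - t) * \<alpha> < t powr \<beta>"
    using chernoff_parameter[OF ab(1)] by blast
  define c where "c = 1 - (1 - t) * \<alpha>"
  \<comment> \<open>The proportion of maps failing at a given set is of order \<open>\<rho> ^ N\<close>.\<close>
  define \<rho> where "\<rho> = c / t powr \<beta>"
  have "c = t + (1 - t) * (1 - \<alpha>)" by (simp add: c_def algebra_simps)
  moreover have "0 \<le> (1 - t) * (1 - \<alpha>)" using t ab by (intro mult_nonneg_nonneg) auto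
  ultimately have "0 < c" using t by linarith
  with t have c: "0 < c" "c < t powr \<beta>" by (auto simp: c_def)
  then have \<rho>: "0 < \<rho>" "\<rho> < 1" using t by (auto simp: \<rho>_def)
  have lim: "(\<lambda>N. real N ^ q * \<rho> ^ N / c ^ q) \<longlonglongrightarrow> 0 / c ^ q"
    by (intro tendsto_divide poly_times_power_tendsto_0 \<rho> tendsto_const) (use c in auto)
  have "\<forall>\<^sub>F N in sequentially. real N ^ q * \<rho> ^ N / c ^ q < 1 / 4"
    by (rule order_tendstoD(2)[OF lim]) simp
  then obtain N1 where N1: "\<And>N. N \<ge> N1 \<Longrightarrow> real N ^ q * \<rho> ^ N / c ^ q < 1 / 4"
    by (auto simp: eventually_sequentially)
  show ?thesis
  proof (rule exI[of _ "max N1 (max q 1)"], intro allI impI)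
    fix N assume N: "max N1 (max q 1) \<le> N"
    show "\<exists>n0. \<forall>n\<ge>n0. \<forall>(V :: 'a set) E. finite V \<and> card V = n \<and>
           (\<forall>S\<subseteq>V. card S = q \<longrightarrow> \<alpha> * n \<le> card {v \<in> V. insert v S \<in> E}) \<longrightarrow>
           real n ^ N \<le> 2 * card {f \<in> {..<N} \<rightarrow>\<^sub>E V. faithful_sample q \<beta> E N f}"
    proof (intro exI[of _ "4 * N * N"] allI impI, elim conjE)
      fix n and V :: "'a set" and E
      assume n: "4 * N * N \<le> n" and V: "finite V" "card V = n"
        and deg: "\<forall>S\<subseteq>V. card S = q \<longrightarrow> \<alpha> * n \<le> card {v \<in> V. insert v S \<in> E}"
      let ?P = "{..<N} \<rightarrow>\<^sub>E V"
      let ?good = "{f \<in> ?P. faithful_sample q \<beta> E N f}"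
      let ?ni = "{f \<in> ?P. \<not> inj_on f {..<N}}"
      define B where "B I = {f \<in> ?P. inj_on f {..<N} \<and>
                  real (card {j \<in> {..<N}. insert (f j) (f ` I) \<in> E}) < \<beta> * N}" for I
      let ?Is = "{I. I \<subseteq> {..<N} \<and> card I = q}"
      have fP: "finite ?P" using finite_PiE[of "{..<N}" "\<lambda>_. V"] V by auto
      have "?P \<subseteq> ?good \<union> (?ni \<union> (\<Union>I\<in>?Is. B I))"
        by (auto simp: faithful_sample_def B_def not_le)
      then have "card ?P \<le> card (?good \<union> (?ni \<union> (\<Union>I\<in>?Is. B I)))"
        using fP by (intro card_mono) (auto simp: B_def)
      also have "\<dots> \<le> card ?good + (card ?ni + card (\<Union>I\<in>?Is. B I))"
        by (meson card_Un_le le_trans add_left_mono)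
      finally have "n ^ N \<le> card ?good + (card ?ni + card (\<Union>I\<in>?Is. B I))"
        using V by (simp add: card_PiE_const)
      then have "real (n ^ N) \<le> real (card ?good + (card ?ni + card (\<Union>I\<in>?Is. B I)))"
        by (rule of_nat_mono)
      then have main: "real n ^ N \<le> card ?good + (card ?ni + card (\<Union>I\<in>?Is. B I))"
        by (simp only: of_nat_add of_nat_power)
      have ni: "real (card ?ni) \<le> real n ^ N / 4"
      proof -
        have "4 * card ?ni \<le> 4 * (N * N * n ^ (N - 1))"
          using few_noninjective_maps[OF V] by simp
        also have "\<dots> \<le> n * n ^ (N - 1)" using n by (simp add: mult.assoc[symmetric])
        also have "\<dots> = n ^ N" using N by (simp add: power_Suc[symmetric] del: power_Suc)
        finally have "real (4 * card ?ni) \<le> real (n ^ N)" by (rule of_nat_mono)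
        then show ?thesis by simp
      qed
      have BI: "real (card (B I)) \<le> real n ^ N * (\<rho> ^ N / c ^ q)" if "I \<in> ?Is" for I
      proof -
        have "card (B I) * t powr (\<beta> * N) \<le> real n ^ N * c ^ (N - q)"
          unfolding B_def c_def using that deg by (intro few_low_codegree_maps V t ab) auto
        also have "c ^ (N - q) = c ^ N / c ^ q" using N c by (simp add: power_diff)
        finally have "card (B I) * t powr (\<beta> * N) \<le> real n ^ N * (c ^ N / c ^ q)" .
        moreover have "t powr (\<beta> * N) = (t powr \<beta>) ^ N" using t
          by (simp add: powr_powr[symmetric] powr_realpow)
        moreover have "c ^ N = \<rho> ^ N * (t powr \<beta>) ^ N"
          using t by (simp add: \<rho>_def power_mult_distrib[symmetric])
        ultimately have "card (B I) * (t powr \<beta>) ^ N \<le> (real n ^ N * (\<rho> ^ N / c ^ q)) * (t powr \<beta>) ^ N"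
          by simp
        then show ?thesis by (rule mult_right_le_imp_le) (use t in simp)
      qed
      have fin: "finite ?Is" by (rule finite_subset[of _ "Pow {..<N}"]) auto
      have "card ?Is \<le> N ^ q"
        using n_subsets[of "{..<N}" q] binomial_le_pow[of q N] N by simp
      then have cIs: "real (card ?Is) \<le> real N ^ q" unfolding of_nat_power[symmetric] by (rule of_nat_mono)
      have "card (\<Union>I\<in>?Is. B I) \<le> (\<Sum>I\<in>?Is. card (B I))" by (rule card_UN_le[OF fin])
      then have "real (card (\<Union>I\<in>?Is. B I)) \<le> (\<Sum>I\<in>?Is. real (card (B I)))"
        unfolding of_nat_sum[symmetric] by (rule of_nat_mono)
      also have "\<dots> \<le> (\<Sum>I\<in>?Is. real n ^ N * (\<rho> ^ N / c ^ q))" by (intro sum_mono BI)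
      also have "\<dots> = card ?Is * (real n ^ N * (\<rho> ^ N / c ^ q))" by simp
      also have "\<dots> \<le> real N ^ q * (real n ^ N * (\<rho> ^ N / c ^ q))"
        using cIs \<rho> c by (intro mult_right_mono) auto
      also have "\<dots> = real n ^ N * (real N ^ q * \<rho> ^ N / c ^ q)" by simp
      also have "\<dots> \<le> real n ^ N * (1 / 4)"
        using N1[of N] N by (intro mult_left_mono) auto
      finally show "real n ^ N \<le> 2 * card ?good" using main ni by simp
    qed
  qed
qed

section \<open>Copies from homomorphisms\<close>

text \<open>Relational form of the theorem of Erdos on complete multipartite subhypergraphs, by induction on
  the number of coordinates. A positive proportion of the initial segments \<open>g\<close> have linearly many
  continuations \<open>D g\<close>, hence a positive proportion of all \<open>t\<close>-sets inside \<open>D g\<close>; so some \<open>t\<close>-set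
  \<open>Y\<close> continues a positive proportion of the initial segments, and the induction hypothesis applies
  to these.\<close>

lemma dense_contains_box:
  assumes "0 < c" "1 \<le> t"
  shows "\<exists>n0. \<forall>(V :: 'a set) F. finite V \<and> n0 \<le> card V \<and> F \<subseteq> {..<N} \<rightarrow>\<^sub>E V \<and>
           c * real (card V) ^ N \<le> card F \<longrightarrow>
           (\<exists>Y. (\<forall>i<N. Y i \<subseteq> V \<and> card (Y i) = t) \<and> PiE {..<N} Y \<subseteq> F)"
  using assms(1)
proof (induction N arbitrary: c)
  case 0
  show ?case
  proof (intro exI[of _ 0] allI impI, elim conjE)
    fix V :: "'a set" and F
    assume F: "F \<subseteq> {..<0::nat} \<rightarrow>\<^sub>E V" "c * real (card V) ^ 0 \<le> card F"
    then have "F \<noteq> {}" using 0 by auto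
    moreover have "F \<subseteq> {\<lambda>_. undefined}" using F(1) by (simp only: lessThan_0 PiE_empty_domain)
    ultimately have "F = {\<lambda>_. undefined}" by blast
    then show "\<exists>Y. (\<forall>i<0. Y i \<subseteq> V \<and> card (Y i) = t) \<and> PiE {..<0} Y \<subseteq> F" by simp
  qed
next
  case (Suc N)
  define c' where "c' = (c / 2) * (c / (2 * t)) ^ t"
  have "0 < c'" using Suc.prems assms(2) by (simp add: c'_def)
  then obtain n1 where n1: "\<forall>(V :: 'a set) F. finite V \<and> n1 \<le> card V \<and> F \<subseteq> {..<N} \<rightarrow>\<^sub>E V \<and>
       c' * real (card V) ^ N \<le> card F \<longrightarrow>
       (\<exists>Y. (\<forall>i<N. Y i \<subseteq> V \<and> card (Y i) = t) \<and> PiE {..<N} Y \<subseteq> F)"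
    using Suc.IH by meson
  define n0 where "n0 = max n1 (max 1 (nat \<lceil>2 * t / c\<rceil>))"
  show ?case
  proof (intro exI[of _ n0] allI impI, elim conjE)
    fix V :: "'a set" and F
    assume V: "finite V" "n0 \<le> card V" and F: "F \<subseteq> {..<Suc N} \<rightarrow>\<^sub>E V"
      and cF: "c * real (card V) ^ Suc N \<le> card F"
    let ?n = "card V"
    let ?P = "{..<N} \<rightarrow>\<^sub>E V"
    have n: "n1 \<le> ?n" "1 \<le> ?n" "2 * t / c \<le> ?n" using V(2) by (auto simp: n0_def)
    then have nt: "t \<le> c / 2 * ?n" using Suc.prems by (simp add: field_simps)
    have fP: "finite ?P" "card ?P = ?n ^ N"
      using finite_PiE[of "{..<N}" "\<lambda>_. V"] V by (auto simp: card_PiE_const)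
    define D where "D g = {x \<in> V. g(N := x) \<in> F}" for g
    have fD: "finite (D g)" "card (D g) \<le> ?n" for g
    proof -
      have "D g \<subseteq> V" by (auto simp: D_def)
      then show "finite (D g)" "card (D g) \<le> ?n" using V(1) finite_subset card_mono by blast+
    qed
    have "F \<subseteq> (\<lambda>(g, x). g(N := x)) ` (SIGMA g:?P. D g)"
    proof
      fix f assume f: "f \<in> F"
      then have fV: "f \<in> {..<Suc N} \<rightarrow>\<^sub>E V" using F by blast
      let ?g = "f(N := undefined)"
      have "?g \<in> ?P" using fV by (auto simp: PiE_iff extensional_def)
      moreover have "f N \<in> D ?g" using f fV by (auto simp: D_def)
      moreover have "f = ?g(N := f N)" by simp
      ultimately show "f \<in> (\<lambda>(g, x). g(N := x)) ` (SIGMA g:?P. D g)" by (intro image_eqI[of _ _ "(?g, f N)"]) auto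
    qed
    then have "card F \<le> card (SIGMA g:?P. D g)"
      using fP fD by (intro surj_card_le) auto
    also have "\<dots> = (\<Sum>g\<in>?P. card (D g))" using fP fD by (simp add: card_SigmaI)
    finally have cF2: "card F \<le> (\<Sum>g\<in>?P. card (D g))" .
    define H where "H = {g \<in> ?P. c / 2 * ?n \<le> card (D g)}"
    have HP: "H \<subseteq> ?P" "finite H" using fP by (auto simp: H_def)
    have "c * real ?n ^ Suc N \<le> (\<Sum>g\<in>?P. real (card (D g)))"
    proof -
      have "real (card F) \<le> real (\<Sum>g\<in>?P. card (D g))" using cF2 by (rule of_nat_mono)
      then show ?thesis using cF by simp
    qed
    also have "\<dots> \<le> (\<Sum>g\<in>?P. (if g \<in> H then real ?n else 0) + c / 2 * ?n)"
      using fD Suc.prems by (intro sum_mono) (auto simp: H_def intro: add_increasing2)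
    also have "\<dots> = card H * ?n + card ?P * (c / 2 * ?n)"
      using HP fP by (simp add: sum.distrib sum.If_cases Int_absorb1)
    also have "\<dots> = (card H + c / 2 * ?n ^ N) * ?n" using fP by (simp add: algebra_simps)
    finally have "(c * ?n ^ N) * ?n \<le> (card H + c / 2 * ?n ^ N) * ?n" by (simp add: algebra_simps)
    then have "c * ?n ^ N \<le> card H + c / 2 * ?n ^ N"
      using n(2) by (subst (asm) mult_le_cancel_right) auto
    then have cH: "c / 2 * real ?n ^ N \<le> card H" by simp
    define Ys where "Ys = {Y. Y \<subseteq> V \<and> card Y = t}"
    have "Ys \<subseteq> Pow V" by (auto simp: Ys_def)
    then have fY: "finite Ys" using V(1) by (simp add: finite_subset)
    have tn: "t \<le> ?n"
    proof -
      have "H \<noteq> {}"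
      proof
        assume "H = {}"
        then have "c / 2 * real ?n ^ N \<le> 0" using cH by simp
        moreover have "0 < c / 2 * real ?n ^ N" using Suc.prems n(2) by simp
        ultimately show False by linarith
      qed
      then obtain g where "g \<in> H" by blast
      then have "real t \<le> card (D g)" using nt by (auto simp: H_def)
      then show ?thesis using fD(2)[of g] by linarith
    qed
    have cY: "card Ys \<le> ?n ^ t"
      unfolding Ys_def using n_subsets[OF V(1)] binomial_le_pow[OF tn] by simp
    have Yg: "(c / (2 * t) * ?n) ^ t \<le> card {Y \<in> Ys. Y \<subseteq> D g}" if g: "g \<in> H" for g
    proof -
      have d: "c / 2 * ?n \<le> card (D g)" using g by (simp add: H_def)
      then have td: "t \<le> card (D g)" using nt by linarith
      have "{Y \<in> Ys. Y \<subseteq> D g} = {Y. Y \<subseteq> D g \<and> card Y = t}" by (auto simp: Ys_def D_def)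
      then have "card {Y \<in> Ys. Y \<subseteq> D g} = card (D g) choose t"
        using n_subsets[OF fD(1)] by simp
      moreover have "(real (card (D g)) / real t) ^ t \<le> real (card (D g) choose t)"
        using binomial_ge_n_over_k_pow_k[OF td] by simp
      moreover have "(c / (2 * t) * ?n) ^ t \<le> (real (card (D g)) / real t) ^ t"
        using d Suc.prems assms(2) by (intro power_mono) (auto simp: field_simps)
      ultimately show ?thesis by linarith
    qed
    have "\<exists>Y\<in>Ys. c' * real ?n ^ N \<le> card {g \<in> H. Y \<subseteq> D g}"
    proof (rule ccontr)
      assume "\<not> ?thesis"
      then have lt: "card {g \<in> H. Y \<subseteq> D g} < c' * real ?n ^ N" if "Y \<in> Ys" for Y
        using that by (auto simp: not_le)
      have "c / 2 * real ?n ^ N * (c / (2 * t) * ?n) ^ t \<le> card H * (c / (2 * t) * ?n) ^ t"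
        using cH Suc.prems by (intro mult_right_mono) auto
      also have "\<dots> = (\<Sum>g\<in>H. (c / (2 * t) * ?n) ^ t)" by simp
      also have "\<dots> \<le> (\<Sum>g\<in>H. real (card {Y \<in> Ys. Y \<subseteq> D g}))" by (intro sum_mono Yg)
      also have "\<dots> = (\<Sum>Y\<in>Ys. real (card {g \<in> H. Y \<subseteq> D g}))"
      proof -
        have "(\<Sum>g\<in>H. card {Y \<in> Ys. Y \<subseteq> D g}) = (\<Sum>Y\<in>Ys. card {g \<in> H. Y \<subseteq> D g})"
          by (rule sum_multicount_gen[OF HP(2) fY]) simp
        then show ?thesis unfolding of_nat_sum[symmetric] by (rule arg_cong)
      qed
      also have "\<dots> < card Ys * (c' * real ?n ^ N)"
      proof -
        have "Ys \<noteq> {}"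
        proof -
          obtain Y where "Y \<subseteq> V" "card Y = t" using obtain_subset_with_card_n[OF tn] by metis
          then show ?thesis by (auto simp: Ys_def)
        qed
        then have "(\<Sum>Y\<in>Ys. real (card {g \<in> H. Y \<subseteq> D g})) < (\<Sum>Y\<in>Ys. c' * real ?n ^ N)"
          using lt fY by (intro sum_strict_mono) auto
        then show ?thesis by simp
      qed
      also have "\<dots> \<le> real ?n ^ t * (c' * real ?n ^ N)"
      proof -
        have "real (card Ys) \<le> real ?n ^ t" using cY unfolding of_nat_power[symmetric] by (rule of_nat_mono)
        then show ?thesis using \<open>0 < c'\<close> by (intro mult_right_mono) auto
      qed
      also have "\<dots> = c / 2 * real ?n ^ N * (c / (2 * t) * ?n) ^ t"
        by (simp add: c'_def power_mult_distrib power_divide)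
      finally show False by simp
    qed
    then obtain Y where Y: "Y \<in> Ys" "c' * real ?n ^ N \<le> card {g \<in> H. Y \<subseteq> D g}" by blast
    have "{g \<in> H. Y \<subseteq> D g} \<subseteq> ?P" using HP by blast
    then obtain Z where Z: "\<forall>i<N. Z i \<subseteq> V \<and> card (Z i) = t" "PiE {..<N} Z \<subseteq> {g \<in> H. Y \<subseteq> D g}"
      using n1[rule_format, of V "{g \<in> H. Y \<subseteq> D g}"] V(1) n(1) Y(2) by blast
    show "\<exists>Y. (\<forall>i<Suc N. Y i \<subseteq> V \<and> card (Y i) = t) \<and> PiE {..<Suc N} Y \<subseteq> F"
    proof (intro exI[of _ "Z(N := Y)"] conjI allI impI)
      fix i assume "i < Suc N"
      then show "(Z(N := Y)) i \<subseteq> V" "card ((Z(N := Y)) i) = t"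
        using Z(1) Y(1) by (auto simp: Ys_def less_Suc_eq)
    next
      show "PiE {..<Suc N} (Z(N := Y)) \<subseteq> F"
      proof
        fix f assume f: "f \<in> PiE {..<Suc N} (Z(N := Y))"
        let ?g = "f(N := undefined)"
        have "?g \<in> PiE {..<N} Z" using f by (auto simp: PiE_iff extensional_def Pi_def split: if_splits)
        then have "Y \<subseteq> D ?g" using Z(2) by blast
        moreover have "f N \<in> Y" using PiE_mem[OF f, of N] by simp
        ultimately have "f N \<in> D ?g" by blast
        then show "f \<in> F" by (simp add: D_def)
      qed
    qed
  qed
qed

text \<open>The sets are so large that a greedy choice works.\<close>

lemma distinct_representatives:
  assumes "finite W" "\<And>w. w \<in> W \<Longrightarrow> card W \<le> card (Y w)"
  shows "\<exists>\<psi>. inj_on \<psi> W \<and> (\<forall>w\<in>W. \<psi> w \<in> Y w)"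
  using assms
proof (induction W)
  case empty
  then show ?case by simp
next
  case (insert a W)
  have "card W \<le> card (Y w)" if "w \<in> W" for w
    using insert.prems[of w] insert.hyps that by simp
  then obtain \<psi> where \<psi>: "inj_on \<psi> W" "\<forall>w\<in>W. \<psi> w \<in> Y w" using insert.IH by blast
  have "card (\<psi> ` W) < card (Y a)"
    using insert.prems[of a] insert.hyps card_image_le[OF insert.hyps(1), of \<psi>] by simp
  then have "\<not> Y a \<subseteq> \<psi> ` W"
    using card_mono[of "\<psi> ` W" "Y a"] insert.hyps(1) by fastforce
  then obtain y where y: "y \<in> Y a" "y \<notin> \<psi> ` W" by blast
  have "inj_on (\<psi>(a := y)) (insert a W)"
    using \<psi>(1) y(2) insert.hyps(2) by (auto simp: inj_on_def)
  moreover have "\<forall>w\<in>insert a W. (\<psi>(a := y)) w \<in> Y w"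
    using \<psi>(2) y(1) insert.hyps(2) by auto
  ultimately show ?case by blast
qed

text \<open>Each faithful sample has a homomorphic image of \<open>F\<close> of one of finitely many shapes \<open>\<phi>\<close>, so one
  shape serves a positive proportion of all maps of the \<open>N\<close> points. A box of such maps has, at each point, as many
  values as \<open>F\<close> has vertices, and distinct values can be assigned to all vertices of \<open>F\<close>.\<close>

lemma hom_threshold_copy:
  fixes F :: "'b hypergraph" and \<alpha> \<beta> :: real and k N1 :: nat
  assumes F: "finite (vertices F)" "vertices F \<noteq> {}" "\<And>e. e \<in> edges F \<Longrightarrow> e \<subseteq> vertices F \<and> card e = k"
    and ab: "\<beta> < \<alpha>" "\<alpha> \<le> 1"
    and hom: "\<And>(N :: nat) E. N1 \<le> N \<Longrightarrow> (\<And>e. e \<in> E \<Longrightarrow> e \<subseteq> {..<N} \<and> card e = k) \<Longrightarrow>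
        (\<And>I. I \<subseteq> {..<N} \<Longrightarrow> card I = k - 1 \<Longrightarrow> \<beta> * N \<le> card {j. insert j I \<in> E}) \<Longrightarrow>
        \<exists>\<phi>. \<phi> ` vertices F \<subseteq> {..<N} \<and> (\<forall>e\<in>edges F. \<phi> ` e \<in> E)"
  shows "\<exists>n0. \<forall>G :: 'a hypergraph. uniform_hypergraph k G \<and> n0 \<le> card (vertices G) \<and>
      (\<forall>S\<subseteq>vertices G. card S = k - 1 \<longrightarrow> \<alpha> * card (vertices G) \<le> codegree G S) \<longrightarrow>
      contains_copy G F"
proof -
  let ?W = "vertices F"
  obtain N0 where N0: "\<forall>N\<ge>N0. \<exists>n0. \<forall>n\<ge>n0. \<forall>(V :: 'a set) E. finite V \<and> card V = n \<and>
           (\<forall>S\<subseteq>V. card S = k - 1 \<longrightarrow> \<alpha> * n \<le> card {v \<in> V. insert v S \<in> E}) \<longrightarrow>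
           real n ^ N \<le> 2 * card {f \<in> {..<N} \<rightarrow>\<^sub>E V. faithful_sample (k - 1) \<beta> E N f}"
    using most_samples_faithful[OF ab] by (rule exE)
  define N where "N = max (max N0 N1) 1"
  have "N0 \<le> N" by (simp add: N_def)
  obtain n1 :: nat where n1: "\<forall>n\<ge>n1. \<forall>(V :: 'a set) E. finite V \<and> card V = n \<and>
           (\<forall>S\<subseteq>V. card S = k - 1 \<longrightarrow> \<alpha> * n \<le> card {v \<in> V. insert v S \<in> E}) \<longrightarrow>
           real n ^ N \<le> 2 * card {f \<in> {..<N} \<rightarrow>\<^sub>E V. faithful_sample (k - 1) \<beta> E N f}"
    using N0[THEN spec, THEN mp, OF \<open>N0 \<le> N\<close>] by (rule exE)
  define \<Phi> where "\<Phi> = ?W \<rightarrow>\<^sub>E {..<N}"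
  have f\<Phi>: "finite \<Phi>" unfolding \<Phi>_def using F(1) by (intro finite_PiE) auto
  have c\<Phi>: "0 < card \<Phi>"
    unfolding \<Phi>_def using F(1) by (simp add: card_PiE_const N_def less_max_iff_disj)
  define c where "c = 1 / (2 * real (card \<Phi>))"
  have c: "0 < c" using c\<Phi> by (simp add: c_def)
  have t: "1 \<le> card ?W" using F by (simp add: Suc_le_eq card_gt_0_iff)
  obtain n2 where n2: "\<forall>(V :: 'a set) F. finite V \<and> n2 \<le> card V \<and> F \<subseteq> {..<N} \<rightarrow>\<^sub>E V \<and>
           c * real (card V) ^ N \<le> card F \<longrightarrow>
           (\<exists>Y. (\<forall>i<N. Y i \<subseteq> V \<and> card (Y i) = card ?W) \<and> PiE {..<N} Y \<subseteq> F)"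
    using dense_contains_box[OF c t] by (rule exE)
  show ?thesis
  proof (rule exI[of _ "max n1 n2"], intro allI impI, elim conjE)
    fix G :: "'a hypergraph"
    assume G: "uniform_hypergraph k G" and n: "max n1 n2 \<le> card (vertices G)"
      and deg: "\<forall>S\<subseteq>vertices G. card S = k - 1 \<longrightarrow> \<alpha> * card (vertices G) \<le> codegree G S"
    let ?V = "vertices G" and ?E = "edges G"
    have V: "finite ?V" and E: "\<And>e. e \<in> ?E \<Longrightarrow> e \<subseteq> ?V \<and> card e = k"
      using G by (auto simp: uniform_hypergraph_def)
    let ?P = "{..<N} \<rightarrow>\<^sub>E ?V"
    have fP: "finite ?P" using V by (intro finite_PiE) auto
    define A where "A \<phi> = {f \<in> ?P. \<forall>e\<in>edges F. f ` \<phi> ` e \<in> ?E}" for \<phi> :: "'b \<Rightarrow> nat"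
    have good: "{f \<in> ?P. faithful_sample (k - 1) \<beta> ?E N f} \<subseteq> (\<Union>\<phi>\<in>\<Phi>. A \<phi>)"
    proof
      fix f assume "f \<in> {f \<in> ?P. faithful_sample (k - 1) \<beta> ?E N f}"
      then have f: "f \<in> ?P" and s: "inj_on f {..<N}"
        "\<And>I. I \<subseteq> {..<N} \<Longrightarrow> card I = k - 1 \<Longrightarrow> \<beta> * N \<le> card {j \<in> {..<N}. insert (f j) (f ` I) \<in> ?E}"
        by (auto simp: faithful_sample_def)
      define E' where "E' = {I. I \<subseteq> {..<N} \<and> f ` I \<in> ?E}"
      have "\<exists>\<phi>. \<phi> ` ?W \<subseteq> {..<N} \<and> (\<forall>e\<in>edges F. \<phi> ` e \<in> E')"
      proof (rule hom)
        show "N1 \<le> N" by (simp add: N_def)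
      next
        fix e assume e: "e \<in> E'"
        then have "card (f ` e) = k" "inj_on f e" using E s(1) inj_on_subset by (auto simp: E'_def)
        then show "e \<subseteq> {..<N} \<and> card e = k" using e by (simp add: E'_def card_image)
      next
        fix I assume I: "I \<subseteq> {..<N}" "card I = k - 1"
        have "{j \<in> {..<N}. insert (f j) (f ` I) \<in> ?E} = {j. insert j I \<in> E'}"
          using I by (auto simp: E'_def)
        then show "\<beta> * N \<le> card {j. insert j I \<in> E'}" using s(2)[OF I] by simp
      qed
      then obtain \<phi> where \<phi>: "\<phi> ` ?W \<subseteq> {..<N}" "\<forall>e\<in>edges F. \<phi> ` e \<in> E'" by blast
      have im: "restrict \<phi> ?W ` e = \<phi> ` e" if "e \<in> edges F" for e
        using F(3)[OF that] by (intro image_cong) auto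
      have "restrict \<phi> ?W \<in> \<Phi>" using \<phi>(1) by (auto simp: \<Phi>_def)
      moreover have "f \<in> A (restrict \<phi> ?W)" using f \<phi>(2) im by (simp add: A_def E'_def)
      ultimately show "f \<in> (\<Union>\<phi>\<in>\<Phi>. A \<phi>)" by blast
    qed
    have "real (card ?V) ^ N \<le> 2 * card {f \<in> ?P. faithful_sample (k - 1) \<beta> ?E N f}"
      using n1[rule_format, of "card ?V" ?V ?E] n V deg by (simp add: codegree_def)
    also have "\<dots> \<le> real (2 * card (\<Union>\<phi>\<in>\<Phi>. A \<phi>))"
    proof (rule of_nat_mono, rule mult_le_mono2, rule card_mono[OF _ good])
      show "finite (\<Union>\<phi>\<in>\<Phi>. A \<phi>)" using f\<Phi> fP by (auto simp: A_def)
    qed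
    also have "\<dots> \<le> real (2 * (\<Sum>\<phi>\<in>\<Phi>. card (A \<phi>)))"
      by (rule of_nat_mono, rule mult_le_mono2, rule card_UN_le[OF f\<Phi>])
    finally have sum: "real (card ?V) ^ N \<le> 2 * (\<Sum>\<phi>\<in>\<Phi>. real (card (A \<phi>)))" by simp
    have "\<exists>\<phi>\<in>\<Phi>. c * real (card ?V) ^ N \<le> card (A \<phi>)"
    proof (rule ccontr)
      assume "\<not> ?thesis"
      then have "(\<Sum>\<phi>\<in>\<Phi>. real (card (A \<phi>))) < (\<Sum>\<phi>\<in>\<Phi>. c * real (card ?V) ^ N)"
        using f\<Phi> c\<Phi> by (intro sum_strict_mono) (auto simp: not_le)
      also have "\<dots> = real (card ?V) ^ N / 2" using c\<Phi> by (simp add: c_def)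
      finally show False using sum by simp
    qed
    then obtain \<phi> where \<phi>: "\<phi> \<in> \<Phi>" "c * real (card ?V) ^ N \<le> card (A \<phi>)" by blast
    have "A \<phi> \<subseteq> ?P" by (auto simp: A_def)
    then obtain Y where Y: "\<forall>i<N. Y i \<subseteq> ?V \<and> card (Y i) = card ?W" "PiE {..<N} Y \<subseteq> A \<phi>"
      using n2[rule_format, of ?V "A \<phi>"] V n \<phi>(2) by auto
    have \<phi>N: "\<phi> w < N" if "w \<in> ?W" for w using \<phi>(1) that by (auto simp: \<Phi>_def)
    have "\<exists>\<psi>. inj_on \<psi> ?W \<and> (\<forall>w\<in>?W. \<psi> w \<in> Y (\<phi> w))"
      using \<phi>N Y(1) by (intro distinct_representatives F(1)) simp
    then obtain \<psi> where \<psi>: "inj_on \<psi> ?W" "\<And>w. w \<in> ?W \<Longrightarrow> \<psi> w \<in> Y (\<phi> w)" by blast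
    have Yne: "Y i \<noteq> {}" if "i < N" for i
      using Y(1) that t by (metis card.empty not_one_le_zero)
    have "\<psi> ` e \<in> ?E" if e: "e \<in> edges F" for e
    proof -
      have eW: "e \<subseteq> ?W" "card e = k" using F(3)[OF e] by auto
      have inPiE: "f ` \<phi> ` e \<in> ?E" if "f \<in> PiE {..<N} Y" for f
        using Y(2) that e by (auto simp: A_def)
      define f0 where "f0 = (\<lambda>i\<in>{..<N}. SOME y. y \<in> Y i)"
      have "f0 \<in> PiE {..<N} Y" using Yne by (auto simp: f0_def some_in_eq)
      then have "k = card (f0 ` \<phi> ` e)" using E inPiE by auto
      moreover have fe: "finite e" using eW(1) F(1) finite_subset by blast
      ultimately have "k \<le> card (\<phi> ` e)" by (simp add: card_image_le)
      then have inj: "inj_on \<phi> e"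
        using fe eW(2) card_image_le[OF fe, of \<phi>] by (intro eq_card_imp_inj_on) auto
      \<comment> \<open>As \<open>\<phi>\<close> is injective on \<open>e\<close>, the values of \<open>\<psi>\<close> on \<open>e\<close> extend to a point of the box.\<close>
      define f where "f = (\<lambda>i\<in>{..<N}. if i \<in> \<phi> ` e then \<psi> (inv_into e \<phi> i) else SOME y. y \<in> Y i)"
      have "f \<in> PiE {..<N} Y"
      proof (rule PiE_I)
        fix i assume i: "i \<in> {..<N}"
        show "f i \<in> Y i"
        proof (cases "i \<in> \<phi> ` e")
          case True
          then obtain w where w: "w \<in> e" "i = \<phi> w" by blast
          then have "f i = \<psi> w" using i inj by (simp add: f_def)
          then show ?thesis using \<psi>(2)[of w] w eW(1) by auto
        next
          case False
          then show ?thesis using i Yne by (auto simp: f_def some_in_eq)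
        qed
      qed (simp add: f_def)
      then have "f ` \<phi> ` e \<in> ?E" by (rule inPiE)
      moreover have "f (\<phi> w) = \<psi> w" if "w \<in> e" for w
        using that inj \<phi>N eW(1) by (auto simp: f_def)
      then have "f ` \<phi> ` e = \<psi> ` e" by (auto simp: image_image)
      ultimately show ?thesis by simp
    qed
    moreover have "\<psi> ` ?W \<subseteq> ?V"
    proof (rule image_subsetI)
      fix w assume "w \<in> ?W"
      then show "\<psi> w \<in> ?V" using \<psi>(2) \<phi>N Y(1) by blast
    qed
    ultimately show "contains_copy G F" using \<psi>(1) by (auto simp: contains_copy_def)
  qed
qed

section \<open>The codegree density as a limit\<close>

lemma min_codegree_le_codegree:
  assumes "uniform_hypergraph k G" "S \<subseteq> vertices G" "card S = k - 1"
  shows "min_codegree k G \<le> codegree G S"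
proof -
  have "finite {S. S \<subseteq> vertices G \<and> card S = k - 1}"
    by (rule finite_subset[of _ "Pow (vertices G)"]) (use assms(1) in \<open>auto simp: uniform_hypergraph_def\<close>)
  then show ?thesis unfolding min_codegree_def using assms by (intro Min_le) auto
qed

lemma min_codegree_attained:
  assumes "uniform_hypergraph k G" "k - 1 \<le> card (vertices G)"
  obtains S where "S \<subseteq> vertices G" "card S = k - 1" "min_codegree k G = codegree G S"
proof -
  have fin: "finite {S. S \<subseteq> vertices G \<and> card S = k - 1}"
    by (rule finite_subset[of _ "Pow (vertices G)"]) (use assms(1) in \<open>auto simp: uniform_hypergraph_def\<close>)
  obtain S where "S \<subseteq> vertices G" "card S = k - 1"
    using obtain_subset_with_card_n[OF assms(2)] by metis
  then have "{S. S \<subseteq> vertices G \<and> card S = k - 1} \<noteq> {}" by blast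
  then have "min_codegree k G \<in> codegree G ` {S. S \<subseteq> vertices G \<and> card S = k - 1}"
    unfolding min_codegree_def using fin by (intro Min_in) auto
  then show ?thesis using that by blast
qed

lemma min_codegree_le_card:
  assumes "uniform_hypergraph k G" "k - 1 \<le> card (vertices G)"
  shows "min_codegree k G \<le> card (vertices G)"
proof -
  obtain S where "min_codegree k G = codegree G S" using min_codegree_attained[OF assms] by blast
  also have "\<dots> \<le> card (vertices G)"
    unfolding codegree_def using assms(1) by (intro card_mono) (auto simp: uniform_hypergraph_def)
  finally show ?thesis .
qed

definition free_codegrees :: "nat \<Rightarrow> nat \<Rightarrow> 'b hypergraph \<Rightarrow> nat set" where
  "free_codegrees k n F = {min_codegree k G | G :: nat hypergraph.
     uniform_hypergraph k G \<and> card (vertices G) = n \<and> \<not> contains_copy G F}"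

lemma finite_free_codegrees: "k - 1 \<le> n \<Longrightarrow> finite (free_codegrees k n F)"
  by (rule finite_subset[of _ "{..n}"]) (auto simp: free_codegrees_def min_codegree_le_card)

lemma codegree_ex_ge:
  fixes G :: "nat hypergraph"
  assumes "uniform_hypergraph k G" "card (vertices G) = n" "\<not> contains_copy G F" "k - 1 \<le> n"
  shows "min_codegree k G \<le> codegree_ex k n F"
  unfolding codegree_ex_def free_codegrees_def[symmetric]
  using assms by (intro Max_ge finite_free_codegrees) (auto simp: free_codegrees_def)

lemma codegree_ex_attained:
  assumes "edges F \<noteq> {}" "k - 1 \<le> n"
  obtains G :: "nat hypergraph" where "uniform_hypergraph k G" "card (vertices G) = n"
    "\<not> contains_copy G F" "min_codegree k G = codegree_ex k n F"
proof -
  let ?G = "\<lparr>vertices = {..<n}, edges = {}\<rparr> :: nat hypergraph"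
  have "uniform_hypergraph k ?G" "card (vertices ?G) = n" "\<not> contains_copy ?G F"
    using assms(1) by (auto simp: uniform_hypergraph_def contains_copy_def)
  then have "free_codegrees k n F \<noteq> {}" unfolding free_codegrees_def by blast
  then have "codegree_ex k n F \<in> free_codegrees k n F"
    unfolding codegree_ex_def free_codegrees_def[symmetric]
    by (intro Max_in finite_free_codegrees assms(2))
  then show ?thesis using that by (auto simp: free_codegrees_def)
qed

abbreviation ex_ratio :: "nat \<Rightarrow> 'b hypergraph \<Rightarrow> nat \<Rightarrow> real" where
  "ex_ratio k F n \<equiv> real (codegree_ex k n F) / real n"

lemma ex_ratio_bounds:
  assumes "edges F \<noteq> {}" "k - 1 \<le> n"
  shows "0 \<le> ex_ratio k F n" "ex_ratio k F n \<le> 1"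
proof -
  obtain G :: "nat hypergraph" where G: "uniform_hypergraph k G" "card (vertices G) = n"
    "min_codegree k G = codegree_ex k n F" using codegree_ex_attained[OF assms] by metis
  then have "codegree_ex k n F \<le> n" using min_codegree_le_card assms(2) by metis
  then show "ex_ratio k F n \<le> 1" by (cases "n = 0") (simp_all add: divide_le_eq_1)
qed simp

lemma ex_ratio_upper:
  fixes \<alpha> :: real and k n0 :: nat
  assumes F: "edges F \<noteq> {}"
    and n0: "\<forall>G :: nat hypergraph. uniform_hypergraph k G \<and> n0 \<le> card (vertices G) \<and>
      (\<forall>S\<subseteq>vertices G. card S = k - 1 \<longrightarrow> \<alpha> * card (vertices G) \<le> codegree G S) \<longrightarrow>
      contains_copy G F"
  shows "\<forall>\<^sub>F n in sequentially. ex_ratio k F n \<le> \<alpha>"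
  unfolding eventually_sequentially
proof (intro exI[of _ "max n0 (max k 1)"] allI impI)
  fix n assume n: "max n0 (max k 1) \<le> n"
  obtain G :: "nat hypergraph" where G: "uniform_hypergraph k G" "card (vertices G) = n"
    "\<not> contains_copy G F" "min_codegree k G = codegree_ex k n F"
    using codegree_ex_attained[OF F, of k n] n by (metis diff_le_self le_trans max.bounded_iff)
  have "\<not> (\<forall>S\<subseteq>vertices G. card S = k - 1 \<longrightarrow> \<alpha> * card (vertices G) \<le> codegree G S)"
    using n0[rule_format, of G] G n by auto
  then obtain S where S: "S \<subseteq> vertices G" "card S = k - 1" "codegree G S < \<alpha> * n"
    using G(2) by (auto simp: not_le)
  then have "codegree_ex k n F < \<alpha> * n"
    using min_codegree_le_codegree[OF G(1) S(1,2)] G(4) by linarith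
  then show "ex_ratio k F n \<le> \<alpha>" using n by (simp add: divide_le_eq)
qed

lemma ex_ratio_lower:
  fixes \<beta> :: real and k n :: nat
  assumes G: "uniform_hypergraph k (G :: nat hypergraph)" "card (vertices G) = n" "\<not> contains_copy G F"
    and n: "k - 1 \<le> n" "0 < n"
    and deg: "\<And>S. S \<subseteq> vertices G \<Longrightarrow> card S = k - 1 \<Longrightarrow> \<beta> * n \<le> codegree G S"
  shows "\<beta> \<le> ex_ratio k F n"
proof -
  obtain S where "S \<subseteq> vertices G" "card S = k - 1" "min_codegree k G = codegree G S"
    using min_codegree_attained[OF G(1)] G(2) n(1) by metis
  then have "\<beta> * n \<le> min_codegree k G" using deg by simp
  also have "\<dots> \<le> codegree_ex k n F" using codegree_ex_ge[OF G n(1)] by simp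
  finally show ?thesis using n(2) by (simp add: le_divide_eq)
qed

text \<open>A faithful sample of a large \<open>F\<close>-free hypergraph is an \<open>F\<close>-free hypergraph of the given order
  \<open>N\<close>. The pair \<open>\<alpha>\<close>, \<open>\<beta>\<close> is fixed first, because the admissible \<open>N\<close> depend on it.\<close>

lemma ex_ratio_inherits:
  fixes k :: nat and \<alpha> \<beta> :: real
  assumes F: "edges F \<noteq> {}" and ab: "\<beta> < \<alpha>"
    and often: "\<exists>\<^sub>F n in sequentially. \<alpha> \<le> ex_ratio k F n"
  shows "\<forall>\<^sub>F N in sequentially. \<beta> \<le> ex_ratio k F N"
proof -
  have "\<alpha> \<le> 1"
  proof -
    have "\<forall>\<^sub>F n in sequentially. ex_ratio k F n \<le> 1"
      unfolding eventually_sequentially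
      by (intro exI[of _ k] allI impI ex_ratio_bounds(2) F) simp
    then obtain n where n: "\<And>n'. n \<le> n' \<Longrightarrow> ex_ratio k F n' \<le> 1"
      unfolding eventually_sequentially by blast
    obtain n' where "n \<le> n'" "\<alpha> \<le> ex_ratio k F n'"
      using often unfolding frequently_sequentially by blast
    then show ?thesis using n[of n'] by linarith
  qed
  obtain N0 where N0: "\<forall>N\<ge>N0. \<exists>n0. \<forall>n\<ge>n0. \<forall>(V :: nat set) E. finite V \<and> card V = n \<and>
           (\<forall>S\<subseteq>V. card S = k - 1 \<longrightarrow> \<alpha> * n \<le> card {v \<in> V. insert v S \<in> E}) \<longrightarrow>
           real n ^ N \<le> 2 * card {f \<in> {..<N} \<rightarrow>\<^sub>E V. faithful_sample (k - 1) \<beta> E N f}"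
    using most_samples_faithful[OF ab \<open>\<alpha> \<le> 1\<close>] by (rule exE)
  show ?thesis
    unfolding eventually_sequentially
  proof (intro exI[of _ "max N0 (max k 1)"] allI impI)
    fix N assume N: "max N0 (max k 1) \<le> N"
    have "N0 \<le> N" using N by simp
    obtain n0 :: nat where n0: "\<forall>n\<ge>n0. \<forall>(V :: nat set) E. finite V \<and> card V = n \<and>
           (\<forall>S\<subseteq>V. card S = k - 1 \<longrightarrow> \<alpha> * n \<le> card {v \<in> V. insert v S \<in> E}) \<longrightarrow>
           real n ^ N \<le> 2 * card {f \<in> {..<N} \<rightarrow>\<^sub>E V. faithful_sample (k - 1) \<beta> E N f}"
      using N0[THEN spec, THEN mp, OF \<open>N0 \<le> N\<close>] by (rule exE)
    have "\<exists>n\<ge>max n0 (max k 1). \<alpha> \<le> ex_ratio k F n"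
      using often unfolding frequently_sequentially by blast
    then obtain n where n: "max n0 (max k 1) \<le> n" "\<alpha> \<le> ex_ratio k F n" by blast
    have "k \<le> n" using n(1) by simp
    then have kn: "k - 1 \<le> n" by linarith
    obtain G :: "nat hypergraph" where G: "uniform_hypergraph k G" "card (vertices G) = n"
      "\<not> contains_copy G F" "min_codegree k G = codegree_ex k n F"
      using codegree_ex_attained[OF F kn] .
    let ?V = "vertices G" and ?E = "edges G"
    have V: "finite ?V" and E: "\<And>e. e \<in> ?E \<Longrightarrow> e \<subseteq> ?V \<and> card e = k"
      using G(1) by (auto simp: uniform_hypergraph_def)
    have "\<alpha> * n \<le> card {v \<in> ?V. insert v S \<in> ?E}" if S: "S \<subseteq> ?V" "card S = k - 1" for S
    proof -
      have "\<alpha> * n \<le> codegree_ex k n F" using n by (simp add: le_divide_eq split: if_splits)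
      also have "\<dots> \<le> codegree G S" using min_codegree_le_codegree[OF G(1) S] G(4) by simp
      finally show ?thesis by (simp add: codegree_def)
    qed
    then have "real n ^ N \<le> 2 * card {f \<in> {..<N} \<rightarrow>\<^sub>E ?V. faithful_sample (k - 1) \<beta> ?E N f}"
      using n0[rule_format, of n ?V ?E] n(1) V G(2) by auto
    moreover have "0 < real n ^ N" using n(1) by simp
    ultimately have "{f \<in> {..<N} \<rightarrow>\<^sub>E ?V. faithful_sample (k - 1) \<beta> ?E N f} \<noteq> {}"
      by (metis card.empty mult_zero_right not_less of_nat_0)
    then obtain f where f: "f \<in> {..<N} \<rightarrow>\<^sub>E ?V" "faithful_sample (k - 1) \<beta> ?E N f" by blast
    define H where "H = \<lparr>vertices = {..<N}, edges = {I. I \<subseteq> {..<N} \<and> f ` I \<in> ?E}\<rparr>"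
    have inj: "inj_on f {..<N}" using f(2) by (simp add: faithful_sample_def)
    show "\<beta> \<le> ex_ratio k F N"
    proof (rule ex_ratio_lower)
      have "card I = k" if "I \<subseteq> {..<N}" "f ` I \<in> ?E" for I
        using E[OF that(2)] card_image[OF inj_on_subset[OF inj that(1)]] by simp
      then show "uniform_hypergraph k H" by (auto simp: uniform_hypergraph_def H_def)
      show "card (vertices H) = N" by (simp add: H_def)
      show "k - 1 \<le> N" "0 < N" using N by auto
    next
      show "\<not> contains_copy H F"
      proof
        assume "contains_copy H F"
        then obtain g where g: "inj_on g (vertices F)" "g ` vertices F \<subseteq> {..<N}"
          "\<forall>e\<in>edges F. f ` g ` e \<in> ?E" by (auto simp: contains_copy_def H_def)
        have "inj_on (f \<circ> g) (vertices F)"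
          using g(1) inj_on_subset[OF inj g(2)] by (rule comp_inj_on)
        moreover have "(f \<circ> g) ` vertices F \<subseteq> ?V" using g(2) f(1) by auto
        moreover have "\<forall>e\<in>edges F. (f \<circ> g) ` e \<in> ?E" using g(3) by (simp add: image_comp)
        ultimately have "contains_copy G F" unfolding contains_copy_def by blast
        then show False using G(3) by simp
      qed
    next
      fix I assume "I \<subseteq> vertices H" and cI: "card I = k - 1"
      then have I: "I \<subseteq> {..<N}" by (simp add: H_def)
      then have "codegree H I = card {j \<in> {..<N}. insert (f j) (f ` I) \<in> ?E}"
        unfolding codegree_def H_def by (intro arg_cong[where f = card]) auto
      then show "\<beta> * N \<le> codegree H I"
        using f(2) I cI by (simp add: faithful_sample_def)
    qed
  qed
qed

text \<open>The limit is the upper limit \<open>L\<close> of the sequence. Every \<open>\<alpha> < L\<close> is exceeded infinitely often, hence,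
  by \<open>ex_ratio_inherits\<close>, every \<open>\<beta> < \<alpha>\<close> is a lower bound eventually.\<close>

lemma ex_ratio_convergent:
  assumes F: "edges F \<noteq> {}"
  shows "convergent (ex_ratio k F)"
proof -
  let ?a = "ex_ratio k F"
  define X where "X = {x. \<forall>\<^sub>F n in sequentially. ?a n \<le> x}"
  define L where "L = Inf X"
  have ev: "\<forall>\<^sub>F n in sequentially. 0 \<le> ?a n \<and> ?a n \<le> 1"
    unfolding eventually_sequentially
    by (intro exI[of _ k] allI impI conjI ex_ratio_bounds F) simp_all
  have X1: "1 \<in> X" using ev by (auto simp: X_def elim: eventually_mono)
  have X0: "0 \<le> x" if "x \<in> X" for x
  proof -
    have "\<forall>\<^sub>F n in sequentially. 0 \<le> x"
      using that[unfolded X_def, simplified]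
    proof eventually_elim
      fix n assume "?a n \<le> x"
      moreover have "0 \<le> ?a n" by simp
      ultimately show "0 \<le> x" by linarith
    qed
    then show ?thesis by (simp add: eventually_const_iff)
  qed
  then have bdd: "bdd_below X" by (auto simp: bdd_below_def)
  have "?a \<longlonglongrightarrow> L"
  proof (rule order_tendstoI)
    fix y assume "L < y"
    then obtain x where x: "x \<in> X" "x < y"
      unfolding L_def using cInf_lessD[of X y] X1 by blast
    have "\<forall>\<^sub>F n in sequentially. ?a n \<le> x" using x(1) by (simp add: X_def)
    then show "\<forall>\<^sub>F n in sequentially. ?a n < y" by eventually_elim (use x in simp)
  next
    fix y assume y: "y < L"
    define \<alpha> where "\<alpha> = y + 2 * (L - y) / 3"
    define \<beta> where "\<beta> = y + (L - y) / 3"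
    have o: "y < \<beta>" "\<beta> < \<alpha>" "\<alpha> < L" using y by (auto simp: \<alpha>_def \<beta>_def field_simps)
    have "\<alpha> \<notin> X" using o cInf_lower[OF _ bdd, of \<alpha>] by (auto simp: L_def)
    then have "\<exists>\<^sub>F n in sequentially. \<alpha> < ?a n"
      by (simp add: X_def frequently_def not_less)
    then have "\<exists>\<^sub>F n in sequentially. \<alpha> \<le> ?a n" by (rule frequently_elim1) simp
    from ex_ratio_inherits[OF F o(2) this]
    show "\<forall>\<^sub>F n in sequentially. y < ?a n" by eventually_elim (use o in simp)
  qed
  then show ?thesis by (rule convergentI)
qed

lemma codegree_density_lower:
  assumes F: "edges F \<noteq> {}"
    and "\<And>\<epsilon>. 0 < \<epsilon> \<Longrightarrow> \<forall>\<^sub>F n in sequentially. \<gamma> - \<epsilon> \<le> ex_ratio k F n"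
  shows "\<gamma> \<le> codegree_density k F"
proof (rule field_le_epsilon)
  fix \<epsilon> :: real assume "0 < \<epsilon>"
  have "ex_ratio k F \<longlonglongrightarrow> codegree_density k F"
    using ex_ratio_convergent[OF F] unfolding codegree_density_def by (simp add: convergent_LIMSEQ_iff)
  then have "\<gamma> - \<epsilon> \<le> codegree_density k F"
    by (rule tendsto_lowerbound) (use assms(2)[OF \<open>0 < \<epsilon>\<close>] in auto)
  then show "\<gamma> \<le> codegree_density k F + \<epsilon>" by simp
qed

lemma codegree_density_upper:
  assumes F: "edges F \<noteq> {}"
    and "\<And>\<epsilon>. 0 < \<epsilon> \<Longrightarrow> \<epsilon> < \<delta> \<Longrightarrow> \<forall>\<^sub>F n in sequentially. ex_ratio k F n \<le> \<gamma> + \<epsilon>" and "0 < \<delta>"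
  shows "codegree_density k F \<le> \<gamma>"
proof (rule field_le_epsilon)
  fix e :: real assume "0 < e"
  define \<epsilon> where "\<epsilon> = min e (\<delta> / 2)"
  have \<epsilon>: "0 < \<epsilon>" "\<epsilon> < \<delta>" "\<epsilon> \<le> e" using \<open>0 < e\<close> \<open>0 < \<delta>\<close> by (auto simp: \<epsilon>_def)
  have "ex_ratio k F \<longlonglongrightarrow> codegree_density k F"
    using ex_ratio_convergent[OF F] unfolding codegree_density_def by (simp add: convergent_LIMSEQ_iff)
  then have "codegree_density k F \<le> \<gamma> + \<epsilon>"
    by (rule tendsto_upperbound) (use assms(2)[OF \<epsilon>(1,2)] in auto)
  then show "codegree_density k F \<le> \<gamma> + e" using \<epsilon> by simp
qed

section \<open>Hypergraphs defined by residues\<close>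

lemma tight_cycle_edge: "edges (tight_cycle k l) = (\<lambda>i. (\<lambda>j. (i + j) mod l) ` {..<k}) ` {..<l}"
  unfolding tight_cycle_def by (auto simp: image_def)

lemma tight_cycle_wf:
  assumes "k \<le> l" "e \<in> edges (tight_cycle k l)"
  shows "e \<subseteq> vertices (tight_cycle k l) \<and> card e = k"
proof -
  obtain i where i: "i < l" "e = (\<lambda>j. (i + j) mod l) ` {..<k}"
    using assms(2) by (auto simp: tight_cycle_edge)
  have "inj_on (\<lambda>j. (i + j) mod l) {..<k}"
  proof (rule inj_onI)
    fix a b assume "a \<in> {..<k}" "b \<in> {..<k}" "(i + a) mod l = (i + b) mod l"
    then have "[i + a = i + b] (mod l)" "a < l" "b < l" using assms(1) by (auto simp: cong_def)
    then show "a = b" using cong_add_lcancel_nat cong_less_modulus_unique_nat by blast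
  qed
  then show ?thesis using i by (auto simp: card_image tight_cycle_def)
qed

lemma tight_cycle_nonempty: "0 < l \<Longrightarrow> edges (tight_cycle k l) \<noteq> {}"
  by (auto simp: tight_cycle_edge)

text \<open>A copy of the tight cycle is unrolled to a periodic sequence, so that no reduction modulo \<open>l\<close> is
  needed when consecutive windows are compared.\<close>

lemma tight_cycle_copy_sequence:
  assumes copy: "contains_copy G (tight_cycle k l)" and kl: "k \<le> l" "0 < l"
  obtains x where "\<And>i. x (i + l) = x i" "\<And>i. inj_on x {i..<i + k}" "\<And>i. x ` {i..<i + k} \<in> edges G"
proof -
  obtain f where f: "inj_on f {..<l}" "\<And>e. e \<in> edges (tight_cycle k l) \<Longrightarrow> f ` e \<in> edges G"
    using copy by (auto simp: contains_copy_def tight_cycle_def)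
  define x where "x i = f (i mod l)" for i
  have win: "x ` {i..<i + k} = f ` ((\<lambda>j. (i mod l + j) mod l) ` {..<k})" for i
  proof -
    have "{i..<i + k} = (\<lambda>j. i + j) ` {..<k}" by (auto simp: image_iff Bex_def) presburger
    then show ?thesis by (simp add: image_image x_def mod_simps)
  qed
  have edge: "(\<lambda>j. (i mod l + j) mod l) ` {..<k} \<in> edges (tight_cycle k l)" for i
    using kl by (auto simp: tight_cycle_edge)
  show ?thesis
  proof (rule that[of x])
    show "x (i + l) = x i" for i by (simp add: x_def)
    show "x ` {i..<i + k} \<in> edges G" for i unfolding win by (intro f edge)
    show "inj_on x {i..<i + k}" for i
    proof (rule eq_card_imp_inj_on)
      let ?e = "(\<lambda>j. (i mod l + j) mod l) ` {..<k}"
      have "card ?e = k" "?e \<subseteq> {..<l}"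
        using tight_cycle_wf[OF kl(1) edge[of i]] by (auto simp: tight_cycle_def)
      then show "card (x ` {i..<i + k}) = card {i..<i + k}"
        unfolding win using card_image[OF inj_on_subset[OF f(1)]] by simp
    qed simp
  qed
qed

lemma card_residue_class:
  assumes "c < p"
  shows "n div p \<le> card {v \<in> {..<n}. v mod p = c}"
proof -
  have "inj_on (\<lambda>j. j * p + c) {..<n div p}" using assms by (auto simp: inj_on_def)
  moreover have "(\<lambda>j. j * p + c) ` {..<n div p} \<subseteq> {v \<in> {..<n}. v mod p = c}"
  proof (rule image_subsetI)
    fix j assume "j \<in> {..<n div p}"
    then have "Suc j * p \<le> n div p * p" by (intro mult_le_mono1) auto
    also have "\<dots> \<le> n" by simp
    finally show "j * p + c \<in> {v \<in> {..<n}. v mod p = c}" using assms by simp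
  qed
  ultimately have "card {..<n div p} \<le> card {v \<in> {..<n}. v mod p = c}"
    by (intro card_inj_on_le) auto
  then show ?thesis by simp
qed

text \<open>Each residue class modulo \<open>p\<close> contains at least \<open>n div p\<close> of the first \<open>n\<close> numbers. If \<open>P\<close> lets
  every \<open>k - 1\<close>-set be completed by all remaining elements of one residue class, the hypergraph of all
  \<open>k\<close>-sets with property \<open>P\<close> has codegree at least \<open>n / p\<close> up to a constant.\<close>

lemma residue_construction:
  fixes P :: "nat set \<Rightarrow> bool" and \<epsilon> :: real and p k l :: nat
  assumes p: "0 < p" and k: "1 \<le> k" "k < l" and \<epsilon>: "0 < \<epsilon>"
    and cover: "\<And>S. finite S \<Longrightarrow> card S = k - 1 \<Longrightarrow>
       \<exists>c<p. \<forall>v. v \<notin> S \<longrightarrow> v mod p = c \<longrightarrow> P (insert v S)"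
    and free: "\<And>x :: nat \<Rightarrow> nat. (\<And>i. x (i + l) = x i) \<Longrightarrow> (\<And>i. inj_on x {i..<i + k}) \<Longrightarrow>
       (\<And>i. P (x ` {i..<i + k})) \<Longrightarrow> False"
  shows "\<forall>\<^sub>F n in sequentially. 1 / p - \<epsilon> \<le> ex_ratio k (tight_cycle k l) n"
  unfolding eventually_sequentially
proof (rule exI[of _ "max k (nat \<lceil>(k + 1) / \<epsilon>\<rceil>)"], intro allI impI)
  fix n assume n: "max k (nat \<lceil>(k + 1) / \<epsilon>\<rceil>) \<le> n"
  define G where "G = \<lparr>vertices = {..<n}, edges = {e. e \<subseteq> {..<n} \<and> card e = k \<and> P e}\<rparr>"
  have kn: "k \<le> n" and nk: "(k + 1) / \<epsilon> \<le> n" using n by auto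
  show "1 / p - \<epsilon> \<le> ex_ratio k (tight_cycle k l) n"
  proof (rule ex_ratio_lower)
    show "uniform_hypergraph k G" by (auto simp: G_def uniform_hypergraph_def)
    show "card (vertices G) = n" by (simp add: G_def)
    show "k - 1 \<le> n" "0 < n" using kn k by linarith+
  next
    show "\<not> contains_copy G (tight_cycle k l)"
    proof
      assume copy: "contains_copy G (tight_cycle k l)"
      have "k \<le> l" "0 < l" using k by auto
      from tight_cycle_copy_sequence[OF copy this]
      obtain x where x: "\<And>i. x (i + l) = x i" "\<And>i. inj_on x {i..<i + k}" "\<And>i. x ` {i..<i + k} \<in> edges G"
        by blast
      then have "\<And>i. P (x ` {i..<i + k})" by (simp add: G_def)
      then show False using free[OF x(1,2)] by blast
    qed
  next
    fix S assume "S \<subseteq> vertices G" and cS: "card S = k - 1"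
    then have S: "S \<subseteq> {..<n}" "finite S" using finite_subset by (auto simp: G_def)
    obtain c where c: "c < p" "\<forall>v. v \<notin> S \<longrightarrow> v mod p = c \<longrightarrow> P (insert v S)"
      using cover[OF S(2) cS] by blast
    let ?R = "{v \<in> {..<n}. v mod p = c}"
    have "?R - S \<subseteq> {v \<in> vertices G. insert v S \<in> edges G}"
      using S cS c k by (auto simp: G_def)
    then have "card (?R - S) \<le> codegree G S"
      unfolding codegree_def by (intro card_mono) (auto simp: G_def)
    moreover have "card ?R - card S \<le> card (?R - S)" by (rule diff_card_le_card_Diff[OF S(2)])
    moreover have "n div p \<le> card ?R" by (rule card_residue_class[OF c(1)])
    ultimately have "n div p \<le> codegree G S + k" using cS by linarith
    then have "real (n div p) \<le> real (codegree G S + k)" by (rule of_nat_mono)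
    moreover have "real n / p - 1 \<le> real (n div p)"
    proof -
      have "n \<le> (n div p + 1) * p"
        using mod_less_divisor[OF p, of n] div_mult_mod_eq[of n p] unfolding add_mult_distrib by linarith
      then have "real n \<le> real ((n div p + 1) * p)" by (rule of_nat_mono)
      then show ?thesis using p by (simp add: field_simps)
    qed
    moreover have "k + 1 \<le> \<epsilon> * n" using nk \<epsilon> by (simp add: field_simps)
    ultimately show "(1 / p - \<epsilon>) * n \<le> codegree G S" by (simp add: algebra_simps)
  qed
qed

lemma periodic_add_mult:
  fixes y :: "nat \<Rightarrow> 'a"
  assumes "\<And>i. y (i + k) = y i"
  shows "y (i + k * a) = y i"
proof (induction a)
  case (Suc a)
  then show ?case using assms[of "i + k * a"] by (simp add: algebra_simps)
qed simp

lemma periodic_gcd: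
  fixes y :: "nat \<Rightarrow> 'a"
  assumes "0 < k" and k: "\<And>i. y (i + k) = y i" and l: "\<And>i. y (i + l) = y i"
  shows "y (i + gcd k l) = y i"
proof -
  obtain a b where ab: "k * a = l * b + gcd k l" using bezout_nat[of k l] assms(1) by auto
  have "y (i + gcd k l) = y (i + gcd k l + l * b)" using periodic_add_mult[of y l, OF l] by simp
  also have "i + gcd k l + l * b = i + k * a" using ab by simp
  also have "y (i + k * a) = y i" by (rule periodic_add_mult[of y k, OF k])
  finally show ?thesis .
qed

lemma sum_periodic:
  fixes y :: "nat \<Rightarrow> nat"
  assumes "\<And>i. y (i + d) = y i"
  shows "(\<Sum>i<m * d. y i) = m * (\<Sum>i<d. y i)"
proof -
  have "(\<Sum>i<m * d. y i) = (\<Sum>j<m. sum y {j * d..<j * d + d})"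
    by (rule sum.nat_group[symmetric])
  also have "\<dots> = (\<Sum>j<m. sum y {..<d})"
  proof (rule sum.cong[OF refl])
    fix j
    have "sum y {j * d..<j * d + d} = (\<Sum>i<d. y (i + d * j))"
      using sum.shift_bounds_nat_ivl[of y 0 "j * d" d] by (simp add: atLeast0LessThan mult.commute add.commute)
    then show "sum y {j * d..<j * d + d} = sum y {..<d}"
      using periodic_add_mult[of y d, OF assms] by simp
  qed
  finally show ?thesis by simp
qed

lemma quotient_dvd_window_sum:
  fixes y :: "nat \<Rightarrow> nat"
  assumes "0 < k" "\<And>i. y (i + k) = y i" "\<And>i. y (i + l) = y i"
  shows "k div gcd k l dvd (\<Sum>i<k. y i)"
proof -
  have "(\<Sum>i<(k div gcd k l) * gcd k l. y i) = (k div gcd k l) * (\<Sum>i<gcd k l. y i)"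
    by (intro sum_periodic periodic_gcd assms)
  then show ?thesis by simp
qed

text \<open>The window sum changes by the entering term minus the leaving one; stated without subtraction.\<close>

lemma window_sum_shift:
  fixes y :: "nat \<Rightarrow> nat"
  shows "(\<Sum>j<k. y (Suc i + j)) + y i = (\<Sum>j<k. y (i + j)) + y (i + k)"
proof -
  have "(\<Sum>j<Suc k. y (i + j)) = y i + (\<Sum>j<k. y (Suc i + j))"
    by (subst sum.lessThan_Suc_shift) simp
  then show ?thesis by simp
qed

lemma sum_window_image:
  fixes x :: "nat \<Rightarrow> 'a" and g :: "'a \<Rightarrow> nat"
  assumes "inj_on x {i..<i + k}"
  shows "sum g (x ` {i..<i + k}) = (\<Sum>j<k. g (x (i + j)))"
proof -
  have "sum g (x ` {i..<i + k}) = sum (g \<circ> x) {i..<i + k}" by (rule sum.reindex[OF assms])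
  also have "\<dots> = (\<Sum>j<k. g (x (i + j)))"
    using sum.shift_bounds_nat_ivl[of "g \<circ> x" 0 i k] by (simp add: atLeast0LessThan add.commute)
  finally show ?thesis .
qed

text \<open>Windows with equal sums modulo \<open>p\<close> make the residues along the cycle periodic, and then the sum of a
  window is divisible by \<open>p\<close> instead of being 1.\<close>

lemma prime_quotient_lower:
  fixes p k l :: nat
  assumes k: "1 \<le> k" "k < l" and p: "2 \<le> p" "p dvd k div gcd k l" and \<epsilon>: "0 < (\<epsilon> :: real)"
  shows "\<forall>\<^sub>F n in sequentially. 1 / p - \<epsilon> \<le> ex_ratio k (tight_cycle k l) n"
proof (rule residue_construction[where P = "\<lambda>e. \<Sum>e mod p = 1"])
  show "0 < p" "1 \<le> k" "k < l" "0 < \<epsilon>" using assms by auto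
next
  fix S :: "nat set" assume S: "finite S"
  \<comment> \<open>This is \<open>1 - \<Sum>S\<close> modulo \<open>p\<close>, written without subtraction.\<close>
  let ?c = "(1 + (p - 1) * \<Sum>S) mod p"
  have "\<Sum>(insert v S) mod p = 1" if v: "v \<notin> S" "v mod p = ?c" for v
  proof -
    have "\<Sum>(insert v S) mod p = (v mod p + \<Sum>S) mod p" using S v(1) by (simp add: mod_simps)
    also have "\<dots> = (1 + (p - 1) * \<Sum>S + \<Sum>S) mod p" unfolding v(2) by (simp add: mod_simps)
    also have "1 + (p - 1) * \<Sum>S + \<Sum>S = 1 + p * \<Sum>S" using p(1) by (cases p) auto
    finally have "\<Sum>(insert v S) mod p = (1 + p * \<Sum>S) mod p" .
    then show ?thesis using p(1) by (simp only: mod_mult_self2) simp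
  qed
  moreover have "?c < p" using p(1) by simp
  ultimately show "\<exists>c<p. \<forall>v. v \<notin> S \<longrightarrow> v mod p = c \<longrightarrow> \<Sum>(insert v S) mod p = 1" by blast
next
  fix x :: "nat \<Rightarrow> nat"
  assume per: "\<And>i. x (i + l) = x i" and inj: "\<And>i. inj_on x {i..<i + k}"
    and one: "\<And>i. \<Sum>(x ` {i..<i + k}) mod p = 1"
  define y where "y i = x i mod p" for i
  have s1: "(\<Sum>j<k. y (i + j)) mod p = 1" for i
    using one[of i] sum_window_image[OF inj, of "\<lambda>v. v" i]
    by (simp add: y_def mod_sum_eq)
  have "y (i + k) = y i" for i
  proof -
    have "((\<Sum>j<k. y (Suc i + j)) + y i) mod p = ((\<Sum>j<k. y (i + j)) + y (i + k)) mod p"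
      by (simp only: window_sum_shift)
    then have "(1 + y i) mod p = (1 + y (i + k)) mod p"
      using s1[of i] s1[of "Suc i"] by (metis mod_add_left_eq)
    then have "[1 + y i = 1 + y (i + k)] (mod p)" by (simp add: cong_def)
    then have "[y i = y (i + k)] (mod p)" by (simp only: cong_add_lcancel_nat)
    then show ?thesis by (simp add: cong_def y_def)
  qed
  moreover have "y (i + l) = y i" for i by (simp add: y_def per)
  ultimately have "k div gcd k l dvd (\<Sum>j<k. y j)"
    using k(1) by (intro quotient_dvd_window_sum) auto
  then have "p dvd (\<Sum>j<k. y j)" using p(2) dvd_trans by blast
  then show False using s1[of 0] by (simp add: dvd_eq_mod_eq_0)
qed

section \<open>Three-coloured constructions of density one third\<close>

definition colour_count :: "nat set \<Rightarrow> nat \<Rightarrow> nat" where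
  "colour_count e c = (\<Sum>v\<in>e. if v mod 3 = c then 1 else 0)"

lemma colour_count_insert:
  "finite S \<Longrightarrow> v \<notin> S \<Longrightarrow> colour_count (insert v S) c = colour_count S c + (if v mod 3 = c then 1 else 0)"
  by (simp add: colour_count_def)

lemma colour_count_sum:
  assumes "finite S"
  shows "colour_count S 0 + colour_count S 1 + colour_count S 2 = card S"
  using assms
proof (induction S)
  case (insert v S)
  have "v mod 3 = 0 \<or> v mod 3 = 1 \<or> v mod 3 = 2" by presburger
  then show ?case using insert by (auto simp: colour_count_insert)
qed (simp add: colour_count_def)

text \<open>A window is described by its numbers \<open>a\<close>, \<open>b\<close>, \<open>c\<close> of vertices of the three colours, and \<open>J\<close> selects
  the edges. The function \<open>pivot\<close> names a colour for each type of window. When two consecutive windows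
  have different types, the pivots have to agree and to differ from the two colours that are
  exchanged. So the pivot is constant along a tight cycle, and entering and leaving vertices agree on
  whether they have the pivot colour. By periodicity \<open>k div gcd k l\<close> then divides the number of
  vertices of the pivot colour in a window, which the last assumption excludes.\<close>

lemma three_colour_lower:
  fixes J :: "nat \<Rightarrow> nat \<Rightarrow> nat \<Rightarrow> bool" and pivot :: "nat \<Rightarrow> nat \<Rightarrow> nat \<Rightarrow> nat"
  assumes k: "1 \<le> k" "k < l" and \<epsilon>: "0 < (\<epsilon> :: real)"
    and cover: "\<And>a b c. a + b + c + 1 = k \<Longrightarrow> J (a + 1) b c \<or> J a (b + 1) c \<or> J a b (c + 1)"
    and adj01: "\<And>a b c. a + b + c + 1 = k \<Longrightarrow> J (a + 1) b c \<Longrightarrow> J a (b + 1) c \<Longrightarrow>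
        pivot (a + 1) b c = 2 \<and> pivot a (b + 1) c = 2"
    and adj02: "\<And>a b c. a + b + c + 1 = k \<Longrightarrow> J (a + 1) b c \<Longrightarrow> J a b (c + 1) \<Longrightarrow>
        pivot (a + 1) b c = 1 \<and> pivot a b (c + 1) = 1"
    and adj12: "\<And>a b c. a + b + c + 1 = k \<Longrightarrow> J a (b + 1) c \<Longrightarrow> J a b (c + 1) \<Longrightarrow>
        pivot a (b + 1) c = 0 \<and> pivot a b (c + 1) = 0"
    and ndvd: "\<And>a b c. a + b + c = k \<Longrightarrow> J a b c \<Longrightarrow>
        pivot a b c = 0 \<and> \<not> k div gcd k l dvd a \<or> pivot a b c = 1 \<and> \<not> k div gcd k l dvd b \<or>
        pivot a b c = 2 \<and> \<not> k div gcd k l dvd c"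
  shows "\<forall>\<^sub>F n in sequentially. 1 / 3 - \<epsilon> \<le> ex_ratio k (tight_cycle k l) n"
proof -
  let ?P = "\<lambda>e. J (colour_count e 0) (colour_count e 1) (colour_count e 2)"
  have "\<forall>\<^sub>F n in sequentially. 1 / real 3 - \<epsilon> \<le> ex_ratio k (tight_cycle k l) n"
  proof (rule residue_construction[where P = ?P])
    show "0 < (3 :: nat)" "1 \<le> k" "k < l" "0 < \<epsilon>" using assms by auto
  next
    fix S :: "nat set" assume S: "finite S" "card S = k - 1"
    let ?a = "colour_count S 0" and ?b = "colour_count S 1" and ?c = "colour_count S 2"
    have "?a + ?b + ?c + 1 = k" using colour_count_sum[OF S(1)] S(2) k(1) by simp
    from cover[OF this] show "\<exists>c<3. \<forall>v. v \<notin> S \<longrightarrow> v mod 3 = c \<longrightarrow> ?P (insert v S)"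
    proof (elim disjE)
      assume "J (?a + 1) ?b ?c"
      then show ?thesis using S(1) by (intro exI[of _ 0]) (auto simp: colour_count_insert)
    next
      assume "J ?a (?b + 1) ?c"
      then show ?thesis using S(1) by (intro exI[of _ 1]) (auto simp: colour_count_insert)
    next
      assume "J ?a ?b (?c + 1)"
      then show ?thesis using S(1) by (intro exI[of _ 2]) (auto simp: colour_count_insert)
    qed
  next
    fix x :: "nat \<Rightarrow> nat"
    assume per: "\<And>i. x (i + l) = x i" and inj: "\<And>i. inj_on x {i..<i + k}"
      and J: "\<And>i. ?P (x ` {i..<i + k})"
    define w where "w c i = (if x i mod 3 = c then 1 else 0 :: nat)" for c i
    define T where "T c i = (\<Sum>j<k. w c (i + j))" for c i
    have T: "colour_count (x ` {i..<i + k}) c = T c i" for c i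
      unfolding colour_count_def T_def w_def by (rule sum_window_image[OF inj])
    have JT: "J (T 0 i) (T 1 i) (T 2 i)" for i using J[of i] unfolding T .
    have sumT: "T 0 i + T 1 i + T 2 i = k" for i
      using colour_count_sum[of "x ` {i..<i + k}"] card_image[OF inj[of i]] unfolding T by simp
    define q where "q i = pivot (T 0 i) (T 1 i) (T 2 i)" for i
    have step: "q (Suc i) = q i \<and> w (q i) (i + k) = w (q i) i" for i
    proof -
      define s where "s c = (\<Sum>j<k - 1. w c (Suc i + j))" for c
      have Ti: "T c i = s c + w c i" for c
      proof -
        have "T c i = (\<Sum>j<Suc (k - 1). w c (i + j))" using k(1) by (simp add: T_def)
        also have "\<dots> = w c i + s c" unfolding s_def by (subst sum.lessThan_Suc_shift) simp
        finally show ?thesis by simp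
      qed
      have Ti': "T c (Suc i) = s c + w c (i + k)" for c
      proof -
        have "T c (Suc i) = (\<Sum>j<Suc (k - 1). w c (Suc i + j))" using k(1) by (simp add: T_def)
        also have "\<dots> = s c + w c (Suc i + (k - 1))" unfolding s_def by simp
        finally show ?thesis using k(1) by simp
      qed
      have m3: "x j mod 3 = 0 \<or> x j mod 3 = 1 \<or> x j mod 3 = 2" for j by presburger
      have ssum: "s 0 + s 1 + s 2 + 1 = k"
        using sumT[of i] m3[of i] unfolding Ti by (auto simp: w_def)
      note J1 = JT[of i, unfolded Ti] and J2 = JT[of "Suc i", unfolded Ti']
      show ?thesis
        using m3[of i] m3[of "i + k"] J1 J2 adj01[OF ssum] adj02[OF ssum] adj12[OF ssum]
        unfolding q_def Ti Ti' by (elim disjE) (auto simp: w_def)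
    qed
    have q0: "q i = q 0" for i by (induction i) (use step in auto)
    have "w (q 0) (i + k) = w (q 0) i" for i using step[of i] unfolding q0[of i] by blast
    moreover have "w (q 0) (i + l) = w (q 0) i" for i by (simp add: w_def per)
    ultimately have "k div gcd k l dvd (\<Sum>j<k. w (q 0) j)"
      using k(1) by (intro quotient_dvd_window_sum) auto
    then have "k div gcd k l dvd T (q 0) 0" by (simp add: T_def)
    then show False using ndvd[OF sumT JT, of 0] unfolding q_def by auto
  qed
  then show ?thesis by simp
qed

lemma mod_3_eqI:
  fixes x t r :: nat
  assumes "x + 3 * s = 3 * t + r" "r < 3"
  shows "x mod 3 = r"
proof -
  have "x mod 3 = (x + 3 * s) mod 3" by simp
  then show ?thesis using assms by simp
qed

lemma not_dvd_near_multiple: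
  fixes m c :: nat
  assumes "1 < m" shows "\<not> m dvd 1" "\<not> m dvd m + 1" "\<not> m dvd 2 * m + 1"
proof -
  show "\<not> m dvd 1" using assms by simp
  then show "\<not> m dvd m + 1" "\<not> m dvd 2 * m + 1"
    using dvd_add_right_iff[of m m 1] dvd_add_right_iff[of m "2 * m" 1] by simp_all
qed

text \<open>All types in the phase \<open>b + 2 * c = 0\<close> modulo 3 except the monochromatic \<open>(m, 0, 0)\<close>, which is
  replaced by \<open>(m - 1, 1, 0)\<close>.\<close>

definition pattern1 :: "nat \<Rightarrow> nat \<Rightarrow> nat \<Rightarrow> nat \<Rightarrow> bool" where
  "pattern1 m a b c \<longleftrightarrow> (b + 2 * c) mod 3 = 0 \<and> a \<noteq> m \<or> b = 1 \<and> c = 0"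

text \<open>The new type \<open>(m - 1, 1, 0)\<close> is adjacent to \<open>(m - 2, 1, 1)\<close> only; they share one vertex of the second colour.
  Every other type is adjacent to no other, and any colour whose count is not divisible by \<open>m\<close> will do.\<close>

definition pivot1 :: "nat \<Rightarrow> nat \<Rightarrow> nat \<Rightarrow> nat \<Rightarrow> nat" where
  "pivot1 m a b c = (if b = 1 \<and> c \<le> 1 then 1 else if m dvd a then 1 else 0)"

lemma pattern1_cover:
  assumes s: "a + b + c + 1 = m"
  shows "pattern1 m (a + 1) b c \<or> pattern1 m a (b + 1) c \<or> pattern1 m a b (c + 1)"
proof -
  have phase: "(b + 1 + 2 * c) mod 3 = 0 \<longleftrightarrow> (b + 2 * c) mod 3 = 2"
    "(b + 2 * (c + 1)) mod 3 = 0 \<longleftrightarrow> (b + 2 * c) mod 3 = 1" by presburger+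
  consider "(b + 2 * c) mod 3 = 0" | "(b + 2 * c) mod 3 = 1" | "(b + 2 * c) mod 3 = 2" by linarith
  then show ?thesis
  proof cases
    case 1
    then show ?thesis using s by (cases "a + 1 = m") (auto simp: pattern1_def)
  qed (use s phase in \<open>auto simp: pattern1_def\<close>)
qed

text \<open>Two different types of the same phase are never adjacent. So one of two adjacent types is new, and
  its phase leaves few possibilities for the other.\<close>

lemma pattern1_adjacent:
  assumes s: "a + b + c + 1 = m"
  shows "\<not> (pattern1 m (a + 1) b c \<and> pattern1 m a (b + 1) c)"
    and "pattern1 m (a + 1) b c \<Longrightarrow> pattern1 m a b (c + 1) \<Longrightarrow> b = 1 \<and> c = 0"
    and "\<not> (pattern1 m a (b + 1) c \<and> pattern1 m a b (c + 1))"
proof -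
  define r where "r = (b + 2 * c) mod 3"
  have r: "(b + 2 * c) mod 3 = 0 \<longleftrightarrow> r = 0" "(b + 1 + 2 * c) mod 3 = 0 \<longleftrightarrow> r = 2"
    "(b + 2 * (c + 1)) mod 3 = 0 \<longleftrightarrow> r = 1"
    unfolding r_def by presburger+
  have e: "b = 1 \<Longrightarrow> c = 0 \<Longrightarrow> r = 1" "b = 0 \<Longrightarrow> c = 0 \<Longrightarrow> r = 0"
    unfolding r_def by simp_all
  have A: "r = 0 \<and> a + 1 \<noteq> m \<or> b = 1 \<and> c = 0 \<and> r = 1" if "pattern1 m (a + 1) b c"
    using that e unfolding pattern1_def r by auto
  have B: "r = 2 \<or> b = 0 \<and> c = 0 \<and> r = 0" if "pattern1 m a (b + 1) c"
    using that e unfolding pattern1_def r by auto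
  have C: "r = 1" if "pattern1 m a b (c + 1)"
    using that unfolding pattern1_def r by auto
  show "\<not> (pattern1 m (a + 1) b c \<and> pattern1 m a (b + 1) c)" using A B s by auto
  show "b = 1 \<and> c = 0" if "pattern1 m (a + 1) b c" "pattern1 m a b (c + 1)"
    using A[OF that(1)] C[OF that(2)] by auto
  show "\<not> (pattern1 m a (b + 1) c \<and> pattern1 m a b (c + 1))" using B C by auto
qed

text \<open>For \<open>k = 2 * m\<close> the types \<open>(2 * m, 0, 0)\<close> and \<open>(0, m, m)\<close> of phase 0 have all counts divisible by
  \<open>m\<close>. The first is replaced by \<open>(2 * m - 1, 1, 0)\<close>, the second by \<open>(0, m + 1, m - 1)\<close> and
  \<open>(0, m - 1, m + 1)\<close>.\<close>

definition pattern2 :: "nat \<Rightarrow> nat \<Rightarrow> nat \<Rightarrow> nat \<Rightarrow> bool" where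
  "pattern2 m a b c \<longleftrightarrow> (b + 2 * c) mod 3 = 0 \<and> a \<noteq> 2 * m \<and> \<not> (a = 0 \<and> b = m) \<or> b = 1 \<and> c = 0 \<or>
     a = 0 \<and> (b = m + 1 \<or> c = m + 1)"

text \<open>Each new type is adjacent to exactly one old one, and they agree in a count equal to 1 or \<open>m + 1\<close>.\<close>

definition pivot2 :: "nat \<Rightarrow> nat \<Rightarrow> nat \<Rightarrow> nat \<Rightarrow> nat" where
  "pivot2 m a b c = (if b = 1 \<and> c \<le> 1 then 1 else if b = m + 1 \<and> a \<le> 1 then 1
     else if c = m + 1 \<and> a \<le> 1 then 2 else if m dvd a then 1 else 0)"

lemma pattern2_cover:
  assumes s: "a + b + c + 1 = 2 * m"
  shows "pattern2 m (a + 1) b c \<or> pattern2 m a (b + 1) c \<or> pattern2 m a b (c + 1)"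
proof -
  have phase: "(b + 1 + 2 * c) mod 3 = 0 \<longleftrightarrow> (b + 2 * c) mod 3 = 2"
    "(b + 2 * (c + 1)) mod 3 = 0 \<longleftrightarrow> (b + 2 * c) mod 3 = 1" by presburger+
  consider "(b + 2 * c) mod 3 = 0" | "(b + 2 * c) mod 3 = 1" | "(b + 2 * c) mod 3 = 2" by linarith
  then show ?thesis
  proof cases
    case 1
    then show ?thesis using s by (cases "a + 1 = 2 * m") (auto simp: pattern2_def)
  next
    case 2
    then show ?thesis using s phase by (cases "a = 0 \<and> b = m") (auto simp: pattern2_def)
  next
    case 3
    then show ?thesis using s phase by (cases "a = 0 \<and> b + 1 = m") (auto simp: pattern2_def)
  qed
qed

lemma pattern2_adjacent:
  assumes m: "1 < m" and s: "a + b + c + 1 = 2 * m"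
  shows "pattern2 m (a + 1) b c \<Longrightarrow> pattern2 m a (b + 1) c \<Longrightarrow> a = 0 \<and> c = m + 1"
    and "pattern2 m (a + 1) b c \<Longrightarrow> pattern2 m a b (c + 1) \<Longrightarrow> b = 1 \<and> c = 0 \<or> a = 0 \<and> b = m + 1"
    and "\<not> (pattern2 m a (b + 1) c \<and> pattern2 m a b (c + 1))"
proof -
  define r where "r = (b + 2 * c) mod 3"
  have r: "(b + 2 * c) mod 3 = 0 \<longleftrightarrow> r = 0" "(b + 1 + 2 * c) mod 3 = 0 \<longleftrightarrow> r = 2"
    "(b + 2 * (c + 1)) mod 3 = 0 \<longleftrightarrow> r = 1"
    unfolding r_def by presburger+
  have e: "b = 1 \<Longrightarrow> c = 0 \<Longrightarrow> r = 1" "b = 0 \<Longrightarrow> c = 0 \<Longrightarrow> r = 0"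
    "a = 0 \<Longrightarrow> b = m \<Longrightarrow> r = 1" "a = 0 \<Longrightarrow> c = m + 1 \<Longrightarrow> r = 0"
    "a = 0 \<Longrightarrow> b = m + 1 \<Longrightarrow> r = 0" "a = 0 \<Longrightarrow> c = m \<Longrightarrow> r = 2"
    unfolding r_def using s by presburger+
  have A: "r = 0 \<and> a + 1 \<noteq> 2 * m \<or> b = 1 \<and> c = 0 \<and> r = 1" if "pattern2 m (a + 1) b c"
    using that e unfolding pattern2_def r by auto
  have B: "r = 2 \<and> \<not> (a = 0 \<and> b + 1 = m) \<or> b = 0 \<and> c = 0 \<and> r = 0 \<or> a = 0 \<and> b = m \<and> r = 1 \<or>
     a = 0 \<and> c = m + 1 \<and> r = 0" if "pattern2 m a (b + 1) c"
    using that e unfolding pattern2_def r by auto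
  have C: "r = 1 \<and> \<not> (a = 0 \<and> b = m) \<or> a = 0 \<and> b = m + 1 \<and> r = 0 \<or> a = 0 \<and> c = m \<and> r = 2"
    if "pattern2 m a b (c + 1)"
    using that e unfolding pattern2_def r by auto
  show "a = 0 \<and> c = m + 1" if J: "pattern2 m (a + 1) b c" "pattern2 m a (b + 1) c"
    using A[OF J(1)] B[OF J(2)]
  proof (elim disjE conjE)
    assume "a + 1 \<noteq> 2 * m" "b = 0" "c = 0"
    then show ?thesis using s by simp
  qed (use m in simp_all)
  show "b = 1 \<and> c = 0 \<or> a = 0 \<and> b = m + 1" if J: "pattern2 m (a + 1) b c" "pattern2 m a b (c + 1)"
    using A[OF J(1)] C[OF J(2)] m by (elim disjE conjE) simp_all
  show "\<not> (pattern2 m a (b + 1) c \<and> pattern2 m a b (c + 1))"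
  proof (rule notI, elim conjE)
    assume J: "pattern2 m a (b + 1) c" "pattern2 m a b (c + 1)"
    show False
      using B[OF J(1)] C[OF J(2)]
    proof (elim disjE conjE)
      assume "a = 0" "c = m" "\<not> (a = 0 \<and> b + 1 = m)"
      then show ?thesis using s by simp
    qed (use m s in simp_all)
  qed
qed

text \<open>For \<open>k = 3 * m\<close> the phase is 1, where the types with all counts divisible by \<open>m\<close> are the three
  cyclic shifts of \<open>(2 * m, m, 0)\<close>. Each is replaced by its two neighbours without the missing colour,
  \<open>(2 * m + 1, m - 1, 0)\<close> and \<open>(2 * m - 1, m + 1, 0)\<close> and their shifts. In phase 0 the type
  \<open>(m, m, m)\<close> would be bad, and no colour is missing there.\<close>

definition pattern3 :: "nat \<Rightarrow> nat \<Rightarrow> nat \<Rightarrow> nat \<Rightarrow> bool" where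
  "pattern3 m a b c \<longleftrightarrow>
     (b + 2 * c) mod 3 = 1 \<and> \<not> (a = 2 * m \<and> b = m) \<and> \<not> (b = 2 * m \<and> c = m) \<and> \<not> (c = 2 * m \<and> a = m) \<or>
     c = 0 \<and> (a = 2 * m + 1 \<or> b = m + 1) \<or> a = 0 \<and> (b = 2 * m + 1 \<or> c = m + 1) \<or>
     b = 0 \<and> (c = 2 * m + 1 \<or> a = m + 1)"

text \<open>Each new type is adjacent to exactly one old one, and they agree in a count equal to \<open>m + 1\<close> or
  \<open>2 * m + 1\<close>.\<close>

definition pivot3 :: "nat \<Rightarrow> nat \<Rightarrow> nat \<Rightarrow> nat \<Rightarrow> nat" where
  "pivot3 m a b c = (if a = 2 * m + 1 \<or> a = m + 1 \<and> b \<le> 1 then 0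
     else if b = 2 * m + 1 \<or> b = m + 1 \<and> c \<le> 1 then 1
     else if c = 2 * m + 1 \<or> c = m + 1 \<and> a \<le> 1 then 2 else if m dvd a then 1 else 0)"

text \<open>Cyclic symmetry of the colours reduces the three kinds of adjacency to one.\<close>

lemma pattern3_rotate: "a + b + c = 3 * m \<Longrightarrow> pattern3 m a b c = pattern3 m b c a"
proof -
  assume s: "a + b + c = 3 * m"
  then have "b + 2 * c + 3 * (2 * m) = c + 2 * a + 3 * (b + c)" by simp
  then have "(b + 2 * c + 3 * (2 * m)) mod 3 = (c + 2 * a + 3 * (b + c)) mod 3" by (rule arg_cong)
  then have "(b + 2 * c) mod 3 = (c + 2 * a) mod 3" by (simp only: mod_mult_self2)
  then show ?thesis unfolding pattern3_def by auto
qed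

lemma pattern3_cover:
  assumes s: "a + b + c + 1 = 3 * m"
  shows "pattern3 m (a + 1) b c \<or> pattern3 m a (b + 1) c \<or> pattern3 m a b (c + 1)"
proof -
  have phase: "(b + 1 + 2 * c) mod 3 = 1 \<longleftrightarrow> (b + 2 * c) mod 3 = 0"
    "(b + 2 * (c + 1)) mod 3 = 1 \<longleftrightarrow> (b + 2 * c) mod 3 = 2" by presburger+
  consider "(b + 2 * c) mod 3 = 0" | "(b + 2 * c) mod 3 = 1" | "(b + 2 * c) mod 3 = 2" by linarith
  then show ?thesis
  proof cases
    case 1
    consider "a = 2 * m \<and> b + 1 = m" | "b + 1 = 2 * m \<and> c = m" | "\<not> (a = 2 * m \<and> b + 1 = m)" "\<not> (b + 1 = 2 * m \<and> c = m)" by blast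
    then show ?thesis
    proof cases
      case 1
      then have "c = 0" using s by linarith
      with 1 have "pattern3 m (a + 1) b c" unfolding pattern3_def by simp
      then show ?thesis by blast
    next
      case 2
      then have "a = 0" using s by linarith
      with 2 have "pattern3 m a b (c + 1)" unfolding pattern3_def by simp
      then show ?thesis by blast
    next
      case 3
      moreover have "(b + 1 + 2 * c) mod 3 = 1" using \<open>(b + 2 * c) mod 3 = 0\<close> phase by simp
      moreover have "\<not> (c = 2 * m \<and> a = m)" using s by linarith
      ultimately have "pattern3 m a (b + 1) c" unfolding pattern3_def by blast
      then show ?thesis by blast
    qed
  next
    case 2
    consider "a + 1 = 2 * m \<and> b = m" | "c = 2 * m \<and> a + 1 = m" | "\<not> (a + 1 = 2 * m \<and> b = m)" "\<not> (c = 2 * m \<and> a + 1 = m)" by blast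
    then show ?thesis
    proof cases
      case 1
      then have "c = 0" using s by linarith
      with 1 have "pattern3 m a (b + 1) c" unfolding pattern3_def by simp
      then show ?thesis by blast
    next
      case 2
      then have "b = 0" using s by linarith
      with 2 have "pattern3 m a b (c + 1)" unfolding pattern3_def by simp
      then show ?thesis by blast
    next
      case 3
      moreover have "(b + 2 * c) mod 3 = 1" using \<open>(b + 2 * c) mod 3 = 1\<close> phase by simp
      moreover have "\<not> (b = 2 * m \<and> c = m)" using s by linarith
      ultimately have "pattern3 m (a + 1) b c" unfolding pattern3_def by blast
      then show ?thesis by blast
    qed
  next
    case 3
    consider "b = 2 * m \<and> c + 1 = m" | "c + 1 = 2 * m \<and> a = m" | "\<not> (b = 2 * m \<and> c + 1 = m)" "\<not> (c + 1 = 2 * m \<and> a = m)" by blast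
    then show ?thesis
    proof cases
      case 1
      then have "a = 0" using s by linarith
      with 1 have "pattern3 m a (b + 1) c" unfolding pattern3_def by simp
      then show ?thesis by blast
    next
      case 2
      then have "b = 0" using s by linarith
      with 2 have "pattern3 m (a + 1) b c" unfolding pattern3_def by simp
      then show ?thesis by blast
    next
      case 3
      moreover have "(b + 2 * (c + 1)) mod 3 = 1" using \<open>(b + 2 * c) mod 3 = 2\<close> phase by simp
      moreover have "\<not> (a = 2 * m \<and> b = m)" using s by linarith
      ultimately have "pattern3 m a b (c + 1)" unfolding pattern3_def by blast
      then show ?thesis by blast
    qed
  qed
qed

lemma pattern3_adjacent:
  assumes s: "a + b + c + 1 = 3 * m" and A: "pattern3 m (a + 1) b c" and B: "pattern3 m a (b + 1) c"
    and q: "m = 3 * u + 1" "3 < m"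
  shows "a = 0 \<and> c = m + 1 \<or> b = 0 \<and> c = 2 * m + 1"
proof -
  define r where "r = (b + 2 * c) mod 3"
  have r: "(b + 2 * c) mod 3 = 1 \<longleftrightarrow> r = 1" "(b + 1 + 2 * c) mod 3 = 1 \<longleftrightarrow> r = 0"
    unfolding r_def by presburger+
  have rI: "r = x" if "b + 2 * c + 3 * y = 3 * t + x" "x < 3" for x y t
    unfolding r_def using that by (rule mod_3_eqI)
  have e: "c = 0 \<Longrightarrow> a = 2 * m \<Longrightarrow> r = 0"
    "c = 0 \<Longrightarrow> b = m + 1 \<Longrightarrow> r = 2"
    "b = 0 \<Longrightarrow> c = 2 * m + 1 \<Longrightarrow> r = 0"
    "b = 0 \<Longrightarrow> a = m \<Longrightarrow> r = 2"
    "c = 0 \<Longrightarrow> a = 2 * m + 1 \<Longrightarrow> r = 2"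
    "c = 0 \<Longrightarrow> b = m \<Longrightarrow> r = 1"
    "a = 0 \<Longrightarrow> b = 2 * m \<Longrightarrow> r = 2"
    "a = 0 \<Longrightarrow> c = m + 1 \<Longrightarrow> r = 1"
    using s q rI[of 0 "u" 0] rI[of 0 "u" 2] rI[of 0 "4 * u + 2" 0] rI[of 0 "4 * u" 2] rI[of 1 "u" 2] rI[of 0 "u" 1] rI[of 0 "4 * u" 2] rI[of 0 "4 * u + 1" 1] by simp_all
  have A': "r = 1 \<and> \<not> (a + 1 = 2 * m \<and> b = m) \<or> c = 0 \<and> a = 2 * m \<and> r = 0 \<or> c = 0 \<and> b = m + 1 \<and> r = 2 \<or>
     b = 0 \<and> c = 2 * m + 1 \<and> r = 0 \<or> b = 0 \<and> a = m \<and> r = 2"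
    using A e(1-4) unfolding pattern3_def r by auto
  have B': "r = 0 \<and> \<not> (a = 2 * m \<and> b + 1 = m) \<or> c = 0 \<and> a = 2 * m + 1 \<and> r = 2 \<or> c = 0 \<and> b = m \<and> r = 1 \<or>
     a = 0 \<and> b = 2 * m \<and> r = 2 \<or> a = 0 \<and> c = m + 1 \<and> r = 1"
    using B e(5-8) unfolding pattern3_def r by auto
  show ?thesis using A' B' s q(2) by (elim disjE conjE) auto
qed

text \<open>If two of the three counts are divisible by \<open>m\<close>, so is the third.\<close>

lemma multiples_of_quotient:
  fixes m :: nat
  assumes "a + b + c = d * m" "m dvd a" "m dvd b" "0 < m"
  obtains x y z where "a = x * m" "b = y * m" "c = z * m" "x + y + z = d"
proof -
  obtain x y where xy: "a = x * m" "b = y * m" using assms(2,3) by (metis dvd_def mult.commute)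
  have le: "(x + y) * m \<le> d * m" using assms(1) xy by (simp add: add_mult_distrib)
  then have "x + y \<le> d" using assms(4) by simp
  moreover have "c = (d - (x + y)) * m" using assms(1) xy by (simp add: diff_mult_distrib add_mult_distrib)
  ultimately show ?thesis using that[of x y "d - (x + y)"] xy by simp
qed

lemma pivot1_not_dvd:
  assumes m: "1 < m" "m mod 3 = 1" and s: "a + b + c = m" and J: "pattern1 m a b c"
  shows "pivot1 m a b c = 0 \<and> \<not> m dvd a \<or> pivot1 m a b c = 1 \<and> \<not> m dvd b \<or> pivot1 m a b c = 2 \<and> \<not> m dvd c"
proof (cases "b = 1 \<and> c \<le> 1")
  case True
  then show ?thesis using not_dvd_near_multiple[OF m(1)] by (simp add: pivot1_def)
next
  case False
  have "\<not> (m dvd a \<and> m dvd b)"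
  proof
    assume "m dvd a \<and> m dvd b"
    then obtain x y z where xyz: "a = x * m" "b = y * m" "c = z * m" "x + y + z = 1"
      using multiples_of_quotient[of a b c 1 m] s m by auto
    then consider "x = 1 \<and> y = 0 \<and> z = 0" | "x = 0 \<and> y = 1 \<and> z = 0" | "x = 0 \<and> y = 0 \<and> z = 1" by linarith
    then show False
      using J m xyz unfolding pattern1_def by cases (auto, presburger+)
  qed
  then show ?thesis using False by (auto simp: pivot1_def)
qed

lemma pivot2_not_dvd:
  assumes m: "1 < m" "m mod 3 = 1" and s: "a + b + c = 2 * m" and J: "pattern2 m a b c"
  shows "pivot2 m a b c = 0 \<and> \<not> m dvd a \<or> pivot2 m a b c = 1 \<and> \<not> m dvd b \<or> pivot2 m a b c = 2 \<and> \<not> m dvd c"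
proof (cases "b = 1 \<and> c \<le> 1 \<or> b = m + 1 \<and> a \<le> 1 \<or> c = m + 1 \<and> a \<le> 1")
  case True
  then show ?thesis using not_dvd_near_multiple[OF m(1)] by (auto simp: pivot2_def)
next
  case False
  have "\<not> (m dvd a \<and> m dvd b)"
  proof
    assume "m dvd a \<and> m dvd b"
    then obtain x y z where xyz: "a = x * m" "b = y * m" "c = z * m" "x + y + z = 2"
      using multiples_of_quotient[of a b c 2 m] s m by auto
    have "(b + 2 * c) mod 3 = (y + 2 * z) mod 3"
    proof -
      have "b + 2 * c = (y + 2 * z) * m" using xyz by (simp add: algebra_simps)
      then show ?thesis using m(2) mod_mult_right_eq[of "y + 2 * z" m 3] by simp
    qed
    moreover have "(b + 2 * c) mod 3 = 0 \<and> a \<noteq> 2 * m \<and> \<not> (a = 0 \<and> b = m)"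
      using J False unfolding pattern2_def by auto
    moreover have "x \<noteq> 2" "\<not> (x = 0 \<and> y = 1)" using calculation xyz by auto
    ultimately have "(y + 2 * z) mod 3 = 0" by simp
    moreover have "y + 2 * z \<le> 4" using xyz(4) by linarith
    ultimately have "y + 2 * z = 0 \<or> y + 2 * z = 3 \<or> y + 2 * z = 6" by presburger
    then show False
      using xyz(4) \<open>y + 2 * z \<le> 4\<close> \<open>x \<noteq> 2\<close> \<open>\<not> (x = 0 \<and> y = 1)\<close> by presburger
  qed
  then show ?thesis using False by (auto simp: pivot2_def)
qed

text \<open>A type of the phase with all counts divisible by \<open>m\<close> is \<open>m\<close> times a type of total 3, and as
  \<open>m = 1\<close> modulo 3 that type is in the phase too; the only such types are the deleted ones.\<close>

lemma pivot3_not_dvd: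
  assumes m: "1 < m" "m mod 3 = 1" and s: "a + b + c = 3 * m" and J: "pattern3 m a b c"
  shows "pivot3 m a b c = 0 \<and> \<not> m dvd a \<or> pivot3 m a b c = 1 \<and> \<not> m dvd b \<or> pivot3 m a b c = 2 \<and> \<not> m dvd c"
proof (cases "a = 2 * m + 1 \<or> a = m + 1 \<and> b \<le> 1 \<or> b = 2 * m + 1 \<or> b = m + 1 \<and> c \<le> 1 \<or>
    c = 2 * m + 1 \<or> c = m + 1 \<and> a \<le> 1")
  case True
  then show ?thesis using not_dvd_near_multiple[OF m(1)] by (auto simp: pivot3_def)
next
  case False
  have "\<not> (m dvd a \<and> m dvd b)"
  proof
    assume "m dvd a \<and> m dvd b"
    then obtain x y z where xyz: "a = x * m" "b = y * m" "c = z * m" "x + y + z = 3"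
      using multiples_of_quotient[of a b c 3 m] s m by auto
    have e1: "(b + 2 * c) mod 3 = (y + 2 * z) mod 3"
    proof -
      have "b + 2 * c = (y + 2 * z) * m" using xyz by (simp add: algebra_simps)
      then show ?thesis using m(2) mod_mult_right_eq[of "y + 2 * z" m 3] by simp
    qed
    have e2: "(b + 2 * c) mod 3 = 1 \<and> \<not> (a = 2 * m \<and> b = m) \<and> \<not> (b = 2 * m \<and> c = m) \<and> \<not> (c = 2 * m \<and> a = m)"
      using J False unfolding pattern3_def by auto
    have n: "\<not> (x = 2 \<and> y = 1)" "\<not> (y = 2 \<and> z = 1)" "\<not> (z = 2 \<and> x = 1)"
      using e2 xyz(1-3) by auto
    have "(y + 2 * z) mod 3 = 1" using e1 e2 by metis
    moreover have "y + 2 * z \<le> 6" using xyz(4) by linarith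
    ultimately have "y + 2 * z = 1 \<or> y + 2 * z = 4" by presburger
    then have "y = 1 \<and> z = 0 \<or> y = 4 \<and> z = 0 \<or> y = 2 \<and> z = 1 \<or> y = 0 \<and> z = 2" by presburger
    then show False
      using xyz(4) n by auto
  qed
  then show ?thesis using False by (auto simp: pivot3_def)
qed

lemma pattern3_pivot:
  assumes m: "m mod 3 = 1" "3 < m" and s: "a + b + c + 1 = 3 * m"
  shows "pattern3 m (a + 1) b c \<Longrightarrow> pattern3 m a (b + 1) c \<Longrightarrow> pivot3 m (a + 1) b c = 2 \<and> pivot3 m a (b + 1) c = 2"
    and "pattern3 m (a + 1) b c \<Longrightarrow> pattern3 m a b (c + 1) \<Longrightarrow> pivot3 m (a + 1) b c = 1 \<and> pivot3 m a b (c + 1) = 1"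
    and "pattern3 m a (b + 1) c \<Longrightarrow> pattern3 m a b (c + 1) \<Longrightarrow> pivot3 m a (b + 1) c = 0 \<and> pivot3 m a b (c + 1) = 0"
proof -
  define u where "u = m div 3"
  have u: "m = 3 * u + 1" using m(1) mult_div_mod_eq[of 3 m] by (simp add: u_def)
  note adj = pattern3_adjacent[OF _ _ _ u m(2)]
  show "pivot3 m (a + 1) b c = 2 \<and> pivot3 m a (b + 1) c = 2" if J: "pattern3 m (a + 1) b c" "pattern3 m a (b + 1) c"
    using adj[OF s J] s m(2) by (elim disjE conjE) (simp_all add: pivot3_def)
  show "pivot3 m (a + 1) b c = 1 \<and> pivot3 m a b (c + 1) = 1" if J: "pattern3 m (a + 1) b c" "pattern3 m a b (c + 1)"
  proof -
    have "pattern3 m (c + 1) a b" "pattern3 m c (a + 1) b"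
      using J pattern3_rotate[of "c + 1" a b m] pattern3_rotate[of c "a + 1" b m] s by simp_all
    then have "c = 0 \<and> b = m + 1 \<or> a = 0 \<and> b = 2 * m + 1" using adj[of c a b] s by simp
    then show ?thesis using s m(2) by (elim disjE conjE) (simp_all add: pivot3_def)
  qed
  show "pivot3 m a (b + 1) c = 0 \<and> pivot3 m a b (c + 1) = 0" if J: "pattern3 m a (b + 1) c" "pattern3 m a b (c + 1)"
  proof -
    have "pattern3 m (b + 1) c a" "pattern3 m b (c + 1) a"
      using J pattern3_rotate[of a "b + 1" c m] pattern3_rotate[of a b "c + 1" m] s by simp_all
    then have "b = 0 \<and> a = m + 1 \<or> c = 0 \<and> a = 2 * m + 1" using adj[of b c a] s by simp
    then show ?thesis using s m(2) by (elim disjE conjE) (simp_all add: pivot3_def)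
  qed
qed

lemma one_third_lower:
  assumes k: "1 \<le> k" "k < l" and i: "gcd k l = i" "i \<in> {1, 2, 3}" "k = i * m"
    and m: "m mod 3 = 1" "3 < m" and \<epsilon>: "0 < (\<epsilon> :: real)"
  shows "\<forall>\<^sub>F n in sequentially. 1 / 3 - \<epsilon> \<le> ex_ratio k (tight_cycle k l) n"
proof -
  have q: "k div gcd k l = m" using i by auto
  have m1: "1 < m" using m by simp
  consider "i = 1" | "i = 2" | "i = 3" using i(2) by auto
  then show ?thesis
  proof cases
    case 1
    then have km: "k = m" using i by simp
    show ?thesis
    proof (rule three_colour_lower[where J = "pattern1 m" and pivot = "pivot1 m", OF k \<epsilon>], unfold q, unfold km)
      fix a b c assume s: "a + b + c + 1 = m"
      show "pattern1 m (a + 1) b c \<or> pattern1 m a (b + 1) c \<or> pattern1 m a b (c + 1)" by (rule pattern1_cover[OF s])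
      show "pivot1 m (a + 1) b c = 2 \<and> pivot1 m a (b + 1) c = 2" if "pattern1 m (a + 1) b c" "pattern1 m a (b + 1) c"
        using pattern1_adjacent(1)[OF s] that by blast
      show "pivot1 m (a + 1) b c = 1 \<and> pivot1 m a b (c + 1) = 1" if "pattern1 m (a + 1) b c" "pattern1 m a b (c + 1)"
        using pattern1_adjacent(2)[OF s that] by (simp add: pivot1_def)
      show "pivot1 m a (b + 1) c = 0 \<and> pivot1 m a b (c + 1) = 0" if "pattern1 m a (b + 1) c" "pattern1 m a b (c + 1)"
        using pattern1_adjacent(3)[OF s] that by blast
    qed (rule pivot1_not_dvd[OF m1 m(1)])
  next
    case 2
    then have km: "k = 2 * m" using i by simp
    show ?thesis
    proof (rule three_colour_lower[where J = "pattern2 m" and pivot = "pivot2 m", OF k \<epsilon>], unfold q, unfold km)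
      fix a b c assume s: "a + b + c + 1 = 2 * m"
      show "pattern2 m (a + 1) b c \<or> pattern2 m a (b + 1) c \<or> pattern2 m a b (c + 1)" by (rule pattern2_cover[OF s])
      show "pivot2 m (a + 1) b c = 2 \<and> pivot2 m a (b + 1) c = 2" if "pattern2 m (a + 1) b c" "pattern2 m a (b + 1) c"
        using pattern2_adjacent(1)[OF m1 s that] s m(2) by (simp add: pivot2_def)
      show "pivot2 m (a + 1) b c = 1 \<and> pivot2 m a b (c + 1) = 1" if "pattern2 m (a + 1) b c" "pattern2 m a b (c + 1)"
        using pattern2_adjacent(2)[OF m1 s that] by (auto simp: pivot2_def)
      show "pivot2 m a (b + 1) c = 0 \<and> pivot2 m a b (c + 1) = 0" if "pattern2 m a (b + 1) c" "pattern2 m a b (c + 1)"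
        using pattern2_adjacent(3)[OF m1 s] that by blast
    qed (rule pivot2_not_dvd[OF m1 m(1)])
  next
    case 3
    then have km: "k = 3 * m" using i by simp
    show ?thesis
    proof (rule three_colour_lower[where J = "pattern3 m" and pivot = "pivot3 m", OF k \<epsilon>], unfold q, unfold km)
      fix a b c assume s: "a + b + c + 1 = 3 * m"
      show "pattern3 m (a + 1) b c \<or> pattern3 m a (b + 1) c \<or> pattern3 m a b (c + 1)" by (rule pattern3_cover[OF s])
      show "pivot3 m (a + 1) b c = 2 \<and> pivot3 m a (b + 1) c = 2" if "pattern3 m (a + 1) b c" "pattern3 m a (b + 1) c"
        by (rule pattern3_pivot(1)[OF m s that])
      show "pivot3 m (a + 1) b c = 1 \<and> pivot3 m a b (c + 1) = 1" if "pattern3 m (a + 1) b c" "pattern3 m a b (c + 1)"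
        by (rule pattern3_pivot(2)[OF m s that])
      show "pivot3 m a (b + 1) c = 0 \<and> pivot3 m a b (c + 1) = 0" if "pattern3 m a (b + 1) c" "pattern3 m a b (c + 1)"
        by (rule pattern3_pivot(3)[OF m s that])
    qed (rule pivot3_not_dvd[OF m1 m(1)])
  qed
qed

section \<open>Densities of tight cycles\<close>

text \<open>The hypotheses on the small hypergraph are strict, whereas samples lose an arbitrarily small part of
  the codegree; half of \<open>\<epsilon>\<close> is spent on this loss.\<close>

lemma density_upper_from_closed_walks:
  fixes \<theta> k l :: nat
  assumes k: "3 \<le> k" "k < l" and \<theta>: "2 \<le> \<theta>"
    and walk: "\<And>N E. kgraph {..<N} E k \<Longrightarrow> E \<noteq> {} \<Longrightarrow>
        (\<And>S. S \<subseteq> {..<N} \<Longrightarrow> card S = k - 1 \<Longrightarrow> N < \<theta> * card (kgraph.nbh E S)) \<Longrightarrow>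
        kgraph.closed_walk E k l"
  shows "codegree_density k (tight_cycle k l) \<le> 1 / \<theta>"
proof (rule codegree_density_upper[where \<delta> = "1 / 2"])
  show "edges (tight_cycle k l) \<noteq> {}" using k by (intro tight_cycle_nonempty) simp
  show "0 < (1 / 2 :: real)" by simp
  fix \<epsilon> :: real assume \<epsilon>: "0 < \<epsilon>" "\<epsilon> < 1 / 2"
  have \<theta>': "1 / real \<theta> \<le> 1 / 2" using \<theta> by (simp add: field_simps)
  have "\<exists>n0. \<forall>G :: nat hypergraph. uniform_hypergraph k G \<and> n0 \<le> card (vertices G) \<and>
      (\<forall>S\<subseteq>vertices G. card S = k - 1 \<longrightarrow> (1 / \<theta> + \<epsilon>) * card (vertices G) \<le> codegree G S) \<longrightarrow>
      contains_copy G (tight_cycle k l)"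
  proof (rule hom_threshold_copy[where \<beta> = "1 / \<theta> + \<epsilon> / 2" and ?N1.0 = k])
    show "finite (vertices (tight_cycle k l))" "vertices (tight_cycle k l) \<noteq> {}"
      using k by (auto simp: tight_cycle_def)
    show "e \<subseteq> vertices (tight_cycle k l) \<and> card e = k" if "e \<in> edges (tight_cycle k l)" for e
      using k that by (intro tight_cycle_wf) auto
    show "1 / real \<theta> + \<epsilon> / 2 < 1 / real \<theta> + \<epsilon>" "1 / real \<theta> + \<epsilon> \<le> 1" using \<epsilon> \<theta>' by simp_all
  next
    fix N :: nat and E
    assume N: "k \<le> N" and E: "\<And>e. e \<in> E \<Longrightarrow> e \<subseteq> {..<N} \<and> card e = k"
      and deg: "\<And>I. I \<subseteq> {..<N} \<Longrightarrow> card I = k - 1 \<Longrightarrow> (1 / \<theta> + \<epsilon> / 2) * N \<le> card {j. insert j I \<in> E}"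
    interpret kgraph "{..<N}" E k
      by unfold_locales (use E k in auto)
    have big: "N < \<theta> * card (nbh S)" if S: "S \<subseteq> {..<N}" "card S = k - 1" for S
    proof -
      have "real N / \<theta> < (1 / \<theta> + \<epsilon> / 2) * N" using \<epsilon> N k by (simp add: field_simps)
      also have "\<dots> \<le> card (nbh S)" using deg[OF S] by (simp add: nbh_def)
      finally have "real N < real (\<theta> * card (nbh S))" using \<theta> by (simp add: field_simps)
      then show ?thesis by (simp only: of_nat_less_iff)
    qed
    have "k - 1 \<le> card {..<N}" using N by simp
    then obtain S where S: "S \<subseteq> {..<N}" "card S = k - 1"
      using obtain_subset_with_card_n by metis
    then have "nbh S \<noteq> {}" using big[OF S] by auto
    then have "E \<noteq> {}" by (auto simp: nbh_def)
    then have "closed_walk l" using walk[OF kgraph_axioms _ big] by blast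
    then obtain x where x: "\<And>i. i < l \<Longrightarrow> (\<lambda>j. x ((i + j) mod l)) ` {..<k} \<in> E"
      by (auto simp: closed_walk_def)
    have "x i \<in> {..<N}" if "i < l" for i
    proof -
      have "x ((i + 0) mod l) \<in> (\<lambda>j. x ((i + j) mod l)) ` {..<k}" using k by (intro imageI) auto
      then show ?thesis using E[OF x[OF that]] that by auto
    qed
    then have "x ` vertices (tight_cycle k l) \<subseteq> {..<N}" by (auto simp: tight_cycle_def)
    moreover have "\<forall>e\<in>edges (tight_cycle k l). x ` e \<in> E"
      using x by (auto simp: tight_cycle_edge image_image)
    ultimately show "\<exists>\<phi>. \<phi> ` vertices (tight_cycle k l) \<subseteq> {..<N} \<and>
        (\<forall>e\<in>edges (tight_cycle k l). \<phi> ` e \<in> E)" by blast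
  qed
  then obtain n0 where "\<forall>G :: nat hypergraph. uniform_hypergraph k G \<and> n0 \<le> card (vertices G) \<and>
      (\<forall>S\<subseteq>vertices G. card S = k - 1 \<longrightarrow> (1 / \<theta> + \<epsilon>) * card (vertices G) \<le> codegree G S) \<longrightarrow>
      contains_copy G (tight_cycle k l)" by (rule exE)
  then show "\<forall>\<^sub>F n in sequentially. ex_ratio k (tight_cycle k l) n \<le> 1 / \<theta> + \<epsilon>"
    by (rule ex_ratio_upper[rotated]) (use k in \<open>intro tight_cycle_nonempty, simp\<close>)
qed

lemma density_le_half:
  assumes "admissible k l"
  shows "codegree_density k (tight_cycle k l) \<le> 1 / 2"
proof -
  have k: "3 \<le> k" "k < l" "\<not> k dvd l" "20 * k\<^sup>2 \<le> l" using assms by (auto simp: admissible_def)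
  have "codegree_density k (tight_cycle k l) \<le> 1 / real 2"
  proof (rule density_upper_from_closed_walks[OF k(1,2)])
    fix N and E :: "nat set set"
    assume G: "kgraph {..<N} E k" and E: "E \<noteq> {}"
      and big: "\<And>S. S \<subseteq> {..<N} \<Longrightarrow> card S = k - 1 \<Longrightarrow> N < 2 * card (kgraph.nbh E S)"
    show "kgraph.closed_walk E k l"
    proof (rule ccontr)
      assume "\<not> kgraph.closed_walk E k l"
      then interpret walk_free "{..<N}" E k l
        using G k by (simp add: walk_free_def walk_free_axioms_def)
      show False using half_codegree big E by simp
    qed
  qed simp
  then show ?thesis by simp
qed

lemma density_le_third:
  assumes "admissible k l" "odd (k div gcd k l)"
  shows "codegree_density k (tight_cycle k l) \<le> 1 / 3"
proof -
  have k: "3 \<le> k" "k < l" "\<not> k dvd l" "20 * k\<^sup>2 \<le> l" using assms by (auto simp: admissible_def)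
  have "codegree_density k (tight_cycle k l) \<le> 1 / real 3"
  proof (rule density_upper_from_closed_walks[OF k(1,2)])
    fix N and E :: "nat set set"
    assume G: "kgraph {..<N} E k" and E: "E \<noteq> {}"
      and big: "\<And>S. S \<subseteq> {..<N} \<Longrightarrow> card S = k - 1 \<Longrightarrow> N < 3 * card (kgraph.nbh E S)"
    show "kgraph.closed_walk E k l"
    proof (rule ccontr)
      assume "\<not> kgraph.closed_walk E k l"
      then interpret third_codegree "{..<N}" E k l
        using G k big by (simp add: walk_free_def walk_free_axioms_def
            third_codegree_def third_codegree_axioms_def)
      show False using odd_quotient_contradiction[OF E assms(2)] .
    qed
  qed simp
  then show ?thesis by simp
qed

lemma p_of_properties:
  assumes "admissible k l"
  shows "prime (p_of k l)" "p_of k l dvd k div gcd k l"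
    "\<And>q. prime q \<Longrightarrow> q dvd k div gcd k l \<Longrightarrow> p_of k l \<le> q"
proof -
  let ?m = "k div gcd k l"
  have k: "3 \<le> k" "\<not> k dvd l" using assms by (auto simp: admissible_def)
  have mg: "?m * gcd k l = k" by simp
  have "?m \<noteq> 0" using mg k by (metis mult_0 not_numeral_le_zero)
  moreover have "?m \<noteq> 1" using mg k by (metis gcd_dvd2 mult_1)
  ultimately have "prime_factors ?m \<noteq> {}" by (simp add: prime_factorization_empty_iff)
  then have "p_of k l \<in> prime_factors ?m"
    unfolding p_of_def smallest_prime_factor_def by (intro Min_in) auto
  then show "prime (p_of k l)" "p_of k l dvd ?m" by auto
  fix q assume "prime q" "q dvd ?m"
  then have "q \<in> prime_factors ?m" using \<open>?m \<noteq> 0\<close> by (simp add: prime_factors_dvd)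
  then show "p_of k l \<le> q"
    unfolding p_of_def smallest_prime_factor_def by (intro Min_le) auto
qed

lemma density_ge_inverse_prime:
  assumes "admissible k l"
  shows "1 / p_of k l \<le> codegree_density k (tight_cycle k l)"
proof -
  have k: "3 \<le> k" "k < l" using assms by (auto simp: admissible_def)
  show ?thesis
  proof (rule codegree_density_lower)
    show "edges (tight_cycle k l) \<noteq> {}" using k by (intro tight_cycle_nonempty) simp
    show "\<forall>\<^sub>F n in sequentially. 1 / p_of k l - \<epsilon> \<le> ex_ratio k (tight_cycle k l) n" if "0 < \<epsilon>" for \<epsilon>
      using k p_of_properties(1,2)[OF assms] prime_ge_2_nat that
      by (intro prime_quotient_lower) auto
  qed
qed

text \<open>Here \<open>k = i * m\<close> with \<open>m = 1\<close> modulo 6, so neither 2 nor 3 divides \<open>m\<close>, whereas the density is at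
  least \<open>1 / 3\<close>.\<close>

lemma density_exceeds_inverse_prime:
  assumes i: "i \<in> {1, 2, 3}" and kl: "admissible k l" "[k = i] (mod (6 * i))" "gcd k l = i"
  shows "p_of k l > 3 \<and> codegree_density k (tight_cycle k l) > 1 / real (p_of k l)"
proof -
  have k: "3 \<le> k" "k < l" "\<not> k dvd l" using kl(1) by (auto simp: admissible_def)
  have i0: "0 < i" using i by auto
  define q where "q = k div (6 * i)"
  define m where "m = 6 * q + 1"
  have "k mod (6 * i) = i" using kl(2) i0 by (simp add: cong_def)
  then have "k = 6 * i * q + i" using mult_div_mod_eq[of "6 * i" k] by (simp add: q_def)
  then have km: "k = i * m" by (simp add: m_def algebra_simps)
  have quot: "k div gcd k l = m" using km kl(3) i0 by simp
  have "m \<noteq> 1" using km kl(3) k(3) by (metis gcd_dvd2 mult.right_neutral)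
  then have m: "m mod 3 = 1" "3 < m" unfolding m_def by (presburger, simp)
  note p = p_of_properties[OF kl(1), unfolded quot]
  have "\<not> 2 dvd m" "\<not> 3 dvd m" unfolding m_def by presburger+
  then have "p_of k l \<noteq> 2" "p_of k l \<noteq> 3" using p(2) by metis+
  then have p3: "3 < p_of k l" using prime_ge_2_nat[OF p(1)] by linarith
  have "1 / 3 \<le> codegree_density k (tight_cycle k l)"
  proof (rule codegree_density_lower)
    show "edges (tight_cycle k l) \<noteq> {}" using k by (intro tight_cycle_nonempty) simp
    show "\<forall>\<^sub>F n in sequentially. 1 / 3 - \<epsilon> \<le> ex_ratio k (tight_cycle k l) n" if "0 < \<epsilon>" for \<epsilon>
      using k(1,2) by (intro one_third_lower[OF _ _ kl(3) i km m that]) auto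
  qed
  moreover have "1 / real (p_of k l) < 1 / 3" using p3 by (simp add: field_simps)
  ultimately show ?thesis using p3 by (intro conjI; linarith)
qed

theorem corollary1p5:
  "(\<forall>k l. admissible k l \<and> p_of k l = 2 \<longrightarrow>
       codegree_density k (tight_cycle k l) = 1 / 2) \<and>
   (\<forall>k l. admissible k l \<and> p_of k l = 3 \<longrightarrow>
       codegree_density k (tight_cycle k l) = 1 / 3) \<and>
   infinite {(k, l). admissible k l \<and> p_of k l > 3 \<and>
       codegree_density k (tight_cycle k l) > 1 / real (p_of k l)} \<and>
   (\<forall>i\<in>{1, 2, 3}. \<forall>k l. admissible k l \<and> [k = i] (mod (6 * i)) \<and> gcd k l = i \<longrightarrow>
       p_of k l > 3 \<and> codegree_density k (tight_cycle k l) > 1 / real (p_of k l))"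
proof (intro conjI allI impI ballI)
  fix k l assume "admissible k l \<and> p_of k l = 2"
  then show "codegree_density k (tight_cycle k l) = 1 / 2"
    using density_le_half[of k l] density_ge_inverse_prime[of k l] by simp
next
  fix k l assume kl: "admissible k l \<and> p_of k l = 3"
  then have "\<not> 2 dvd k div gcd k l" using p_of_properties(3)[of k l 2] by auto
  then show "codegree_density k (tight_cycle k l) = 1 / 3"
    using kl density_le_third[of k l] density_ge_inverse_prime[of k l] by simp
next
  let ?X = "{(k, l). admissible k l \<and> p_of k l > 3 \<and>
       codegree_density k (tight_cycle k l) > 1 / real (p_of k l)}"
  have "range (\<lambda>n. (7, 7 * (140 + n) + 1)) \<subseteq> ?X"
  proof (rule image_subsetI)
    fix n :: nat
    let ?l = "7 * (140 + n) + 1"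
    have adm: "admissible 7 ?l" unfolding admissible_def by (simp, presburger)
    have "gcd 7 ?l dvd ?l - 7 * (140 + n)" 
      by (intro dvd_diff_nat dvd_mult2 gcd_dvd1 gcd_dvd2)
    then have "gcd 7 ?l = 1" by simp
    then show "(7, ?l) \<in> ?X"
      using density_exceeds_inverse_prime[of 1 7 ?l] adm by (simp add: cong_def)
  qed
  moreover have "inj (\<lambda>n :: nat. (7 :: nat, 7 * (140 + n) + 1))" by (auto simp: inj_on_def)
  ultimately show "infinite ?X" using infinite_super range_inj_infinite by blast
next
  fix i k l :: nat
  assume "i \<in> {1, 2, 3}" "admissible k l \<and> [k = i] (mod (6 * i)) \<and> gcd k l = i"
  then have *: "p_of k l > 3 \<and> codegree_density k (tight_cycle k l) > 1 / real (p_of k l)"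
    by (intro density_exceeds_inverse_prime) auto
  show "p_of k l > 3" "codegree_density k (tight_cycle k l) > 1 / real (p_of k l)" using * by auto
qed

end
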